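(* Let $X\subset\widehat A$ be an $H$-invariant Borel set and $\mathcal H=\mathcal H_X$. Then $\mathcal H$ has a weakly admissible vector if and only if there exists an $H$-invariant Borel subset $B\subset X$ with $X\setminus B$ of Haar measure zero such that (1) for all $\xi\in B$ the stabilizer $H_\xi=\{h\in H:\xi.h=\xi\}$ is compact, and (2) there exists a Borel set $C\subset B$ such that for every $\xi\in B$ the set $C\cap\xi.H$ consists of exactly one point.
   Context: $A$ is a second countable locally compact abelian group (written additively) with Haar measure $dx$. $H$ is a group of topological automorphisms of $A$, endowed with a second countable locally compact group topology such that $(h,x)\mapsto h(x)$ is continuous. For $h\in H$ let $\delta(h)=|h(B)|/|B|$ for any Borel $B\subset A$ of positive finite Haar measure. $G=A\rtimes H$ is $A\times H$ with product $(a,h)(b,g)=(a+h(b),hg)$ and product topology; its left Haar measure is $dx\,dh/\delta(h)$. The quasi-regular representation $\pi$ on $L^2(A)$ is $\pi(a,h)f(t)=\delta(h)^{-1/2}f(h^{-1}(t-a))$, and $V_\psi f(a,h)=\langle f,\pi(a,h)\psi\rangle$. For a closed $\pi$-invariant subspace $\mathcal H$, $\psi\in\mathcal H$ is weakly admissible for $\mathcal H$ if $f\mapsto V_\psi f$ is a well-defined bounded injective map $\mathcal H\to L^2(G)$. $\widehat A$ is the dual group with Haar (Plancherel) measure normalized so that the Fourier transform $\widehat f(\xi)=\int_A f(x)\overline{\xi(x)}dx$ extends to a unitary $L^2(A)\to L^2(\widehat A)$. $H$ acts on $\widehat A$ from the right by $(\xi.h)(x)=\xi(h(x))$; $\xi.H$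 denotes the orbit. For $H$-invariant Borel $X\subset\widehat A$, $\mathcal H_X=\{f\in L^2(A):\widehat f\mathbf 1_X=\widehat f\}$. *)

theory Defs
  imports "HOL-Analysis.Analysis"
begin

definition lca_group :: "'a::{ab_group_add, t2_space, second_countable_topology} itself \<Rightarrow> bool" where
  "lca_group _ \<longleftrightarrow>
     continuous_on UNIV (\<lambda>p::'a \<times> 'a. fst p + snd p) \<and>
     continuous_on UNIV (uminus :: 'a \<Rightarrow> 'a) \<and>
     locally_compact_space (euclidean :: 'a topology)"

definition borel_of :: "'b topology \<Rightarrow> 'b measure" where
  "borel_of T = sigma (topspace T) {U. openin T U}"

definition haar_measure_A :: "'a::{ab_group_add, topological_space} measure \<Rightarrow> bool" where
  "haar_measure_A M \<longleftrightarrow>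
     sets M = sets borel \<and>
     (\<forall>K. compact K \<longrightarrow> emeasure M K < \<infinity>) \<and>
     (\<forall>U. open U \<and> U \<noteq> {} \<longrightarrow> emeasure M U > 0) \<and>
     (\<forall>a B. B \<in> sets borel \<longrightarrow> emeasure M ((\<lambda>x. a + x) ` B) = emeasure M B)"

definition is_character :: "('a::{ab_group_add, topological_space} \<Rightarrow> complex) \<Rightarrow> bool" where
  "is_character ch \<longleftrightarrow> continuous_on UNIV ch \<and> (\<forall>x y. ch (x + y) = ch x * ch y) \<and> (\<forall>x. cmod (ch x) = 1)"

definition dual_group :: "('a::{ab_group_add, topological_space} \<Rightarrow> complex) set" where
  "dual_group = {ch. is_character ch}"

definition dual_topology :: "('a::{ab_group_add, topological_space} \<Rightarrow> complex) topology" where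
  "dual_topology = topology_generated_by
     {{ch \<in> dual_group. ch ` K \<subseteq> U} | K U. compact K \<and> open U}"

definition L2 :: "'b measure \<Rightarrow> ('b \<Rightarrow> complex) set" where
  "L2 N = {f. f \<in> borel_measurable N \<and> integrable N (\<lambda>x. (cmod (f x))\<^sup>2)}"

definition L2norm :: "'b measure \<Rightarrow> ('b \<Rightarrow> complex) \<Rightarrow> real" where
  "L2norm N f = sqrt (\<integral>x. (cmod (f x))\<^sup>2 \<partial>N)"

definition L1 :: "'b measure \<Rightarrow> ('b \<Rightarrow> complex) set" where
  "L1 N = {f. integrable N f}"

definition fourier1 :: "'a measure \<Rightarrow> ('a \<Rightarrow> complex) \<Rightarrow> ('a \<Rightarrow> complex) \<Rightarrow> complex" where
  "fourier1 M f \<xi> = (\<integral>x. f x * cnj (\<xi> x) \<partial>M)"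

text \<open>Haar measure on the dual group normalized as Plancherel measure: the Fourier transform
  on L1 \<inter> L2 is isometric into L2 of the dual with dense range (so extends to a unitary).\<close>
definition plancherel_measure :: "'a::{ab_group_add, topological_space} measure \<Rightarrow> ('a \<Rightarrow> complex) measure \<Rightarrow> bool" where
  "plancherel_measure M N \<longleftrightarrow>
     space N = dual_group \<and> sets N = sets (borel_of (dual_topology :: ('a \<Rightarrow> complex) topology)) \<and>
     (\<forall>K. compactin dual_topology K \<longrightarrow> emeasure N K < \<infinity>) \<and>
     (\<forall>U. openin dual_topology U \<and> U \<noteq> {} \<longrightarrow> emeasure N U > 0) \<and>
     (\<forall>\<eta> \<in> dual_group. \<forall>B \<in> sets N. emeasure N ((\<lambda>\<xi> x. \<eta> x * \<xi> x) ` B) = emeasure N B) \<and>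
     (\<forall>f \<in> L1 M \<inter> L2 M. fourier1 M f \<in> L2 N \<and> L2norm N (fourier1 M f) = L2norm M f) \<and>
     (\<forall>g \<in> L2 N. \<forall>e>0. \<exists>f \<in> L1 M \<inter> L2 M. L2norm N (\<lambda>\<xi>. fourier1 M f \<xi> - g \<xi>) < e)"

definition is_fourier_L2 :: "'a measure \<Rightarrow> ('a \<Rightarrow> complex) measure \<Rightarrow> ('a \<Rightarrow> complex) \<Rightarrow> (('a \<Rightarrow> complex) \<Rightarrow> complex) \<Rightarrow> bool" where
  "is_fourier_L2 M N f g \<longleftrightarrow> f \<in> L2 M \<and> g \<in> L2 N \<and>
     (\<exists>fs::nat \<Rightarrow> 'a \<Rightarrow> complex. (\<forall>n. fs n \<in> L1 M \<inter> L2 M) \<and>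
        (\<lambda>n. L2norm M (\<lambda>x. fs n x - f x)) \<longlonglongrightarrow> 0 \<and>
        (\<lambda>n. L2norm N (\<lambda>\<xi>. fourier1 M (fs n) \<xi> - g \<xi>)) \<longlonglongrightarrow> 0)"

definition H_space :: "'a measure \<Rightarrow> ('a \<Rightarrow> complex) measure \<Rightarrow> ('a \<Rightarrow> complex) set \<Rightarrow> ('a \<Rightarrow> complex) set" where
  "H_space M N X = {f \<in> L2 M. \<exists>g. is_fourier_L2 M N f g \<and> (AE \<xi> in N. g \<xi> * indicator X \<xi> = g \<xi>)}"

definition topological_automorphism :: "('a::{ab_group_add, topological_space} \<Rightarrow> 'a) \<Rightarrow> bool" where
  "topological_automorphism h \<longleftrightarrow> homeomorphism UNIV UNIV h (inv h) \<and> (\<forall>x y. h (x + y) = h x + h y)"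

definition automorphism_group ::
  "('a::{ab_group_add, topological_space} \<Rightarrow> 'a) set \<Rightarrow> ('a \<Rightarrow> 'a) topology \<Rightarrow> ('a \<Rightarrow> 'a) measure \<Rightarrow> bool" where
  "automorphism_group Hs TH MH \<longleftrightarrow>
     (\<forall>h \<in> Hs. topological_automorphism h) \<and> id \<in> Hs \<and>
     (\<forall>g \<in> Hs. \<forall>h \<in> Hs. g \<circ> h \<in> Hs) \<and> (\<forall>h \<in> Hs. inv h \<in> Hs) \<and>
     topspace TH = Hs \<and> Hausdorff_space TH \<and> second_countable TH \<and> locally_compact_space TH \<and>
     continuous_map (prod_topology TH TH) TH (\<lambda>p. fst p \<circ> snd p) \<and>
     continuous_map TH TH inv \<and>
     continuous_map (prod_topology TH euclidean) euclidean (\<lambda>p. fst p (snd p)) \<and>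
     space MH = Hs \<and> sets MH = sets (borel_of TH) \<and>
     (\<forall>K. compactin TH K \<longrightarrow> emeasure MH K < \<infinity>) \<and>
     (\<forall>U. openin TH U \<and> U \<noteq> {} \<longrightarrow> emeasure MH U > 0) \<and>
     (\<forall>g \<in> Hs. \<forall>E \<in> sets MH. emeasure MH ((\<lambda>h. g \<circ> h) ` E) = emeasure MH E)"

definition delta :: "'a measure \<Rightarrow> ('a \<Rightarrow> 'a) \<Rightarrow> real" where
  "delta M h = (let B = (SOME B. B \<in> sets M \<and> 0 < emeasure M B \<and> emeasure M B < \<infinity>)
                in measure M (h ` B) / measure M B)"

text \<open>Left Haar measure dx dh / delta(h) on G = A \<rtimes> H, realized on pairs (a,h).\<close>
definition G_measure :: "'a measure \<Rightarrow> ('a \<Rightarrow> 'a) measure \<Rightarrow> ('a \<times> ('a \<Rightarrow> 'a)) measure" where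
  "G_measure M MH = density (M \<Otimes>\<^sub>M MH) (\<lambda>p. ennreal (1 / delta M (snd p)))"

definition quasi_regular :: "'a::ab_group_add measure \<Rightarrow> 'a \<Rightarrow> ('a \<Rightarrow> 'a) \<Rightarrow> ('a \<Rightarrow> complex) \<Rightarrow> 'a \<Rightarrow> complex" where
  "quasi_regular M a h f t = complex_of_real (delta M h powr (-1/2)) * f (inv h (t - a))"

definition voice :: "'a::ab_group_add measure \<Rightarrow> ('a \<Rightarrow> complex) \<Rightarrow> ('a \<Rightarrow> complex) \<Rightarrow> 'a \<times> ('a \<Rightarrow> 'a) \<Rightarrow> complex" where
  "voice M \<psi> f p = (\<integral>t. f t * cnj (quasi_regular M (fst p) (snd p) \<psi> t) \<partial>M)"

text \<open>Weak admissibility: f \<mapsto> V_psi f is a well-defined bounded injective map from the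
  subspace Hsp into L2(G) (injective on L2 classes: V_psi f = 0 a.e. forces f = 0 a.e.).\<close>
definition weakly_admissible ::
  "'a::ab_group_add measure \<Rightarrow> ('a \<Rightarrow> 'a) measure \<Rightarrow> ('a \<Rightarrow> complex) set \<Rightarrow> ('a \<Rightarrow> complex) \<Rightarrow> bool" where
  "weakly_admissible M MH Hsp \<psi> \<longleftrightarrow> \<psi> \<in> Hsp \<and>
     (\<forall>f \<in> Hsp. voice M \<psi> f \<in> L2 (G_measure M MH)) \<and>
     (\<exists>C. \<forall>f \<in> Hsp. L2norm (G_measure M MH) (voice M \<psi> f) \<le> C * L2norm M f) \<and>
     (\<forall>f \<in> Hsp. (AE p in G_measure M MH. voice M \<psi> f p = 0) \<longrightarrow> (AE x in M. f x = 0))"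

definition dual_orbit :: "('a \<Rightarrow> 'a) set \<Rightarrow> ('a \<Rightarrow> complex) \<Rightarrow> ('a \<Rightarrow> complex) set" where
  "dual_orbit Hs \<xi> = {\<xi> \<circ> h | h. h \<in> Hs}"

definition stabilizer :: "('a \<Rightarrow> 'a) set \<Rightarrow> ('a \<Rightarrow> complex) \<Rightarrow> ('a \<Rightarrow> 'a) set" where
  "stabilizer Hs \<xi> = {h \<in> Hs. \<xi> \<circ> h = \<xi>}"

definition H_invariant :: "('a \<Rightarrow> 'a) set \<Rightarrow> ('a \<Rightarrow> complex) set \<Rightarrow> bool" where
  "H_invariant Hs X \<longleftrightarrow> (\<forall>\<xi> \<in> X. \<forall>h \<in> Hs. \<xi> \<circ> h \<in> X)"

end

theory Submission
  imports Defs "HOL-Probability.Probability"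
begin

text \<open>Write \<open>p\<close> and \<open>F\<close> for the Plancherel transforms of \<open>\<psi>\<close> and \<open>f\<close>, and put
  \<open>\<Phi>(\<xi>) = \<integral> |p(\<xi> h)|\<^sup>2 dh\<close>. On the Fourier side \<open>V f(\<cdot>, h)\<close> is a multiple of the inverse
  transform of \<open>F(\<xi>) cnj (p(\<xi> h))\<close>, so that \<open>\<parallel>V f\<parallel>\<^sup>2 = \<integral> |F|\<^sup>2 \<Phi>\<close>, and admissibility concerns only
  the size of the invariant function \<open>\<Phi>\<close>.

  If \<open>\<psi>\<close> is weakly admissible, then \<open>0 < \<Phi> < \<infinity>\<close> almost everywhere on \<open>X\<close>. Where this holds, the
  stabilizer is compact, and \<open>|p(\<xi> h)|\<^sup>2 dh / \<Phi>(\<xi>)\<close> is carried to a probability measure on the orbit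
  of \<open>\<xi>\<close> that depends on the orbit only. The dual is a standard Borel space, so this measure can
  be viewed on the line, and a quantile of it at a generic level is a point of the orbit for almost
  every orbit.

  Conversely, a Borel cross-section yields by Lusin separation a Borel map \<open>c\<close> that sends a point to
  the representative of its orbit. For a compact neighbourhood \<open>L\<close> of the identity, the points \<open>\<xi>\<close>
  with \<open>c(\<xi>) \<in> \<xi> L\<close> form a Borel set that each orbit map meets in a set of positive finite Haar
  measure; a rescaled indicator function of it is \<open>|p|\<^sup>2\<close> for a weakly admissible \<open>\<psi>\<close>.\<close>

text \<open>An orbit may be a null set of the dual, so statements that hold almost everywhere on the
  dual do not produce a point of it. The measure carried over from the acting group lives on the
  orbit itself, however thin it is. For each orbit all but a null set of quantile levels give a
  point of that orbit; Fubini exchanges the two quantifiers and yields one level that is good for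
  almost every orbit. The exceptional orbits form the invariant null set that is removed from
  \<open>X\<close>.

  The modulus cancels. The Plancherel transform turns the normalization of the representation,
  \<open>delta M h\<close> to the power -1/2, into the power 1/2; its square is compensated by the
  factor \<open>1 / delta M h\<close> in the Haar measure of the semidirect product. What remains is
  integration against left Haar measure of the acting group, whose left invariance makes \<Phi>
  constant on orbits.

  Of the real coordinate on the dual only a retraction is required: Borel maps \<open>i\<close> to
  the line and \<open>j\<close> back, with \<open>j\<close> after \<open>i\<close> the identity on
  characters. Measures on orbits and the graph of \<open>c\<close> are then moved to the line and
  the plane, where quantiles and compactness apply.\<close>

subsection \<open>Coding sequences of reals by a real\<close>

fun ternary_rem :: "nat \<Rightarrow> real \<Rightarrow> real" where
  "ternary_rem 0 x = x"
| "ternary_rem (Suc n) x = 3 * (ternary_rem n x - of_bool (ternary_rem n x \<ge> 1))"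

text \<open>Only the digits 0 and 1 occur in base 3, which leaves a gap: the part after the leading
  digit is at most 1/2, so a comparison with 1 reads that digit. Binary expansions would be
  ambiguous here.\<close>

definition ternary_code :: "(nat \<Rightarrow> bool) \<Rightarrow> real" where
  "ternary_code b = (\<Sum>n. of_bool (b n) / 3 ^ n)"

lemma summable_ternary: "summable (\<lambda>n. of_bool (b n) / 3 ^ n :: real)"
proof (rule summable_comparison_test')
  show "summable (\<lambda>n. (1/3::real) ^ n)" by (rule summable_geometric) simp
  show "norm (of_bool (b n) / 3 ^ n :: real) \<le> (1/3) ^ n" for n
    by (simp add: power_one_over)
qed

lemma ternary_code_nonneg: "0 \<le> ternary_code b"
  unfolding ternary_code_def by (rule suminf_nonneg[OF summable_ternary]) simp

lemma ternary_code_le: "ternary_code b \<le> 3 / 2"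
proof -
  have "ternary_code b \<le> (\<Sum>n. (1/3::real) ^ n)"
    unfolding ternary_code_def
    by (intro suminf_le summable_ternary summable_geometric) (auto simp: power_one_over)
  also have "\<dots> = 3 / 2" by (subst suminf_geometric) auto
  finally show ?thesis .
qed

lemma ternary_code_shift: "ternary_code b = of_bool (b 0) + ternary_code (\<lambda>n. b (Suc n)) / 3"
proof -
  have "ternary_code b = of_bool (b 0) + (\<Sum>n. of_bool (b (Suc n)) / 3 ^ Suc n)"
    unfolding ternary_code_def using suminf_split_head[OF summable_ternary, of b] by simp
  also have "(\<Sum>n. of_bool (b (Suc n)) / 3 ^ Suc n) = ternary_code (\<lambda>n. b (Suc n)) / 3"
    unfolding ternary_code_def
    by (subst suminf_divide[OF summable_ternary, symmetric]) (simp add: field_simps)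
  finally show ?thesis .
qed

lemma ternary_code_ge_1_iff: "1 \<le> ternary_code b \<longleftrightarrow> b 0"
  using ternary_code_shift[of b] ternary_code_nonneg[of "\<lambda>n. b (Suc n)"]
    ternary_code_le[of "\<lambda>n. b (Suc n)"] by (cases "b 0") auto

lemma ternary_rem_code: "ternary_rem n (ternary_code b) = ternary_code (\<lambda>k. b (n + k))"
proof (induction n)
  case (Suc n)
  then show ?case
    using ternary_code_shift[of "\<lambda>k. b (n + k)"] ternary_code_ge_1_iff[of "\<lambda>k. b (n + k)"] by simp
qed simp

lemma ternary_digit: "1 \<le> ternary_rem n (ternary_code b) \<longleftrightarrow> b n"
  by (simp add: ternary_rem_code ternary_code_ge_1_iff)

lemma borel_measurable_ternary_rem [measurable]: "ternary_rem n \<in> borel_measurable borel"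
  by (induction n) (simp_all add: measurable_ident_sets of_bool_def)

text \<open>The sequence is stored through its lower Dedekind cuts: row \<open>k\<close> of the
  pairing records which rationals lie below \<open>v k\<close>.\<close>

definition seq_code :: "(nat \<Rightarrow> real) \<Rightarrow> real" where
  "seq_code v = ternary_code (\<lambda>n. from_nat_into \<rat> (snd (prod_decode n)) < v (fst (prod_decode n)))"

text \<open>The supremum of the cut in row \<open>k\<close>. It is formed in the extended reals so
  that the decoder is defined and Borel on the whole line, also at reals that code no
  sequence.\<close>

definition seq_decode :: "nat \<Rightarrow> real \<Rightarrow> real" where
  "seq_decode k x = real_of_ereal
     (SUP m. if 1 \<le> ternary_rem (prod_encode (k, m)) x then ereal (from_nat_into \<rat> m) else -\<infinity>)"

lemma borel_measurable_seq_decode [measurable]: "seq_decode k \<in> borel_measurable borel"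
  unfolding seq_decode_def by measurable

lemma borel_measurable_seq_code [measurable]:
  assumes [measurable]: "\<And>k. f k \<in> borel_measurable \<Omega>"
  shows "(\<lambda>\<omega>. seq_code (\<lambda>k. f k \<omega>)) \<in> borel_measurable \<Omega>"
  unfolding seq_code_def ternary_code_def of_bool_def by measurable

lemma seq_decode_code: "seq_decode k (seq_code v) = v k"
proof -
  have "(SUP m. if from_nat_into \<rat> m < v k then ereal (from_nat_into \<rat> m) else -\<infinity>) = ereal (v k)"
  proof (intro antisym SUP_least)
    show "ereal (v k) \<le> (SUP m. if from_nat_into \<rat> m < v k then ereal (from_nat_into \<rat> m) else -\<infinity>)"
    proof (rule dense_le)
      fix y assume y: "y < ereal (v k)"
      \<comment> \<open>\<open>y\<close> may be -\<infinity>; a real \<open>r\<close> above it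
        leaves room for a rational below \<open>v k\<close>.\<close>
      obtain r where r: "y \<le> ereal r" "r < v k"
        using y lt_ex[of "v k"] by (cases y) auto
      obtain q where q: "q \<in> \<rat>" "r < q" "q < v k" using Rats_dense_in_real[OF r(2)] by blast
      then obtain m where m: "q = from_nat_into \<rat> m"
        using countable_rat by (metis from_nat_into_surj)
      have "y \<le> (if from_nat_into \<rat> m < v k then ereal (from_nat_into \<rat> m) else -\<infinity>)"
        using r q m by (auto intro: order_trans)
      also have "\<dots> \<le> (SUP m. if from_nat_into \<rat> m < v k then ereal (from_nat_into \<rat> m) else -\<infinity>)"
        by (rule SUP_upper) simp
      finally show "y \<le> (SUP m. if from_nat_into \<rat> m < v k then ereal (from_nat_into \<rat> m) else -\<infinity>)" .
    qed
  qed auto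
  then show ?thesis
    by (simp add: seq_decode_def seq_code_def ternary_digit)
qed

subsection \<open>Lusin separation\<close>

text \<open>Branches are whole sequences, on which the sets depend locally, instead of finite words:
  countable intersections are then a mere reindexing.\<close>

definition suslin_scheme :: "(nat \<Rightarrow> (nat \<Rightarrow> nat) \<Rightarrow> 'a::topological_space set) \<Rightarrow> 'a set \<Rightarrow> bool" where
  "suslin_scheme F A \<longleftrightarrow> (\<forall>n a. compact (F n a)) \<and>
     (\<forall>n a. \<exists>m. \<forall>b. (\<forall>i<m. b i = a i) \<longrightarrow> F n b = F n a) \<and> A = {y. \<exists>a. \<forall>n. y \<in> F n a}"

definition suslin :: "'a::topological_space set \<Rightarrow> bool" where
  "suslin A \<longleftrightarrow> (\<exists>F. suslin_scheme F A)"

lemma suslin_schemeD: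
  assumes "suslin_scheme F A"
  shows "compact (F n a)" "\<exists>m. \<forall>b. (\<forall>i<m. b i = a i) \<longrightarrow> F n b = F n a"
    "A = {y. \<exists>a. \<forall>n. y \<in> F n a}"
  using assms unfolding suslin_scheme_def by auto

lemma suslin_compact: "compact K \<Longrightarrow> suslin K"
  unfolding suslin_def suslin_scheme_def by (rule exI[of _ "\<lambda>_ _. K"]) auto

lemma suslin_INT:
  assumes "\<And>k::nat. suslin (A k)"
  shows "suslin (\<Inter>k. A k)"
proof -
  from assms have "\<forall>k. \<exists>F. suslin_scheme F (A k)" unfolding suslin_def by blast
  from choice[OF this] obtain F where sch: "\<And>k. suslin_scheme (F k) (A k)" by blast
  note F = suslin_schemeD[OF sch]
  \<comment> \<open>Row \<open>k\<close> of the branch serves as a branch for \<open>A k\<close>,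
    and \<open>n\<close> runs through all pairs of a row and a position in the scheme of that
    row.\<close>
  define G where "G n a = (let (k, l) = prod_decode n in F k l (\<lambda>i. a (prod_encode (k, i))))" for n a
  show ?thesis unfolding suslin_def suslin_scheme_def
  proof (intro exI[of _ G] conjI allI)
    show "compact (G n a)" for n a by (simp add: G_def F split: prod.splits)
    show "\<exists>m. \<forall>b. (\<forall>i<m. b i = a i) \<longrightarrow> G n b = G n a" for n a
    proof -
      obtain k l where kl: "prod_decode n = (k, l)" by fastforce
      obtain m where m: "\<And>b. (\<forall>i<m. b i = a (prod_encode (k, i))) \<Longrightarrow>
          F k l b = F k l (\<lambda>i. a (prod_encode (k, i)))"
        using F(2)[of "\<lambda>i. a (prod_encode (k, i))" k l] by blast
      \<comment> \<open>The bound lies beyond the first \<open>m\<close> places of row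
        \<open>k\<close>, on which \<open>G n a\<close> depends; \<open>insert 0\<close> keeps the
        maximum meaningful when \<open>m\<close> is 0.\<close>
      have "G n b = G n a" if "\<forall>i<Suc (Max (insert 0 ((\<lambda>i. prod_encode (k, i)) ` {..<m}))). b i = a i" for b
      proof -
        have "b (prod_encode (k, i)) = a (prod_encode (k, i))" if i: "i < m" for i
        proof -
          have "prod_encode (k, i) \<le> Max (insert 0 ((\<lambda>i. prod_encode (k, i)) ` {..<m}))"
            using i by (intro Max_ge) auto
          then show ?thesis using \<open>\<forall>i<_. b i = a i\<close> by auto
        qed
        then show ?thesis using kl m[of "\<lambda>i. b (prod_encode (k, i))"] by (simp add: G_def)
      qed
      then show ?thesis by blast
    qed
    show "(\<Inter>k. A k) = {y. \<exists>a. \<forall>n. y \<in> G n a}"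
    proof (intro set_eqI iffI)
      fix y assume "y \<in> (\<Inter>k. A k)"
      then have "\<forall>k. \<exists>a. \<forall>n. y \<in> F k n a" using F(3) by auto
      then obtain a where a: "\<And>k n. y \<in> F k n (a k)" by metis
      have "y \<in> G n (\<lambda>i. a (fst (prod_decode i)) (snd (prod_decode i)))" for n
        by (auto simp: G_def a split: prod.splits)
      then show "y \<in> {y. \<exists>a. \<forall>n. y \<in> G n a}" by blast
    next
      fix y assume "y \<in> {y. \<exists>a. \<forall>n. y \<in> G n a}"
      then obtain a where a: "\<And>n. y \<in> G n a" by blast
      have "y \<in> F k l (\<lambda>i. a (prod_encode (k, i)))" for k l
        using a[of "prod_encode (k, l)"] by (simp add: G_def)
      then show "y \<in> (\<Inter>k. A k)" using F(3) by blast
    qed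
  qed
qed

text \<open>The first entry of a branch selects one of the sets, and the remaining entries form a
  branch for it.\<close>

lemma suslin_UN:
  assumes "\<And>k::nat. suslin (A k)"
  shows "suslin (\<Union>k. A k)"
proof -
  from assms have "\<forall>k. \<exists>F. suslin_scheme F (A k)" unfolding suslin_def by blast
  from choice[OF this] obtain F where sch: "\<And>k. suslin_scheme (F k) (A k)" by blast
  note F = suslin_schemeD[OF sch]
  define G where "G n a = F (a 0) n (\<lambda>i. a (Suc i))" for n a
  show ?thesis unfolding suslin_def suslin_scheme_def
  proof (intro exI[of _ G] conjI allI)
    show "compact (G n a)" for n a by (simp add: G_def F)
    show "\<exists>m. \<forall>b. (\<forall>i<m. b i = a i) \<longrightarrow> G n b = G n a" for n a
    proof -
      obtain m where m: "\<And>b. (\<forall>i<m. b i = a (Suc i)) \<Longrightarrow> F (a 0) n b = F (a 0) n (\<lambda>i. a (Suc i))"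
        using F(2)[of "\<lambda>i. a (Suc i)" "a 0" n] by blast
      have "G n b = G n a" if b: "\<forall>i<Suc m. b i = a i" for b
      proof -
        have "b 0 = a 0" "\<forall>i<m. b (Suc i) = a (Suc i)" using b by blast+
        then show ?thesis using m[of "\<lambda>i. b (Suc i)"] unfolding G_def by (simp only:)
      qed
      then show ?thesis by blast
    qed
    show "(\<Union>k. A k) = {y. \<exists>a. \<forall>n. y \<in> G n a}"
    proof (intro set_eqI iffI)
      fix y assume "y \<in> (\<Union>k. A k)"
      then obtain k a where "\<And>n. y \<in> F k n a" using F(3) by auto
      then have "\<forall>n. y \<in> G n (case_nat k a)" by (simp add: G_def)
      then show "y \<in> {y. \<exists>a. \<forall>n. y \<in> G n a}" by blast
    next
      fix y assume "y \<in> {y. \<exists>a. \<forall>n. y \<in> G n a}"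
      then show "y \<in> (\<Union>k. A k)" using F(3) by (auto simp: G_def)
    qed
  qed
qed

lemma suslin_open:
  fixes U :: "'a::euclidean_space set"
  assumes "open U" shows "suslin U"
proof -
  obtain C where "\<And>n::nat. compact (C n)" "\<Union>(range C) = U"
    using open_Union_compact_subsets[OF assms] by metis
  then show ?thesis using suslin_UN[of C] suslin_compact by metis
qed

lemma suslin_closed:
  fixes U :: "'a::euclidean_space set"
  assumes "closed U" shows "suslin U"
proof -
  have "U = (\<Union>n::nat. U \<inter> cball 0 (real n))"
    by (auto simp: real_arch_simple)
  then show ?thesis
    by (metis suslin_UN suslin_compact closed_Int_compact assms compact_cball)
qed

text \<open>Suslin sets are not closed under complements, so the induction carries a set and its
  complement together.\<close>

lemma suslin_borel:
  fixes A :: "'a::euclidean_space set"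
  assumes "A \<in> sets borel" shows "suslin A"
proof -
  have "A \<in> sigma_sets UNIV {S. open S}" using assms by (simp add: borel_def)
  then have "suslin A \<and> suslin (- A)"
  proof (induction rule: sigma_sets.induct)
    case (Basic a)
    then show ?case using suslin_open suslin_closed by (metis closed_Compl mem_Collect_eq)
  next
    case Empty
    then show ?case by (simp add: suslin_compact suslin_open)
  next
    case (Compl a)
    then show ?case by (simp flip: Compl_eq_Diff_UNIV)
  next
    case (Union a)
    then show ?case by (simp add: suslin_UN suslin_INT)
  qed
  then show ?thesis ..
qed

text \<open>Borel sets that separate countably many pairs of pieces combine into one that separates
  the unions. Hence inseparability of the two projections is inherited by some pair of smaller
  pieces, again and again, along two branches \<open>a\<close> and \<open>b\<close>. But the compact
  sets met along the branches either share a first coordinate in the limit, contradicting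
  disjointness, or have disjoint compact projections after finitely many stages, which are
  separated. Working with first coordinates throughout means that projections of Suslin sets need no
  scheme of their own.\<close>

theorem lusin_separation:
  fixes P Q :: "(real \<times> real) set"
  assumes "P \<in> sets borel" "Q \<in> sets borel" and disj: "fst ` P \<inter> fst ` Q = {}"
  shows "\<exists>S\<in>sets borel. fst ` P \<subseteq> S \<and> fst ` Q \<inter> S = {}"
proof (rule ccontr)
  define Sep where "Sep X Y \<longleftrightarrow> (\<exists>S\<in>sets borel. fst ` X \<subseteq> S \<and> fst ` Y \<inter> S = {})"
    for X Y :: "(real \<times> real) set"
  assume "\<not> (\<exists>S\<in>sets borel. fst ` P \<subseteq> S \<and> fst ` Q \<inter> S = {})"
  then have nPQ: "\<not> Sep P Q" by (simp add: Sep_def)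
  obtain F G where sch: "suslin_scheme F P" "suslin_scheme G Q"
    using suslin_borel assms(1,2) unfolding suslin_def by blast
  note F = suslin_schemeD[OF sch(1)] and G = suslin_schemeD[OF sch(2)]
  \<comment> \<open>The points of \<open>P\<close> that are carried by some branch agreeing with
    \<open>a\<close> below \<open>n\<close>.\<close>
  define PP where "PP n a = {y. \<exists>a'. (\<forall>i<n. a' i = a i) \<and> (\<forall>k. y \<in> F k a')}" for n a
  define QQ where "QQ n a = {y. \<exists>a'. (\<forall>i<n. a' i = a i) \<and> (\<forall>k. y \<in> G k a')}" for n a
  have PP_split: "PP n a = (\<Union>u. PP (Suc n) (a(n := u)))" for n a
  proof (intro set_eqI iffI)
    fix y assume "y \<in> PP n a"
    then obtain a' where "\<forall>i<n. a' i = a i" "\<forall>k. y \<in> F k a'" unfolding PP_def by blast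
    then have "y \<in> PP (Suc n) (a(n := a' n))"
      unfolding PP_def by (auto simp: less_Suc_eq intro!: exI[of _ a'])
    then show "y \<in> (\<Union>u. PP (Suc n) (a(n := u)))" by blast
  qed (auto simp: PP_def less_Suc_eq split: if_splits)
  have QQ_split: "QQ n a = (\<Union>u. QQ (Suc n) (a(n := u)))" for n a
  proof (intro set_eqI iffI)
    fix y assume "y \<in> QQ n a"
    then obtain a' where "\<forall>i<n. a' i = a i" "\<forall>k. y \<in> G k a'" unfolding QQ_def by blast
    then have "y \<in> QQ (Suc n) (a(n := a' n))"
      unfolding QQ_def by (auto simp: less_Suc_eq intro!: exI[of _ a'])
    then show "y \<in> (\<Union>u. QQ (Suc n) (a(n := u)))" by blast
  qed (auto simp: QQ_def less_Suc_eq split: if_splits)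
  \<comment> \<open>If every pair of successors had a separator \<open>S u v\<close>, the union over
    \<open>u\<close> of the intersections over \<open>v\<close> would separate the two
    pieces.\<close>
  have step: "\<exists>u v. \<not> Sep (PP (Suc n) (a(n := u))) (QQ (Suc n) (b(n := v)))"
    if "\<not> Sep (PP n a) (QQ n b)" for n a b
  proof (rule ccontr)
    assume "\<not> ?thesis"
    then have "\<forall>u v. \<exists>S\<in>sets borel. fst ` PP (Suc n) (a(n := u)) \<subseteq> S \<and> fst ` QQ (Suc n) (b(n := v)) \<inter> S = {}"
      unfolding Sep_def by blast
    then obtain S where S: "\<And>u v. S u v \<in> sets borel"
      "\<And>u v. fst ` PP (Suc n) (a(n := u)) \<subseteq> S u v"
      "\<And>u v. fst ` QQ (Suc n) (b(n := v)) \<inter> S u v = {}" by metis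
    have "(\<Union>u. \<Inter>v. S u v) \<in> sets borel" using S(1) by auto
    moreover have "fst ` PP n a \<subseteq> (\<Union>u. \<Inter>v. S u v)"
      using S(2) unfolding PP_split[of n a] by blast
    moreover have "fst ` QQ n b \<inter> (\<Union>u. \<Inter>v. S u v) = {}"
      using S(3) unfolding QQ_split[of n b] by blast
    ultimately show False using that unfolding Sep_def by blast
  qed
  have "\<exists>f. \<forall>n. \<not> Sep (PP n (fst (f n))) (QQ n (snd (f n))) \<and>
      (\<exists>u v. f (Suc n) = ((fst (f n))(n := u), (snd (f n))(n := v)))"
  proof (rule dependent_nat_choice)
    have "PP 0 undefined = P" "QQ 0 undefined = Q" by (auto simp: PP_def QQ_def F(3) G(3))
    then show "\<exists>x. \<not> Sep (PP 0 (fst x)) (QQ 0 (snd x))"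
      using nPQ by (intro exI[of _ "(undefined, undefined)"]) simp
    fix x n assume "\<not> Sep (PP n (fst x)) (QQ n (snd x))"
    from step[OF this] obtain u v where
      "\<not> Sep (PP (Suc n) ((fst x)(n := u))) (QQ (Suc n) ((snd x)(n := v)))" by blast
    then show "\<exists>y. \<not> Sep (PP (Suc n) (fst y)) (QQ (Suc n) (snd y)) \<and>
        (\<exists>u v. y = ((fst x)(n := u), (snd x)(n := v)))"
      by (intro exI[of _ "((fst x)(n := u), (snd x)(n := v))"]) auto
  qed
  then obtain f where f: "\<And>n. \<not> Sep (PP n (fst (f n))) (QQ n (snd (f n)))"
    "\<And>n. \<exists>u v. f (Suc n) = ((fst (f n))(n := u), (snd (f n))(n := v))" by blast
  \<comment> \<open>Stage \<open>Suc n\<close> changes only entry \<open>n\<close>, so entry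
    \<open>i\<close> has reached its final value at stage \<open>Suc i\<close>.\<close>
  define a where "a i = fst (f (Suc i)) i" for i
  define b where "b i = snd (f (Suc i)) i" for i
  have ab: "\<forall>i<n. fst (f n) i = a i \<and> snd (f n) i = b i" for n
  proof (induction n)
    case (Suc n)
    obtain u v where uv: "f (Suc n) = ((fst (f n))(n := u), (snd (f n))(n := v))" using f(2) by blast
    show ?case using Suc uv by (auto simp: less_Suc_eq a_def b_def)
  qed simp
  have bad: "\<not> Sep (PP n a) (QQ n b)" for n
  proof -
    have "PP n (fst (f n)) = PP n a" "QQ n (snd (f n)) = QQ n b"
      unfolding PP_def QQ_def using ab[of n] by auto
    then show ?thesis using f(1)[of n] by simp
  qed
  define U where "U n = (\<Inter>k\<le>n. F k a)" for n :: nat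
  define V where "V n = (\<Inter>k\<le>n. G k b)" for n :: nat
  have cU: "compact (U n)" and cV: "compact (V n)" for n
    unfolding U_def V_def by (auto intro!: compact_Inter F G)
  \<comment> \<open>A pair lying in every \<open>R n\<close> would consist of a point of
    \<open>P\<close> and a point of \<open>Q\<close> with the same first coordinate. The sets are
    compact and decreasing, so one of them is already empty.\<close>
  define R where "R n = (U n \<times> V n) \<inter> {x. fst (fst x) = fst (snd x)}" for n
  have "\<exists>n. R n = {}"
  proof (rule ccontr)
    assume "\<nexists>n. R n = {}"
    then have ne: "\<And>n. R n \<noteq> {}" by blast
    have "compact (R n)" for n unfolding R_def
      by (intro compact_Int_closed compact_Times cU cV closed_Collect_eq continuous_intros)
    moreover have "R n \<subseteq> R m" if "m \<le> n" for m n
      using that unfolding R_def U_def V_def by force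
    ultimately have "\<Inter>(range R) \<noteq> {}" using ne by (intro compact_nest) auto
    then obtain p q where pq: "\<And>n. (p, q) \<in> R n" by fastforce
    have "p \<in> P" using pq unfolding F(3) R_def U_def by auto
    moreover have "q \<in> Q" using pq unfolding G(3) R_def V_def by auto
    moreover have "fst p = fst q" using pq by (auto simp: R_def)
    ultimately show False using disj by blast
  qed
  then obtain n where n: "R n = {}" by blast
  obtain mF where mF: "\<And>k a'. (\<forall>i<mF k. a' i = a i) \<Longrightarrow> F k a' = F k a"
    using choice[of "\<lambda>k m. \<forall>a'. (\<forall>i<m. a' i = a i) \<longrightarrow> F k a' = F k a"] F(2) by blast
  obtain mG where mG: "\<And>k a'. (\<forall>i<mG k. a' i = b i) \<Longrightarrow> G k a' = G k b"
    using choice[of "\<lambda>k m. \<forall>a'. (\<forall>i<m. a' i = b i) \<longrightarrow> G k a' = G k b"] G(2) by blast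
  \<comment> \<open>\<open>U n\<close> and \<open>V n\<close> involve finitely many members of the
    schemes, and each of these depends on finitely many entries; agreement below \<open>m\<close>
    settles them all, so the pieces at stage \<open>m\<close> lie in \<open>U n\<close> and
    \<open>V n\<close>.\<close>
  define m where "m = Max (mF ` {..n} \<union> mG ` {..n})"
  have m: "mF k \<le> m" "mG k \<le> m" if "k \<le> n" for k
    unfolding m_def using that by (auto intro!: Max_ge)
  have "PP m a \<subseteq> U n"
  proof
    fix y assume "y \<in> PP m a"
    then obtain a' where a': "\<forall>i<m. a' i = a i" "\<forall>k. y \<in> F k a'" unfolding PP_def by blast
    have "F k a' = F k a" if "k \<le> n" for k
      using a'(1) m(1)[OF that] by (intro mF) (meson order_less_le_trans)
    then show "y \<in> U n" using a'(2) unfolding U_def by blast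
  qed
  moreover have "QQ m b \<subseteq> V n"
  proof
    fix y assume "y \<in> QQ m b"
    then obtain a' where a': "\<forall>i<m. a' i = b i" "\<forall>k. y \<in> G k a'" unfolding QQ_def by blast
    have "G k a' = G k b" if "k \<le> n" for k
      using a'(1) m(2)[OF that] by (intro mG) (meson order_less_le_trans)
    then show "y \<in> V n" using a'(2) unfolding V_def by blast
  qed
  moreover have "fst ` U n \<inter> fst ` V n = {}"
    using n unfolding R_def by force
  moreover have "fst ` U n \<in> sets borel"
    by (intro borel_compact compact_continuous_image cU continuous_intros)
  ultimately have "Sep (PP m a) (QQ m b)" unfolding Sep_def by (intro bexI[of _ "fst ` U n"]) auto
  then show False using bad by blast
qed

subsection \<open>Square-integrable functions\<close>

lemma L2_measurable [measurable_dest]: "f \<in> L2 N \<Longrightarrow> f \<in> borel_measurable N"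
  by (simp add: L2_def)

lemma L2_integrable: "f \<in> L2 N \<Longrightarrow> integrable N (\<lambda>x. (cmod (f x))\<^sup>2)"
  by (simp add: L2_def)

lemma L2_iff_nn_integral:
  assumes [measurable]: "f \<in> borel_measurable N"
  shows "f \<in> L2 N \<longleftrightarrow> (\<integral>\<^sup>+x. ennreal ((cmod (f x))\<^sup>2) \<partial>N) < \<infinity>"
  unfolding L2_def integrable_iff_bounded by simp

lemma ennreal_L2norm_sq:
  assumes "f \<in> L2 N"
  shows "ennreal ((L2norm N f)\<^sup>2) = (\<integral>\<^sup>+x. ennreal ((cmod (f x))\<^sup>2) \<partial>N)"
  using assms L2_integrable[OF assms] unfolding L2norm_def
  by (subst nn_integral_eq_integral) auto

lemma L2norm_nonneg: "0 \<le> L2norm N f"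
  by (simp add: L2norm_def)

lemma L2norm_sq: "(L2norm N f)\<^sup>2 = (\<integral>x. (cmod (f x))\<^sup>2 \<partial>N)"
  by (simp add: L2norm_def)

lemma cmod_add_sq_le: "(cmod (a + b))\<^sup>2 \<le> 2 * (cmod a)\<^sup>2 + 2 * (cmod b)\<^sup>2"
proof -
  have "(cmod (a + b))\<^sup>2 \<le> (cmod a + cmod b)\<^sup>2" by (intro power_mono norm_triangle_ineq) auto
  also have "\<dots> \<le> 2 * (cmod a)\<^sup>2 + 2 * (cmod b)\<^sup>2"
    using sum_squares_bound[of "cmod a" "cmod b"] by (simp add: power2_sum)
  finally show ?thesis .
qed

lemma L2_add [intro]:
  assumes "f \<in> L2 N" "g \<in> L2 N" shows "(\<lambda>x. f x + g x) \<in> L2 N"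
proof -
  have [measurable]: "f \<in> borel_measurable N" "g \<in> borel_measurable N"
    using assms by (auto simp: L2_def)
  have "integrable N (\<lambda>x. 2 * (cmod (f x))\<^sup>2 + 2 * (cmod (g x))\<^sup>2)"
    using assms by (auto simp: L2_def)
  then have "integrable N (\<lambda>x. (cmod (f x + g x))\<^sup>2)"
    by (rule Bochner_Integration.integrable_bound) (auto intro!: AE_I2 cmod_add_sq_le)
  then show ?thesis by (simp add: L2_def)
qed

lemma L2_scale [intro]:
  assumes "f \<in> L2 N" shows "(\<lambda>x. c * f x) \<in> L2 N"
  using assms by (auto simp: L2_def norm_mult power_mult_distrib)

lemma L2_uminus [intro]: "f \<in> L2 N \<Longrightarrow> (\<lambda>x. - f x) \<in> L2 N"
  using L2_scale[of f N "-1"] by simp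

lemma L2_diff [intro]:
  assumes "f \<in> L2 N" "g \<in> L2 N" shows "(\<lambda>x. f x - g x) \<in> L2 N"
  using L2_add[OF assms(1) L2_uminus[OF assms(2)]] by simp

lemma borel_measurable_cnj [measurable]: "cnj \<in> borel_measurable borel"
  by (intro borel_measurable_continuous_onI continuous_intros)

lemma L2_cnj [intro]: "f \<in> L2 N \<Longrightarrow> (\<lambda>x. cnj (f x)) \<in> L2 N"
  by (auto simp: L2_def)

lemma L2_zero [simp]: "(\<lambda>x. 0) \<in> L2 N"
  by (simp add: L2_def)

lemma L2_mult_bounded:
  assumes "f \<in> L2 N" and [measurable]: "m \<in> borel_measurable N"
    and "\<And>x. x \<in> space N \<Longrightarrow> cmod (m x) \<le> b"
  shows "(\<lambda>x. f x * m x) \<in> L2 N"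
proof -
  have [measurable]: "f \<in> borel_measurable N" using assms by (auto simp: L2_def)
  have "integrable N (\<lambda>x. b\<^sup>2 * (cmod (f x))\<^sup>2)" using assms by (auto simp: L2_def)
  then have "integrable N (\<lambda>x. (cmod (f x * m x))\<^sup>2)"
  proof (rule Bochner_Integration.integrable_bound)
    show "AE x in N. norm ((cmod (f x * m x))\<^sup>2) \<le> norm (b\<^sup>2 * (cmod (f x))\<^sup>2)"
    proof (rule AE_I2)
      fix x assume "x \<in> space N"
      then have "(cmod (m x))\<^sup>2 \<le> b\<^sup>2" using assms(3) by (intro power_mono) auto
      then show "norm ((cmod (f x * m x))\<^sup>2) \<le> norm (b\<^sup>2 * (cmod (f x))\<^sup>2)"
        by (simp add: norm_mult power_mult_distrib mult.commute[of "b\<^sup>2"] mult_left_mono)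
    qed
  qed simp
  then show ?thesis by (simp add: L2_def)
qed

lemma integrable_L2_mult:
  assumes "f \<in> L2 N" "g \<in> L2 N" shows "integrable N (\<lambda>x. f x * g x)"
proof -
  have [measurable]: "f \<in> borel_measurable N" "g \<in> borel_measurable N"
    using assms by (auto simp: L2_def)
  have "integrable N (\<lambda>x. (cmod (f x))\<^sup>2 + (cmod (g x))\<^sup>2)"
    using assms by (auto simp: L2_def)
  then show ?thesis
  proof (rule Bochner_Integration.integrable_bound)
    show "AE x in N. norm (f x * g x) \<le> norm ((cmod (f x))\<^sup>2 + (cmod (g x))\<^sup>2)"
    proof (rule AE_I2)
      fix x
      have "2 * (cmod (f x) * cmod (g x)) \<le> (cmod (f x))\<^sup>2 + (cmod (g x))\<^sup>2"
        using sum_squares_bound[of "cmod (f x)" "cmod (g x)"] by simp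
      moreover have "0 \<le> cmod (f x) * cmod (g x)" by simp
      ultimately have "cmod (f x) * cmod (g x) \<le> (cmod (f x))\<^sup>2 + (cmod (g x))\<^sup>2" by linarith
      then show "norm (f x * g x) \<le> norm ((cmod (f x))\<^sup>2 + (cmod (g x))\<^sup>2)"
        by (simp add: norm_mult)
    qed
  qed simp
qed

lemma integrable_L2_cnj:
  assumes "f \<in> L2 N" "g \<in> L2 N" shows "integrable N (\<lambda>x. f x * cnj (g x))"
  using integrable_L2_mult[OF assms(1) L2_cnj[OF assms(2)]] .

lemma cmod_integral_L2_le:
  assumes "f \<in> L2 N" "g \<in> L2 N"
  shows "(\<integral>x. cmod (f x) * cmod (g x) \<partial>N) \<le> L2norm N f * L2norm N g"
proof -
  have [measurable]: "f \<in> borel_measurable N" "g \<in> borel_measurable N"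
    using assms by (auto simp: L2_def)
  have i: "integrable N (\<lambda>x. cmod (f x) * cmod (g x))"
    using integrable_norm[OF integrable_L2_mult[OF assms]] by (simp add: norm_mult)
  have "ennreal ((\<integral>x. cmod (f x) * cmod (g x) \<partial>N)\<^sup>2) = (\<integral>\<^sup>+x. ennreal (cmod (f x)) * ennreal (cmod (g x)) \<partial>N)\<^sup>2"
    using i by (subst ennreal_power[symmetric]) (auto simp: nn_integral_eq_integral[symmetric] ennreal_mult)
  also have "\<dots> \<le> (\<integral>\<^sup>+x. ennreal (cmod (f x)) ^ 2 \<partial>N) * (\<integral>\<^sup>+x. ennreal (cmod (g x)) ^ 2 \<partial>N)"
    by (rule Cauchy_Schwarz_nn_integral) auto
  also have "\<dots> = ennreal ((L2norm N f * L2norm N g)\<^sup>2)"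
    using assms by (simp add: ennreal_power ennreal_L2norm_sq power_mult_distrib ennreal_mult)
  finally have "(\<integral>x. cmod (f x) * cmod (g x) \<partial>N)\<^sup>2 \<le> (L2norm N f * L2norm N g)\<^sup>2"
    by (simp add: ennreal_le_iff)
  then show ?thesis
    by (rule power2_le_imp_le) (simp add: L2norm_nonneg)
qed

lemma L2norm_triangle:
  assumes "f \<in> L2 N" "g \<in> L2 N"
  shows "L2norm N (\<lambda>x. f x + g x) \<le> L2norm N f + L2norm N g"
proof -
  have i: "integrable N (\<lambda>x. cmod (f x) * cmod (g x))"
    using integrable_norm[OF integrable_L2_mult[OF assms]] by (simp add: norm_mult)
  have "(L2norm N (\<lambda>x. f x + g x))\<^sup>2 \<le>
      (\<integral>x. (cmod (f x))\<^sup>2 + (cmod (g x))\<^sup>2 + 2 * (cmod (f x) * cmod (g x)) \<partial>N)"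
    unfolding L2norm_sq
  proof (rule integral_mono)
    show "(cmod (f x + g x))\<^sup>2 \<le> (cmod (f x))\<^sup>2 + (cmod (g x))\<^sup>2 + 2 * (cmod (f x) * cmod (g x))" for x
    proof -
      have "(cmod (f x + g x))\<^sup>2 \<le> (cmod (f x) + cmod (g x))\<^sup>2"
        by (intro power_mono norm_triangle_ineq) auto
      then show ?thesis by (simp add: power2_sum)
    qed
  qed (use assms i in \<open>auto intro!: L2_integrable\<close>)
  also have "\<dots> = (L2norm N f)\<^sup>2 + (L2norm N g)\<^sup>2 + 2 * (\<integral>x. cmod (f x) * cmod (g x) \<partial>N)"
    using assms i by (simp add: L2norm_sq L2_integrable)
  also have "\<dots> \<le> (L2norm N f + L2norm N g)\<^sup>2"
    using cmod_integral_L2_le[OF assms] by (simp add: power2_sum)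
  finally show ?thesis
    by (rule power2_le_imp_le) (simp add: L2norm_nonneg)
qed

lemma L2norm_scale: "L2norm N (\<lambda>x. c * f x) = cmod c * L2norm N f"
  by (simp add: L2norm_def norm_mult power_mult_distrib real_sqrt_mult)

lemma L2norm_minus_commute: "L2norm N (\<lambda>x. f x - g x) = L2norm N (\<lambda>x. g x - f x)"
  by (simp add: L2norm_def norm_minus_commute)

lemma L2norm_diff_triangle:
  assumes "f \<in> L2 N" "g \<in> L2 N" "h \<in> L2 N"
  shows "L2norm N (\<lambda>x. f x - h x) \<le> L2norm N (\<lambda>x. f x - g x) + L2norm N (\<lambda>x. g x - h x)"
  using L2norm_triangle[of "\<lambda>x. f x - g x" N "\<lambda>x. g x - h x"] assms by auto

lemma abs_L2norm_diff_le:
  assumes "f \<in> L2 N" "g \<in> L2 N"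
  shows "\<bar>L2norm N f - L2norm N g\<bar> \<le> L2norm N (\<lambda>x. f x - g x)"
  using L2norm_triangle[OF L2_diff[OF assms] assms(2)]
    L2norm_triangle[OF L2_diff[OF assms(2,1)] assms(1)] L2norm_minus_commute[of N f g]
  by simp

lemma L2norm_tendsto:
  assumes "\<And>n. fs n \<in> L2 N" "f \<in> L2 N" "(\<lambda>n. L2norm N (\<lambda>x. fs n x - f x)) \<longlonglongrightarrow> 0"
  shows "(\<lambda>n. L2norm N (fs n)) \<longlonglongrightarrow> L2norm N f"
proof (subst LIM_zero_iff[symmetric], rule Lim_null_comparison[OF _ assms(3)])
  show "\<forall>\<^sub>F n in sequentially. norm (L2norm N (fs n) - L2norm N f) \<le> L2norm N (\<lambda>x. fs n x - f x)"
    using abs_L2norm_diff_le[OF assms(1,2)] by simp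
qed

lemma L2norm_eq_0_iff:
  assumes "f \<in> L2 N" shows "L2norm N f = 0 \<longleftrightarrow> (AE x in N. f x = 0)"
  using integral_nonneg_eq_0_iff_AE[OF L2_integrable[OF assms]] by (simp add: L2norm_def)

section \<open>Completeness of the space of square-integrable functions\<close>

lemma SUP_power2_ennreal:
  fixes a :: "nat \<Rightarrow> ennreal"
  assumes "incseq a"
  shows "(SUP n. a n)\<^sup>2 = (SUP n. (a n)\<^sup>2)"
proof (rule antisym)
  have "(SUP n. a n)\<^sup>2 = (SUP m. SUP n. a m * a n)"
    unfolding power2_eq_square SUP_mult_left_ennreal SUP_mult_right_ennreal by (rule SUP_commute)
  also have "\<dots> \<le> (SUP n. (a n)\<^sup>2)"
  proof (intro SUP_least)
    fix m n
    have "a m * a n \<le> (a (max m n))\<^sup>2"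
      unfolding power2_eq_square by (intro mult_mono incseqD[OF assms]) auto
    then show "a m * a n \<le> (SUP n. (a n)\<^sup>2)" by (rule SUP_upper2[rotated]) simp
  qed
  finally show "(SUP n. a n)\<^sup>2 \<le> (SUP n. (a n)\<^sup>2)" .
qed (auto intro!: SUP_least power_mono SUP_upper)

text \<open>The Riesz-Fischer argument. The sum of the moduli of the steps from \<open>m\<close> on
  has norm at most 2 times the \<open>m\<close>-th power of 1/2. For \<open>m = 0\<close> this gives
  absolute convergence of the telescoping series almost everywhere, and for general \<open>m\<close>
  the rate of convergence to its sum.\<close>

lemma L2_complete_fast:
  fixes f :: "nat \<Rightarrow> 'b \<Rightarrow> complex"
  assumes f: "\<And>n. f n \<in> L2 N" and fast: "\<And>n. L2norm N (\<lambda>x. f (Suc n) x - f n x) \<le> (1/2)^n"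
  obtains g where "g \<in> L2 N" "(\<lambda>n. L2norm N (\<lambda>x. f n x - g x)) \<longlonglongrightarrow> 0"
proof -
  have [measurable]: "f n \<in> borel_measurable N" for n using f[of n] by (simp add: L2_def)
  define d where "d n x = f (Suc n) x - f n x" for n x
  have d: "d n \<in> L2 N" for n unfolding d_def using f by auto
  have [measurable]: "d n \<in> borel_measurable N" for n using d[of n] by (simp add: L2_def)
  have norm_sum: "L2norm N (\<lambda>x. complex_of_real (\<Sum>i=m..<n. cmod (d i x))) \<le> 2 * (1/2)^m"
    and sum_L2: "(\<lambda>x. complex_of_real (\<Sum>i=m..<n. cmod (d i x))) \<in> L2 N" for m n
  proof -
    have cd: "(\<lambda>x. complex_of_real (cmod (d i x))) \<in> L2 N"
      "L2norm N (\<lambda>x. complex_of_real (cmod (d i x))) \<le> (1/2)^i" for i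
      using d[of i] fast[of i] by (auto simp: L2_def L2norm_def d_def)
    have *: "(\<lambda>x. complex_of_real (\<Sum>i=m..<n. cmod (d i x))) \<in> L2 N \<and>
        L2norm N (\<lambda>x. complex_of_real (\<Sum>i=m..<n. cmod (d i x))) \<le> (\<Sum>i=m..<n. (1/2)^i)"
    proof (induction n)
      case 0
      then show ?case by (simp add: L2norm_def)
    next
      case (Suc n)
      show ?case
      proof (cases "m \<le> n")
        case True
        then show ?thesis
          using L2_add[OF conjunct1[OF Suc] cd(1)[of n]] L2norm_triangle[OF conjunct1[OF Suc] cd(1)[of n]]
            Suc cd(2)[of n] by (simp add: of_real_add[symmetric] del: of_real_add of_real_sum)
      next
        case False
        then show ?thesis by (simp add: L2norm_def)
      qed
    qed
    have "(\<Sum>i=m..<n. (1/2::real)^i) \<le> 2 * (1/2)^m"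
    proof (cases "m \<le> n")
      case True
      have "(\<Sum>i=m..<n. (1/2::real)^i) = 2 * (1/2)^m - 2 * (1/2)^n"
        using True by (induction n rule: dec_induct) auto
      then show ?thesis by simp
    qed simp
    then show "L2norm N (\<lambda>x. complex_of_real (\<Sum>i=m..<n. cmod (d i x))) \<le> 2 * (1/2)^m"
      "(\<lambda>x. complex_of_real (\<Sum>i=m..<n. cmod (d i x))) \<in> L2 N"
      using * by auto
  qed
  have tail: "(\<integral>\<^sup>+x. (\<Sum>i. ennreal (cmod (d (i + m) x)))\<^sup>2 \<partial>N) \<le> ennreal ((2 * (1/2)^m)\<^sup>2)" for m
  proof -
    have inc: "incseq (\<lambda>n x. (\<Sum>i<n. ennreal (cmod (d (i + m) x)))\<^sup>2)"
      by (intro incseq_SucI le_funI power_mono) auto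
    have "(\<Sum>i. ennreal (cmod (d (i + m) x)))\<^sup>2 = (SUP n. (\<Sum>i<n. ennreal (cmod (d (i + m) x)))\<^sup>2)" for x
      by (subst SUP_power2_ennreal[symmetric]) (auto simp: suminf_eq_SUP intro!: incseq_SucI ennreal_leI)
    then have "(\<integral>\<^sup>+x. (\<Sum>i. ennreal (cmod (d (i + m) x)))\<^sup>2 \<partial>N) =
        (SUP n. \<integral>\<^sup>+x. (\<Sum>i<n. ennreal (cmod (d (i + m) x)))\<^sup>2 \<partial>N)"
      using inc by (simp add: nn_integral_monotone_convergence_SUP)
    also have "\<dots> \<le> ennreal ((2 * (1/2)^m)\<^sup>2)"
    proof (rule SUP_least)
      fix n :: nat
      have "(\<Sum>i<n. cmod (d (i + m) x)) = (\<Sum>i=m..<n+m. cmod (d i x))" for x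
        using sum.shift_bounds_nat_ivl[of "\<lambda>i. cmod (d i x)" 0 m n] by (simp add: atLeast0LessThan)
      then have "(\<integral>\<^sup>+x. (\<Sum>i<n. ennreal (cmod (d (i + m) x)))\<^sup>2 \<partial>N) =
          (\<integral>\<^sup>+x. ennreal ((cmod (complex_of_real (\<Sum>i=m..<n+m. cmod (d i x))))\<^sup>2) \<partial>N)"
        by (intro nn_integral_cong) (simp add: ennreal_power sum_nonneg del: of_real_sum)
      also have "\<dots> = ennreal ((L2norm N (\<lambda>x. complex_of_real (\<Sum>i=m..<n+m. cmod (d i x))))\<^sup>2)"
        by (rule ennreal_L2norm_sq[OF sum_L2, symmetric])
      also have "\<dots> \<le> ennreal ((2 * (1/2)^m)\<^sup>2)"
        by (intro ennreal_leI power_mono norm_sum L2norm_nonneg)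
      finally show "(\<integral>\<^sup>+x. (\<Sum>i<n. ennreal (cmod (d (i + m) x)))\<^sup>2 \<partial>N) \<le> ennreal ((2 * (1/2)^m)\<^sup>2)" .
    qed
    finally show ?thesis .
  qed
  have "AE x in N. (\<Sum>i. ennreal (cmod (d (i + 0) x)))\<^sup>2 \<noteq> \<infinity>"
    using tail[of 0] by (intro nn_integral_PInf_AE) (auto simp: top_unique)
  then have summ: "AE x in N. (\<Sum>i. ennreal (cmod (d i x))) \<noteq> \<infinity> \<and> summable (\<lambda>i. cmod (d i x))"
  proof eventually_elim
    case (elim x)
    then have "(\<Sum>i. ennreal (cmod (d i x))) \<noteq> \<infinity>" by (auto simp: power2_eq_square)
    then show ?case using summable_suminf_not_top[of "\<lambda>i. cmod (d i x)"] by simp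
  qed
  \<comment> \<open>Convergence is tested by finiteness of a sum in \<open>ennreal\<close>, which is
    a measurable condition; the value 0 elsewhere affects a null set only.\<close>
  define g where "g x = (if (\<Sum>i. ennreal (cmod (d i x))) \<noteq> \<infinity> then f 0 x + (\<Sum>i. d i x) else 0)" for x
  have [measurable]: "g \<in> borel_measurable N" unfolding g_def by measurable
  have bound: "AE x in N. ennreal ((cmod (f m x - g x))\<^sup>2) \<le> (\<Sum>i. ennreal (cmod (d (i + m) x)))\<^sup>2" for m
    using summ
  proof eventually_elim
    case (elim x)
    then have elim: "(\<Sum>i. ennreal (cmod (d i x))) \<noteq> \<infinity>" "summable (\<lambda>i. cmod (d i x))" by auto
    from elim(2) have s: "summable (\<lambda>i. d i x)" by (rule summable_norm_cancel)
    have "f m x = f 0 x + (\<Sum>i<m. d i x)" by (induction m) (auto simp: d_def)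
    then have "g x - f m x = (\<Sum>i. d (i + m) x)"
      using elim suminf_split_initial_segment[OF s, of m] by (simp add: g_def)
    then have "cmod (f m x - g x) \<le> (\<Sum>i. cmod (d (i + m) x))"
      using summable_norm[of "\<lambda>i. d (i + m) x"] elim summable_ignore_initial_segment[OF elim(2), of m]
        by (simp add: norm_minus_commute[of "f m x"])
    then have "ennreal (cmod (f m x - g x)) \<le> (\<Sum>i. ennreal (cmod (d (i + m) x)))"
      using summable_ignore_initial_segment[OF elim(2), of m]
      by (subst suminf_ennreal2) (auto intro!: ennreal_leI)
    then have "(ennreal (cmod (f m x - g x)))\<^sup>2 \<le> (\<Sum>i. ennreal (cmod (d (i + m) x)))\<^sup>2"
      by (intro power_mono) auto
    then show ?case by (simp add: ennreal_power)
  qed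
  have le: "(\<integral>\<^sup>+x. ennreal ((cmod (f m x - g x))\<^sup>2) \<partial>N) \<le> ennreal ((2 * (1/2)^m)\<^sup>2)" for m
    using order_trans[OF nn_integral_mono_AE[OF bound] tail] .
  have dL2: "(\<lambda>x. f m x - g x) \<in> L2 N" for m
    using le[of m] by (subst L2_iff_nn_integral) (auto simp: le_less_trans)
  have "g \<in> L2 N" using L2_diff[OF f[of 0] dL2[of 0]] by simp
  moreover have "(\<lambda>n. L2norm N (\<lambda>x. f n x - g x)) \<longlonglongrightarrow> 0"
  proof (rule Lim_null_comparison)
    show "\<forall>\<^sub>F n in sequentially. norm (L2norm N (\<lambda>x. f n x - g x)) \<le> 2 * (1/2)^n"
    proof (intro always_eventually allI)
      fix n
      have "ennreal ((L2norm N (\<lambda>x. f n x - g x))\<^sup>2) \<le> ennreal ((2 * (1/2)^n)\<^sup>2)"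
        using le[of n] ennreal_L2norm_sq[OF dL2[of n]] by simp
      then have "(L2norm N (\<lambda>x. f n x - g x))\<^sup>2 \<le> (2 * (1/2)^n)\<^sup>2" by (subst (asm) ennreal_le_iff) auto
      then show "norm (L2norm N (\<lambda>x. f n x - g x)) \<le> 2 * (1/2)^n"
        using power2_le_imp_le[of "L2norm N (\<lambda>x. f n x - g x)" "2 * (1/2)^n"]
        by (simp add: L2norm_nonneg)
    qed
    show "(\<lambda>n. 2 * (1/2::real)^n) \<longlonglongrightarrow> 0" by (intro tendsto_mult_right_zero LIMSEQ_power_zero) auto
  qed
  ultimately show ?thesis using that by blast
qed

subsection \<open>Uniqueness of invariant measures\<close>

text \<open>Haar and Plancherel measure are assumed invariant for images of sets, while substitution
  in integrals wants invariance of the image measure. The map \<open>g\<close> stands for the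
  inverse of \<open>f\<close>.\<close>

lemma distr_eqI_invariant:
  assumes inj: "\<And>B. B \<in> sets \<mu> \<Longrightarrow> f -` B \<inter> space \<mu> = g ` B"
    and [measurable]: "f \<in> \<mu> \<rightarrow>\<^sub>M \<mu>"
    and inv: "\<And>B. B \<in> sets \<mu> \<Longrightarrow> emeasure \<mu> (g ` B) = emeasure \<mu> B"
  shows "distr \<mu> \<mu> f = \<mu>"
  by (rule measure_eqI) (auto simp: emeasure_distr inj inv)

text \<open>The double integral of \<open>f (m y x) * g y\<close> is evaluated twice. Translation in
  \<open>x\<close> splits it into the left-hand product. Replacing \<open>y\<close> by its translate
  under the inverse of \<open>x\<close> leaves \<open>f y * g (m (n x) y)\<close>, and translation
  in \<open>x\<close> then gives the right-hand product with \<open>g\<close> reflected. The laws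
  \<open>l1\<close> and \<open>l2\<close> are those of an abelian group with operation
  \<open>m\<close> and inverse \<open>n\<close>.\<close>

lemma invariant_measure_unique_aux:
  assumes "sigma_finite_measure \<mu>" "sigma_finite_measure \<nu>" and sets_eq[measurable_cong]: "sets \<nu> = sets \<mu>"
    and m: "(\<lambda>(x, y). m x y) \<in> \<mu> \<Otimes>\<^sub>M \<mu> \<rightarrow>\<^sub>M \<mu>" and neg[measurable]: "n \<in> \<mu> \<rightarrow>\<^sub>M \<mu>"
    and l1: "\<And>x y. x \<in> space \<mu> \<Longrightarrow> y \<in> space \<mu> \<Longrightarrow> m (m (n x) y) x = y"
    and l2: "\<And>x y. x \<in> space \<mu> \<Longrightarrow> y \<in> space \<mu> \<Longrightarrow> n (m (n y) x) = m (n x) y"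
    and inv\<mu>: "\<And>x. x \<in> space \<mu> \<Longrightarrow> distr \<mu> \<mu> (m x) = \<mu>"
    and inv\<nu>: "\<And>x. x \<in> space \<mu> \<Longrightarrow> distr \<nu> \<nu> (m x) = \<nu>"
    and f[measurable]: "f \<in> borel_measurable \<mu>" and g[measurable]: "g \<in> borel_measurable \<mu>"
  shows "(\<integral>\<^sup>+x. f x \<partial>\<mu>) * (\<integral>\<^sup>+x. g x \<partial>\<nu>) = (\<integral>\<^sup>+x. f x \<partial>\<nu>) * (\<integral>\<^sup>+x. g (n x) \<partial>\<mu>)"
proof -
  interpret \<mu>: sigma_finite_measure \<mu> by fact
  interpret \<nu>: sigma_finite_measure \<nu> by fact
  interpret pair_sigma_finite \<mu> \<nu> ..
  have sp: "space \<nu> = space \<mu>" by (rule sets_eq_imp_space_eq[OF sets_eq])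
  have [measurable (raw)]: "(\<lambda>w. m (p w) (q w)) \<in> K \<rightarrow>\<^sub>M \<mu>" if "p \<in> K \<rightarrow>\<^sub>M \<mu>" "q \<in> K \<rightarrow>\<^sub>M \<mu>" for p q K
    using measurable_compose[OF measurable_Pair[OF that] m] by simp
  have tr\<mu>: "(\<integral>\<^sup>+y. h (m x y) \<partial>\<mu>) = (\<integral>\<^sup>+y. h y \<partial>\<mu>)"
    if [measurable]: "h \<in> borel_measurable \<mu>" and x: "x \<in> space \<mu>" for h x
  proof -
    have "(\<integral>\<^sup>+y. h y \<partial>\<mu>) = (\<integral>\<^sup>+y. h y \<partial>distr \<mu> \<mu> (m x))" by (simp add: inv\<mu> x)
    also have "\<dots> = (\<integral>\<^sup>+y. h (m x y) \<partial>\<mu>)" using x by (intro nn_integral_distr) auto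
    finally show ?thesis ..
  qed
  have tr\<nu>: "(\<integral>\<^sup>+y. h (m x y) \<partial>\<nu>) = (\<integral>\<^sup>+y. h y \<partial>\<nu>)"
    if [measurable]: "h \<in> borel_measurable \<mu>" and x: "x \<in> space \<mu>" for h x
  proof -
    have "(\<integral>\<^sup>+y. h y \<partial>\<nu>) = (\<integral>\<^sup>+y. h y \<partial>distr \<nu> \<nu> (m x))" by (simp add: inv\<nu> x)
    also have "\<dots> = (\<integral>\<^sup>+y. h (m x y) \<partial>\<nu>)" using x by (intro nn_integral_distr) auto
    finally show ?thesis ..
  qed
  have "(\<integral>\<^sup>+x. f x \<partial>\<mu>) * (\<integral>\<^sup>+x. g x \<partial>\<nu>) = (\<integral>\<^sup>+y. (\<integral>\<^sup>+x. f x \<partial>\<mu>) * g y \<partial>\<nu>)"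
    by (simp add: nn_integral_cmult)
  also have "\<dots> = (\<integral>\<^sup>+y. (\<integral>\<^sup>+x. f (m y x) * g y \<partial>\<mu>) \<partial>\<nu>)"
    by (intro nn_integral_cong) (simp add: tr\<mu> sp nn_integral_multc)
  also have "\<dots> = (\<integral>\<^sup>+x. (\<integral>\<^sup>+y. f (m y x) * g y \<partial>\<nu>) \<partial>\<mu>)"
    by (intro Fubini') measurable
  also have "\<dots> = (\<integral>\<^sup>+x. (\<integral>\<^sup>+y. f y * g (m (n x) y) \<partial>\<nu>) \<partial>\<mu>)"
  proof (rule nn_integral_cong)
    fix x assume x: "x \<in> space \<mu>"
    then have nx: "n x \<in> space \<mu>" using measurable_space[OF neg] by blast
    have "(\<integral>\<^sup>+y. f (m y x) * g y \<partial>\<nu>) = (\<integral>\<^sup>+y. f (m (m (n x) y) x) * g (m (n x) y) \<partial>\<nu>)"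
      using x nx by (subst tr\<nu>[of "\<lambda>y. f (m y x) * g y", symmetric]) auto
    also have "\<dots> = (\<integral>\<^sup>+y. f y * g (m (n x) y) \<partial>\<nu>)"
      using x by (intro nn_integral_cong) (simp add: l1 sp)
    finally show "(\<integral>\<^sup>+y. f (m y x) * g y \<partial>\<nu>) = (\<integral>\<^sup>+y. f y * g (m (n x) y) \<partial>\<nu>)" .
  qed
  also have "\<dots> = (\<integral>\<^sup>+y. (\<integral>\<^sup>+x. f y * g (m (n x) y) \<partial>\<mu>) \<partial>\<nu>)"
    by (intro Fubini'[symmetric]) measurable
  also have "\<dots> = (\<integral>\<^sup>+y. f y * (\<integral>\<^sup>+x. g (n x) \<partial>\<mu>) \<partial>\<nu>)"
  proof (intro nn_integral_cong)
    fix y assume "y \<in> space \<nu>"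
    then have y: "y \<in> space \<mu>" and ny: "n y \<in> space \<mu>" using measurable_space[OF neg] sp by auto
    have "(\<integral>\<^sup>+x. g (m (n x) y) \<partial>\<mu>) = (\<integral>\<^sup>+x. g (n (m (n y) x)) \<partial>\<mu>)"
      using y by (intro nn_integral_cong) (simp add: l2)
    also have "\<dots> = (\<integral>\<^sup>+x. g (n x) \<partial>\<mu>)"
      using ny by (intro tr\<mu>[of "\<lambda>x. g (n x)"]) auto
    finally show "(\<integral>\<^sup>+x. f y * g (m (n x) y) \<partial>\<mu>) = f y * (\<integral>\<^sup>+x. g (n x) \<partial>\<mu>)"
      using y by (subst nn_integral_cmult) auto
  qed
  also have "\<dots> = (\<integral>\<^sup>+x. f x \<partial>\<nu>) * (\<integral>\<^sup>+x. g (n x) \<partial>\<mu>)"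
    by (simp add: nn_integral_multc)
  finally show ?thesis .
qed

text \<open>The reflection in the auxiliary identity is removed by applying that identity with both
  measures equal to \<mu> and \<open>f\<close> the indicator of a set of positive finite measure: it
  says that \<mu> itself is invariant under \<open>n\<close>. The product form of the conclusion
  expresses proportionality of the two measures without division.\<close>

theorem invariant_measure_unique:
  assumes "sigma_finite_measure \<mu>" "sigma_finite_measure \<nu>" and sets_eq: "sets \<nu> = sets \<mu>"
    and m: "(\<lambda>(x, y). m x y) \<in> \<mu> \<Otimes>\<^sub>M \<mu> \<rightarrow>\<^sub>M \<mu>" and neg: "n \<in> \<mu> \<rightarrow>\<^sub>M \<mu>"
    and l1: "\<And>x y. x \<in> space \<mu> \<Longrightarrow> y \<in> space \<mu> \<Longrightarrow> m (m (n x) y) x = y"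
    and l2: "\<And>x y. x \<in> space \<mu> \<Longrightarrow> y \<in> space \<mu> \<Longrightarrow> n (m (n y) x) = m (n x) y"
    and inv\<mu>: "\<And>x. x \<in> space \<mu> \<Longrightarrow> distr \<mu> \<mu> (m x) = \<mu>"
    and inv\<nu>: "\<And>x. x \<in> space \<mu> \<Longrightarrow> distr \<nu> \<nu> (m x) = \<nu>"
    and f: "f \<in> borel_measurable \<mu>" and g: "g \<in> borel_measurable \<mu>"
  shows "(\<integral>\<^sup>+x. f x \<partial>\<mu>) * (\<integral>\<^sup>+x. g x \<partial>\<nu>) = (\<integral>\<^sup>+x. f x \<partial>\<nu>) * (\<integral>\<^sup>+x. g x \<partial>\<mu>)"
proof -
  interpret \<mu>: sigma_finite_measure \<mu> by fact
  have refl: "(\<integral>\<^sup>+x. g (n x) \<partial>\<mu>) = (\<integral>\<^sup>+x. g x \<partial>\<mu>)"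
  proof (cases "emeasure \<mu> (space \<mu>) = 0")
    case True
    have "(\<integral>\<^sup>+x. h x \<partial>\<mu>) = 0" for h
    proof -
      have "AE x in \<mu>. h x = 0" by (rule AE_I[of _ _ "space \<mu>"]) (use True in auto)
      then have "(\<integral>\<^sup>+x. h x \<partial>\<mu>) = (\<integral>\<^sup>+x. 0 \<partial>\<mu>)" by (intro nn_integral_cong_AE) auto
      then show ?thesis by simp
    qed
    then show ?thesis by simp
  next
    case False
    obtain A :: "nat \<Rightarrow> 'a set" where A: "range A \<subseteq> sets \<mu>" "(\<Union>i. A i) = space \<mu>" "\<And>i. emeasure \<mu> (A i) \<noteq> \<infinity>"
      using \<mu>.sigma_finite by metis
    obtain i where i: "emeasure \<mu> (A i) \<noteq> 0"
      using False A emeasure_UN_eq_0[of \<mu> A] by metis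
    have "(\<integral>\<^sup>+x. indicator (A i) x \<partial>\<mu>) * (\<integral>\<^sup>+x. g x \<partial>\<mu>) = (\<integral>\<^sup>+x. indicator (A i) x \<partial>\<mu>) * (\<integral>\<^sup>+x. g (n x) \<partial>\<mu>)"
      using A by (intro invariant_measure_unique_aux[where m = m] assms refl borel_measurable_indicator) auto
    moreover have "(\<integral>\<^sup>+x. indicator (A i) x \<partial>\<mu>) = emeasure \<mu> (A i)" using A by auto
    ultimately show ?thesis
      using i A(3)[of i] by (simp add: ennreal_mult_cancel_left)
  qed
  show ?thesis
    using invariant_measure_unique_aux[OF assms] refl by simp
qed

subsection \<open>Random selection from a measurable family of distributions\<close>

text \<open>A quantile at a uniformly random level has the prescribed distribution, so for each
  \<xi> almost every level satisfies \<open>P\<close>. Fubini then provides a single level that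
  works for almost every \<xi>. The selection depends on \<xi> through \<open>D \<xi>\<close> alone,
  which later makes it constant on orbits.\<close>

lemma random_selection:
  fixes D :: "'b \<Rightarrow> real measure"
  assumes "sigma_finite_measure \<Omega>"
    and D: "\<And>\<xi>. \<xi> \<in> space \<Omega> \<Longrightarrow> real_distribution (D \<xi>)"
    and cdf[measurable]: "\<And>x. (\<lambda>\<xi>. cdf (D \<xi>) x) \<in> borel_measurable \<Omega>"
    and P[measurable]: "Measurable.pred (\<Omega> \<Otimes>\<^sub>M borel) P"
    and AE_P: "\<And>\<xi>. \<xi> \<in> space \<Omega> \<Longrightarrow> AE y in D \<xi>. P (\<xi>, y)"
  obtains s where "s \<in> borel_measurable \<Omega>" "\<And>\<xi> \<eta>. D \<xi> = D \<eta> \<Longrightarrow> s \<xi> = s \<eta>"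
    "AE \<xi> in \<Omega>. P (\<xi>, s \<xi>)"
proof -
  define L where "L = restrict_space lborel {0<..<1::real}"
  have L: "prob_space L"
    unfolding L_def by (auto simp: space_restrict_space emeasure_restrict_space intro!: prob_spaceI)
  interpret L: prob_space L by fact
  interpret \<Omega>: sigma_finite_measure \<Omega> by fact
  interpret pair_sigma_finite \<Omega> L ..
  have spL: "space L = {0<..<1}" by (simp add: L_def space_restrict_space)
  \<comment> \<open>The quantile at level \<open>t\<close>. Its Galois relation with the
    distribution function, \<open>S_le\<close>, turns measurability in both variables into
    measurability of the distribution functions.\<close>
  define S where "S t \<xi> = Inf {x. t \<le> cdf (D \<xi>) x}" for t \<xi>
  have id_L[measurable]: "(\<lambda>t. t) \<in> borel_measurable L"
    unfolding L_def by (intro measurable_restrict_space1) simp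
  have S_le: "S t \<xi> \<le> x \<longleftrightarrow> t \<le> cdf (D \<xi>) x" if "\<xi> \<in> space \<Omega>" "t \<in> {0<..<1}" for t \<xi> x
  proof -
    interpret cdf_distribution "D \<xi>" using D[OF that(1)] by (simp add: cdf_distribution_def)
    show ?thesis using pseudoinverse'[rule_format, OF that(2), of x] unfolding S_def by simp
  qed
  have [measurable]: "(\<lambda>w. S (snd w) (fst w)) \<in> borel_measurable (\<Omega> \<Otimes>\<^sub>M L)"
  proof (rule borel_measurable_iff_le[THEN iffD2], intro allI)
    fix a
    have "{w \<in> space (\<Omega> \<Otimes>\<^sub>M L). S (snd w) (fst w) \<le> a} =
        {w \<in> space (\<Omega> \<Otimes>\<^sub>M L). snd w \<le> cdf (D (fst w)) a}"
      by (auto simp: space_pair_measure spL S_le)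
    also have "\<dots> \<in> sets (\<Omega> \<Otimes>\<^sub>M L)" by measurable
    finally show "{w \<in> space (\<Omega> \<Otimes>\<^sub>M L). S (snd w) (fst w) \<le> a} \<in> sets (\<Omega> \<Otimes>\<^sub>M L)" .
  qed
  have [measurable]: "(\<lambda>t. S t \<xi>) \<in> borel_measurable L" if "\<xi> \<in> space \<Omega>" for \<xi>
    using measurable_compose[OF measurable_Pair1'[OF that] \<open>(\<lambda>w. S (snd w) (fst w)) \<in> _\<close>] by simp
  have S2[measurable]: "(\<lambda>\<xi>. S t \<xi>) \<in> borel_measurable \<Omega>" if "t \<in> space L" for t
    using measurable_compose[OF measurable_Pair2'[OF that] \<open>(\<lambda>w. S (snd w) (fst w)) \<in> _\<close>] by simp
  have "AE t in L. P (\<xi>, S t \<xi>)" if \<xi>: "\<xi> \<in> space \<Omega>" for \<xi>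
  proof -
    interpret cdf_distribution "D \<xi>" using D[OF \<xi>] by (simp add: cdf_distribution_def)
    have "distr L borel (\<lambda>t. S t \<xi>) = D \<xi>"
      using distr_I_eq_M unfolding L_def S_def by simp
    then have "AE y in distr L borel (\<lambda>t. S t \<xi>). P (\<xi>, y)" using AE_P[OF \<xi>] by (simp only:)
    then show ?thesis
      using \<xi>
        by (subst (asm) AE_distr_iff) (auto intro!: measurable_compose[OF _ P] simp: pred_def[symmetric])
  qed
  then have "AE \<xi> in \<Omega>. AE t in L. P (\<xi>, S t \<xi>)" by simp
  then have "AE t in L. AE \<xi> in \<Omega>. P (\<xi>, S t \<xi>)"
    by (subst (asm) AE_commute) (auto simp: space_pair_measure)
  then obtain t where t: "t \<in> space L" "AE \<xi> in \<Omega>. P (\<xi>, S t \<xi>)"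
    using eventually_happens'[OF L.ae_filter_bot] AE_space[of L]
    by (metis (mono_tags, lifting) eventually_conj)
  show ?thesis
    using t S2[OF t(1)] by (intro that[of "S t"]) (auto simp: S_def)
qed

subsection \<open>Second countable locally compact Hausdorff spaces\<close>

lemma space_borel_of [simp]: "space (borel_of T) = topspace T"
  unfolding borel_of_def by (rule space_measure_of) (auto dest: openin_subset)

lemma sets_borel_of: "sets (borel_of T) = sigma_sets (topspace T) {U. openin T U}"
  unfolding borel_of_def by (rule sets_measure_of) (auto dest: openin_subset)

lemma openin_sets_borel_of: "openin T U \<Longrightarrow> U \<in> sets (borel_of T)"
  unfolding sets_borel_of by auto

lemma closedin_sets_borel_of:
  assumes "closedin T C" shows "C \<in> sets (borel_of T)"
proof -
  have "topspace T - (topspace T - C) \<in> sets (borel_of T)"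
    using sets.compl_sets[OF openin_sets_borel_of[of T "topspace T - C"]] assms by auto
  then show ?thesis using closedin_subset[OF assms] by (simp add: double_diff)
qed

lemma sets_borel_of_euclidean: "sets (borel_of euclidean) = sets borel"
  unfolding sets_borel_of borel_def by simp

lemma countable_base_compact_closure:
  assumes sc: "second_countable T" and lc: "locally_compact_space T" and H: "Hausdorff_space T"
  obtains \<B> where "countable \<B>" "\<And>V. V \<in> \<B> \<Longrightarrow> openin T V" "\<And>V. V \<in> \<B> \<Longrightarrow> compactin T (T closure_of V)"
    "\<And>U x. openin T U \<Longrightarrow> x \<in> U \<Longrightarrow> \<exists>V\<in>\<B>. x \<in> V \<and> T closure_of V \<subseteq> U"
proof -
  obtain \<B> where \<B>: "countable \<B>" "\<And>V. V \<in> \<B> \<Longrightarrow> openin T V"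
    "\<And>U x. openin T U \<Longrightarrow> x \<in> U \<Longrightarrow> \<exists>V\<in>\<B>. x \<in> V \<and> V \<subseteq> U"
    using sc unfolding second_countable_def by metis
  have nb: "neighbourhood_base_of (\<lambda>C. compactin T C \<and> closedin T C) T"
    using lc H locally_compact_space_neighbourhood_base_closedin by blast
  show ?thesis
  proof (rule that[of "{V \<in> \<B>. compactin T (T closure_of V)}"])
    fix U x assume "openin T U" "x \<in> U"
    then obtain W C where W: "openin T W" "compactin T C" "closedin T C" "x \<in> W" "W \<subseteq> C" "C \<subseteq> U"
      using nb[unfolded neighbourhood_base_of, rule_format, of U x] by auto
    obtain V where V: "V \<in> \<B>" "x \<in> V" "V \<subseteq> W" using \<B>(3)[OF W(1,4)] by blast
    have "T closure_of V \<subseteq> C" using V W by (intro closure_of_minimal) auto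
    then show "\<exists>V\<in>{V \<in> \<B>. compactin T (T closure_of V)}. x \<in> V \<and> T closure_of V \<subseteq> U"
      using V W closed_compactin[OF W(2) _ closedin_closure_of] by blast
  qed (use \<B> in auto)
qed

lemma sigma_finite_measure_borel_of:
  assumes sc: "second_countable T" and lc: "locally_compact_space T" and H: "Hausdorff_space T"
    and sets: "sets \<mu> = sets (borel_of T)"
    and fin: "\<And>K. compactin T K \<Longrightarrow> emeasure \<mu> K < \<infinity>"
  shows "sigma_finite_measure \<mu>"
proof -
  obtain \<B> where \<B>: "countable \<B>" "\<And>V. V \<in> \<B> \<Longrightarrow> openin T V" "\<And>V. V \<in> \<B> \<Longrightarrow> compactin T (T closure_of V)"
    "\<And>U x. openin T U \<Longrightarrow> x \<in> U \<Longrightarrow> \<exists>V\<in>\<B>. x \<in> V \<and> T closure_of V \<subseteq> U"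
    using countable_base_compact_closure[OF sc lc H] by metis
  have sp: "space \<mu> = topspace T" using sets_eq_imp_space_eq[OF sets] by simp
  show ?thesis
  proof
    show "\<exists>A. countable A \<and> A \<subseteq> sets \<mu> \<and> \<Union> A = space \<mu> \<and> (\<forall>a\<in>A. emeasure \<mu> a \<noteq> \<infinity>)"
    proof (intro exI[of _ "(\<lambda>V. T closure_of V) ` \<B>"] conjI ballI)
      show "(\<lambda>V. T closure_of V) ` \<B> \<subseteq> sets \<mu>"
        using sets closedin_sets_borel_of[OF closedin_closure_of] by blast
      show "\<Union> ((\<lambda>V. T closure_of V) ` \<B>) = space \<mu>"
      proof (intro antisym subsetI)
        fix x assume "x \<in> space \<mu>"
        then obtain V where V: "V \<in> \<B>" "x \<in> V" using \<B>(4)[of "topspace T" x] by (auto simp: sp)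
        then show "x \<in> \<Union> ((\<lambda>V. T closure_of V) ` \<B>)"
          using closure_of_subset[OF openin_subset[OF \<B>(2)[OF V(1)]]] by (intro UN_I[OF V(1)]) auto
      qed (auto simp: sp in_closure_of)
      show "emeasure \<mu> a \<noteq> \<infinity>" if "a \<in> (\<lambda>V. T closure_of V) ` \<B>" for a
        using that fin[OF \<B>(3)] by (force simp: less_top[symmetric])
    qed (use \<B> in auto)
  qed
qed

lemma compact_exhaustion:
  assumes sc: "second_countable T" and lc: "locally_compact_space T" and H: "Hausdorff_space T"
  obtains K :: "nat \<Rightarrow> 'b set" where "\<And>n. compactin T (K n)" "(\<Union>n. K n) = topspace T"
proof -
  obtain \<B> where \<B>: "countable \<B>" "\<And>V. V \<in> \<B> \<Longrightarrow> openin T V" "\<And>V. V \<in> \<B> \<Longrightarrow> compactin T (T closure_of V)"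
    "\<And>U x. openin T U \<Longrightarrow> x \<in> U \<Longrightarrow> \<exists>V\<in>\<B>. x \<in> V \<and> T closure_of V \<subseteq> U"
    using countable_base_compact_closure[OF sc lc H] by metis
  show ?thesis
  proof (rule that[of "\<lambda>n. if \<B> = {} then {} else T closure_of (from_nat_into \<B> n)"])
    show "(\<Union>n. if \<B> = {} then {} else T closure_of (from_nat_into \<B> n)) = topspace T"
    proof (intro set_eqI iffI)
      fix x assume x: "x \<in> topspace T"
      then obtain V where V: "V \<in> \<B>" "x \<in> V" using \<B>(4)[of "topspace T" x] by auto
      then obtain n where "V = from_nat_into \<B> n" using \<B>(1) by (metis from_nat_into_surj)
      moreover have "x \<in> T closure_of V"
        using closure_of_subset[OF openin_subset[OF \<B>(2)[OF V(1)]]] V by blast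
      ultimately show "x \<in> (\<Union>n. if \<B> = {} then {} else T closure_of (from_nat_into \<B> n))"
        using V by auto
    qed (auto simp: in_closure_of split: if_splits)
  qed (use \<B>(3) in \<open>auto simp: from_nat_into\<close>)
qed

text \<open>Second countability makes an open subset of the product a countable union of open
  rectangles. Without it the Borel sets of a product may exceed the product \<sigma>-algebra, and
  jointly continuous maps would not be known to be measurable.\<close>

lemma sets_pair_borel_of_openin:
  assumes S: "second_countable S" and T: "second_countable T" and W: "openin (prod_topology S T) W"
  shows "W \<in> sets (borel_of S \<Otimes>\<^sub>M borel_of T)"
proof -
  obtain \<B> where \<B>: "countable \<B>" "\<And>V. V \<in> \<B> \<Longrightarrow> openin S V"
    "\<And>U x. openin S U \<Longrightarrow> x \<in> U \<Longrightarrow> \<exists>V\<in>\<B>. x \<in> V \<and> V \<subseteq> U"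
    using S unfolding second_countable_def by metis
  obtain \<C> where \<C>: "countable \<C>" "\<And>V. V \<in> \<C> \<Longrightarrow> openin T V"
    "\<And>U x. openin T U \<Longrightarrow> x \<in> U \<Longrightarrow> \<exists>V\<in>\<C>. x \<in> V \<and> V \<subseteq> U"
    using T unfolding second_countable_def by metis
  have "W = \<Union> ((\<lambda>(U, V). U \<times> V) ` {p \<in> \<B> \<times> \<C>. fst p \<times> snd p \<subseteq> W})"
  proof (intro set_eqI iffI)
    fix p assume "p \<in> W"
    obtain x y where p: "p = (x, y)" by fastforce
    obtain U V where UV: "openin S U" "openin T V" "x \<in> U" "y \<in> V" "U \<times> V \<subseteq> W"
      using W \<open>p \<in> W\<close> unfolding openin_prod_topology_alt p by meson
    obtain U' V' where "U' \<in> \<B>" "x \<in> U'" "U' \<subseteq> U" "V' \<in> \<C>" "y \<in> V'" "V' \<subseteq> V"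
      using \<B>(3)[OF UV(1,3)] \<C>(3)[OF UV(2,4)] by blast
    then show "p \<in> \<Union> ((\<lambda>(U, V). U \<times> V) ` {p \<in> \<B> \<times> \<C>. fst p \<times> snd p \<subseteq> W})"
      using UV(5) p by (intro UnionI[of "U' \<times> V'"]) force+
  qed auto
  also have "\<dots> \<in> sets (borel_of S \<Otimes>\<^sub>M borel_of T)"
    using \<B>(1,2) \<C>(1,2)
    by (intro sets.countable_Union countable_image countable_subset[OF _ countable_SIGMA[of \<B> "\<lambda>_. \<C>"]])
       (auto intro!: openin_sets_borel_of)
  finally show ?thesis .
qed

lemma measurable_continuous_map_borel_of:
  assumes "continuous_map S T f" shows "f \<in> borel_of S \<rightarrow>\<^sub>M borel_of T"
proof (unfold borel_of_def[of T], rule measurable_measure_of)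
  show "f -` U \<inter> space (borel_of S) \<in> sets (borel_of S)" if "U \<in> {U. openin T U}" for U
  proof -
    have "f -` U \<inter> space (borel_of S) = {x \<in> topspace S. f x \<in> U}" by auto
    then show ?thesis
      using that openin_continuous_map_preimage[OF assms, of U] by (simp add: openin_sets_borel_of)
  qed
qed (use assms in \<open>auto dest: openin_subset continuous_map_image_subset_topspace\<close>)

lemma measurable_continuous_map_prod:
  assumes S: "second_countable S" and T: "second_countable T"
    and f: "continuous_map (prod_topology S T) U f"
  shows "f \<in> borel_of S \<Otimes>\<^sub>M borel_of T \<rightarrow>\<^sub>M borel_of U"
proof (unfold borel_of_def[of U], rule measurable_measure_of)
  show "f -` O' \<inter> space (borel_of S \<Otimes>\<^sub>M borel_of T) \<in> sets (borel_of S \<Otimes>\<^sub>M borel_of T)"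
    if "O' \<in> {O'. openin U O'}" for O'
  proof -
    have "f -` O' \<inter> space (borel_of S \<Otimes>\<^sub>M borel_of T) = {x \<in> topspace (prod_topology S T). f x \<in> O'}"
      by (auto simp: space_pair_measure)
    then show ?thesis
      using that openin_continuous_map_preimage[OF f, of O'] by (simp add: sets_pair_borel_of_openin S T)
  qed
  show "f \<in> space (borel_of S \<Otimes>\<^sub>M borel_of T) \<rightarrow> topspace U"
    using f by (auto simp: space_pair_measure continuous_map_def)
qed (auto dest: openin_subset)

subsection \<open>The dual group as a standard Borel space\<close>

lemma is_characterD:
  assumes "is_character \<xi>"
  shows "continuous_on UNIV \<xi>" "\<xi> (x + y) = \<xi> x * \<xi> y" "cmod (\<xi> x) = 1"
  using assms unfolding is_character_def by auto

lemma is_character_0: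
  assumes "is_character \<xi>" shows "\<xi> 0 = 1"
proof -
  have "\<xi> 0 * \<xi> 0 = \<xi> 0" using is_characterD(2)[OF assms, of 0 0] by simp
  moreover have "\<xi> 0 \<noteq> 0" using is_characterD(3)[OF assms, of 0] by auto
  ultimately show ?thesis by simp
qed

lemma cnj_eq_inverse_unimodular: "cmod z = 1 \<Longrightarrow> z * cnj z = 1"
  by (simp add: complex_norm_square[symmetric])

lemma dual_group_iff: "\<xi> \<in> dual_group \<longleftrightarrow> is_character \<xi>"
  by (simp add: dual_group_def)

lemma topspace_dual_topology: "topspace dual_topology = dual_group"
proof -
  have "dual_group \<in> {{ch \<in> dual_group. ch ` K \<subseteq> U} | K U. compact K \<and> open U}"
    by (auto intro!: exI[of _ "{}"])
  then show ?thesis unfolding dual_topology_def topology_generated_by_topspace by auto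
qed

lemma openin_dual_subbase:
  "compact K \<Longrightarrow> open U \<Longrightarrow> openin dual_topology {\<xi> \<in> dual_group. \<xi> ` K \<subseteq> U}"
  unfolding dual_topology_def by (rule topology_generated_by_Basis) blast

text \<open>The values at these points are the countably many coordinates in which characters are
  described.\<close>

definition dense_seq :: "nat \<Rightarrow> 'a::second_countable_topology" where
  "dense_seq = (SOME d. \<forall>U. open U \<longrightarrow> U \<noteq> {} \<longrightarrow> (\<exists>k. d k \<in> U))"

lemma dense_seq:
  fixes U :: "'a::second_countable_topology set"
  assumes "open U" "U \<noteq> {}" shows "\<exists>k. dense_seq k \<in> U"
proof -
  obtain D :: "'a set" where D: "countable D" "\<And>X. open X \<Longrightarrow> X \<noteq> {} \<Longrightarrow> \<exists>d\<in>D. d \<in> X"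
    using countable_dense_exists by blast
  have "\<forall>U. open U \<longrightarrow> U \<noteq> {} \<longrightarrow> (\<exists>k. from_nat_into D k \<in> U)"
    using D by (metis from_nat_into_surj)
  then have "\<exists>d::nat \<Rightarrow> 'a. \<forall>U. open U \<longrightarrow> U \<noteq> {} \<longrightarrow> (\<exists>k. d k \<in> U)" by blast
  from someI_ex[OF this] show ?thesis using assms unfolding dense_seq_def by blast
qed

lemma dense_seq_converging:
  fixes a :: "'a::second_countable_topology"
  shows "\<exists>r. (\<lambda>n. dense_seq (r n)) \<longlonglongrightarrow> a"
proof -
  obtain A :: "nat \<Rightarrow> 'a set" where A: "\<And>i. open (A i)" "\<And>i. a \<in> A i"
    and lim: "\<And>F. (\<forall>n. F n \<in> A n) \<Longrightarrow> F \<longlonglongrightarrow> a"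
    by (rule first_countable_topology_class.countable_basis[of a]) blast
  have "\<forall>n. \<exists>k. dense_seq k \<in> A n" using dense_seq A(1,2) by blast
  then obtain r where "\<And>n. dense_seq (r n) \<in> A n" by metis
  then show ?thesis using lim[of "\<lambda>n. dense_seq (r n)"] by auto
qed

lemma continuous_eq_dense_seq:
  fixes f g :: "'a::second_countable_topology \<Rightarrow> complex"
  assumes "continuous_on UNIV f" "continuous_on UNIV g" "\<And>k. f (dense_seq k) = g (dense_seq k)"
  shows "f = g"
proof
  fix a :: 'a
  obtain r where r: "(\<lambda>n. dense_seq (r n)) \<longlonglongrightarrow> a" using dense_seq_converging by blast
  have "(\<lambda>n. f (dense_seq (r n))) \<longlonglongrightarrow> f a" "(\<lambda>n. g (dense_seq (r n))) \<longlonglongrightarrow> g a"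
    using continuous_on_tendsto_compose[OF assms(1) r] continuous_on_tendsto_compose[OF assms(2) r]
    by simp_all
  then show "f a = g a" using assms(3) by (simp add: LIMSEQ_unique)
qed

locale lca =
  fixes N :: "('a::{ab_group_add, t2_space, second_countable_topology} \<Rightarrow> complex) measure"
  assumes lca: "lca_group TYPE('a)"
    and space_N: "space N = dual_group"
    and sets_N: "sets N = sets (borel_of dual_topology)"
begin

lemma tendsto_add_group:
  assumes "(f \<longlongrightarrow> (a::'a)) F" "(g \<longlongrightarrow> b) F" shows "((\<lambda>x. f x + g x) \<longlongrightarrow> a + b) F"
proof -
  have c: "continuous_on UNIV (\<lambda>p::'a \<times> 'a. fst p + snd p)" using lca by (simp add: lca_group_def)
  show ?thesis using continuous_on_tendsto_compose[OF c tendsto_Pair[OF assms]] by simp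
qed

lemma tendsto_uminus_group:
  assumes "(f \<longlongrightarrow> (a::'a)) F" shows "((\<lambda>x. - f x) \<longlongrightarrow> - a) F"
proof -
  have c: "continuous_on UNIV (uminus :: 'a \<Rightarrow> 'a)" using lca by (simp add: lca_group_def)
  show ?thesis using continuous_on_tendsto_compose[OF c assms] by simp
qed

lemma tendsto_diff_group:
  assumes "(f \<longlongrightarrow> (a::'a)) F" "(g \<longlongrightarrow> b) F" shows "((\<lambda>x. f x - g x) \<longlongrightarrow> a - b) F"
  using tendsto_add_group[OF assms(1) tendsto_uminus_group[OF assms(2)]] by simp

lemma continuous_on_diff_group: "continuous_on UNIV (\<lambda>p::'a \<times> 'a. fst p - snd p)"
  unfolding continuous_on_def by (intro ballI tendsto_diff_group tendsto_fst tendsto_snd tendsto_ident_at)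

lemma continuous_on_add_group: "continuous_on UNIV (\<lambda>p::'a \<times> 'a. fst p + snd p)"
  using lca by (simp add: lca_group_def)

lemma second_countable_A: "second_countable (euclidean :: 'a topology)"
proof -
  obtain B :: "'a set set" where "countable B" "topological_basis B"
    using ex_countable_basis by blast
  then show ?thesis unfolding second_countable_def
    by (metis open_openin topological_basisE topological_basis_open)
qed

lemma locally_compact_A: "locally_compact_space (euclidean :: 'a topology)"
  using lca by (simp add: lca_group_def)

lemma Hausdorff_A: "Hausdorff_space (euclidean :: 'a topology)"
  unfolding Hausdorff_space_def disjnt_def using hausdorff by auto

lemma compact_closure_base:
  obtains \<B> :: "'a set set" where "countable \<B>" "\<And>V. V \<in> \<B> \<Longrightarrow> open V" "\<And>V. V \<in> \<B> \<Longrightarrow> compact (closure V)"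
    "\<And>U x. open U \<Longrightarrow> x \<in> U \<Longrightarrow> \<exists>V\<in>\<B>. x \<in> V \<and> closure V \<subseteq> U"
  by (rule countable_base_compact_closure[OF second_countable_A locally_compact_A Hausdorff_A]) (rule that; simp)

lemma sets_N_subbase:
  "compact K \<Longrightarrow> open U \<Longrightarrow> {\<xi> \<in> dual_group. \<xi> ` K \<subseteq> U} \<in> sets N"
  unfolding sets_N by (intro openin_sets_borel_of openin_dual_subbase)

text \<open>If \<xi> maps \<open>a\<close> into an open set \<open>U\<close>, continuity gives a
  basic neighbourhood of \<open>a\<close> whose compact closure is mapped into \<open>U\<close>. So
  the preimage of \<open>U\<close> is a countable union of rectangles with a compact-open set of
  characters as one side.\<close>

lemma measurable_eval: "(\<lambda>(\<xi>, a). \<xi> a) \<in> borel_measurable (N \<Otimes>\<^sub>M (borel :: 'a measure))"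
proof (rule borel_measurableI)
  fix U :: "complex set" assume U: "open U"
  obtain \<B> :: "'a set set" where \<B>: "countable \<B>" "\<And>V. V \<in> \<B> \<Longrightarrow> open V"
    "\<And>V. V \<in> \<B> \<Longrightarrow> compact (closure V)"
    "\<And>U x. open U \<Longrightarrow> x \<in> U \<Longrightarrow> \<exists>V\<in>\<B>. x \<in> V \<and> closure V \<subseteq> U"
    using compact_closure_base by metis
  have "(\<lambda>(\<xi>, a). \<xi> a) -` U \<inter> space (N \<Otimes>\<^sub>M (borel :: 'a measure)) =
      (\<Union>V\<in>\<B>. {\<xi> \<in> dual_group. \<xi> ` closure V \<subseteq> U} \<times> V)" (is "?L = ?R")
  proof (intro antisym subsetI)
    fix p assume "p \<in> ?L"
    then obtain \<xi> a where p: "p = (\<xi>, a)" "\<xi> \<in> dual_group" "\<xi> a \<in> U"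
      by (auto simp: space_pair_measure space_N)
    have "open (\<xi> -` U)"
      using p(2) U by (auto simp: dual_group_iff dest!: is_characterD(1) intro: open_vimage)
    then obtain V where "V \<in> \<B>" "a \<in> V" "closure V \<subseteq> \<xi> -` U" using \<B>(4)[of "\<xi> -` U" a] p(3) by auto
    then show "p \<in> ?R" using p by blast
  next
    fix p assume "p \<in> ?R"
    then show "p \<in> ?L" using closure_subset by (fastforce simp: space_pair_measure space_N)
  qed
  also have "\<dots> \<in> sets (N \<Otimes>\<^sub>M borel)"
    using \<B>(1-3) U by (intro sets.countable_UN') (auto intro!: sets_N_subbase)
  finally show "(\<lambda>(\<xi>, a). \<xi> a) -` U \<inter> space (N \<Otimes>\<^sub>M (borel :: 'a measure)) \<in> sets (N \<Otimes>\<^sub>M borel)" .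
qed

lemma measurable_eval_compose [measurable (raw)]:
  assumes "f \<in> \<Omega> \<rightarrow>\<^sub>M N" "g \<in> borel_measurable \<Omega>"
  shows "(\<lambda>\<omega>. f \<omega> (g \<omega> :: 'a)) \<in> borel_measurable \<Omega>"
  using measurable_compose[OF measurable_Pair[OF assms] measurable_eval] by simp

text \<open>Turns membership in a compact-open set into countably many conditions on coordinates.
  The compact image lies in one member \<open>C n\<close> of the exhaustion of \<open>W\<close>;
  conversely the preimage of \<open>C n\<close> is closed, and the dense points inside the open set
  \<open>V\<close> force it to contain the closure of \<open>V\<close>.\<close>

lemma image_closure_subset_iff:
  assumes \<xi>: "\<xi> \<in> dual_group" and V: "open (V :: 'a set)" "compact (closure V)"
    and C: "\<And>n::nat. compact (C n)" "\<And>K. compact K \<Longrightarrow> K \<subseteq> W \<Longrightarrow> \<exists>N. \<forall>n\<ge>N. K \<subseteq> C n"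
      "\<And>n. C n \<subseteq> W"
  shows "\<xi> ` closure V \<subseteq> W \<longleftrightarrow> (\<exists>n. \<forall>k. dense_seq k \<in> V \<longrightarrow> \<xi> (dense_seq k) \<in> C n)"
proof
  have cont: "continuous_on UNIV \<xi>" using \<xi> by (simp add: dual_group_iff is_characterD)
  {
    assume "\<xi> ` closure V \<subseteq> W"
    moreover have "compact (\<xi> ` closure V)"
      using V(2) cont by (meson compact_continuous_image continuous_on_subset subset_UNIV)
    ultimately obtain n where n: "\<xi> ` closure V \<subseteq> C n" using C(2)[of "\<xi> ` closure V"] by auto
    have "\<xi> (dense_seq k) \<in> C n" if "dense_seq k \<in> V" for k
      using n closure_subset[of V] that by blast
    then show "\<exists>n. \<forall>k. dense_seq k \<in> V \<longrightarrow> \<xi> (dense_seq k) \<in> C n" by blast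
  }
  assume "\<exists>n. \<forall>k. dense_seq k \<in> V \<longrightarrow> \<xi> (dense_seq k) \<in> C n"
  then obtain n where n: "\<And>k. dense_seq k \<in> V \<Longrightarrow> \<xi> (dense_seq k) \<in> C n" by blast
  have cl: "closed (\<xi> -` C n)" using cont C(1) by (auto intro: closed_vimage compact_imp_closed)
  have "V \<subseteq> \<xi> -` C n"
  proof (rule ccontr)
    assume "\<not> V \<subseteq> \<xi> -` C n"
    then have "V - \<xi> -` C n \<noteq> {}" by blast
    moreover have "open (V - \<xi> -` C n)" using V cl by (intro open_Diff)
    ultimately show False using dense_seq n by fastforce
  qed
  then have "closure V \<subseteq> \<xi> -` C n" using cl by (rule closure_minimal)
  then show "\<xi> ` closure V \<subseteq> W" using C(3) by blast
qed

text \<open>Basic compact-open sets whose compact sets are closures of open sets: the dense sequence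
  meets such a compact set densely, which an arbitrary compact set would not ensure.\<close>

definition dual_basic :: "('a \<Rightarrow> complex) set \<Rightarrow> bool" where
  "dual_basic G \<longleftrightarrow> (\<exists>F. finite F \<and> G = dual_group \<inter> \<Inter>F \<and>
     (\<forall>S\<in>F. \<exists>V W. open V \<and> compact (closure V) \<and> open W \<and> S = {\<xi> \<in> dual_group. \<xi> ` closure V \<subseteq> W}))"

text \<open>Second countability of the dual. Every subbasic set is, around each of its points,
  reached by finitely many conditions taken from countable bases of the group and of the
  plane.\<close>

lemma dual_open_countable_base:
  obtains \<F> where "countable \<F>"
    "\<And>G. G \<in> \<F> \<Longrightarrow> dual_basic G"
    "\<And>U \<xi>. openin dual_topology U \<Longrightarrow> \<xi> \<in> U \<Longrightarrow> \<exists>G\<in>\<F>. \<xi> \<in> G \<and> G \<subseteq> U"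
proof -
  obtain \<B> :: "'a set set" where \<B>: "countable \<B>" "\<And>V. V \<in> \<B> \<Longrightarrow> open V"
    "\<And>V. V \<in> \<B> \<Longrightarrow> compact (closure V)"
    "\<And>U x. open U \<Longrightarrow> x \<in> U \<Longrightarrow> \<exists>V\<in>\<B>. x \<in> V \<and> closure V \<subseteq> U"
    using compact_closure_base by metis
  obtain \<W> :: "complex set set" where \<W>: "countable \<W>" "topological_basis \<W>"
    using ex_countable_basis by blast
  define \<S> where "\<S> = (\<lambda>(V, W). {\<xi> \<in> dual_group. \<xi> ` closure V \<subseteq> W}) ` (\<B> \<times> \<W>)"
  define \<F> where "\<F> = (\<lambda>F. dual_group \<inter> \<Inter>F) ` {F. finite F \<and> F \<subseteq> \<S>}"
  have "countable \<S>" unfolding \<S>_def using \<B>(1) \<W>(1) by auto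
  then have c1: "countable \<F>" unfolding \<F>_def by (intro countable_image countable_Collect_finite_subset)
  have c2: "dual_basic G"
    if G: "G \<in> \<F>" for G
  proof -
    obtain F where "F \<in> {F. finite F \<and> F \<subseteq> \<S>}" "G = dual_group \<inter> \<Inter>F"
      using G unfolding \<F>_def by (rule imageE)
    then have F: "finite F" "F \<subseteq> \<S>" "G = dual_group \<inter> \<Inter>F" by auto
    have "\<exists>V W. open V \<and> compact (closure V) \<and> open W \<and> S = {\<xi> \<in> dual_group. \<xi> ` closure (V::'a set) \<subseteq> W}"
      if S: "S \<in> F" for S
    proof -
      have "S \<in> \<S>" using S F(2) by blast
      then obtain V W where "V \<in> \<B>" "W \<in> \<W>" "S = {\<xi> \<in> dual_group. \<xi> ` closure V \<subseteq> W}"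
        unfolding \<S>_def by auto
      then show ?thesis using \<B>(2,3) topological_basis_open[OF \<W>(2)]
        by (intro exI[of _ V] exI[of _ W]) simp
    qed
    then show ?thesis using F unfolding dual_basic_def by (intro exI[of _ F]) simp
  qed
  have c3: "\<exists>G\<in>\<F>. \<xi> \<in> G \<and> G \<subseteq> U" if "openin dual_topology U" "\<xi> \<in> U" for U \<xi>
  proof -
    have "generate_topology_on {{ch \<in> dual_group. ch ` K \<subseteq> U} | K U. compact K \<and> open U} U"
      using that(1) unfolding dual_topology_def openin_topology_generated_by_iff .
    then have "\<forall>\<xi>\<in>U. \<exists>F. finite F \<and> F \<subseteq> \<S> \<and> \<xi> \<in> dual_group \<inter> \<Inter>F \<and> dual_group \<inter> \<Inter>F \<subseteq> U"
    proof (induction rule: generate_topology_on.induct)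
      case (Int a b)
      show ?case
      proof
        fix \<xi> assume "\<xi> \<in> a \<inter> b"
        then have ab: "\<xi> \<in> a" "\<xi> \<in> b" by auto
        obtain F where F: "finite F" "F \<subseteq> \<S>" "\<xi> \<in> dual_group \<inter> \<Inter>F" "dual_group \<inter> \<Inter>F \<subseteq> a"
          using bspec[OF Int(3) ab(1)] by (elim exE conjE)
        obtain F' where F': "finite F'" "F' \<subseteq> \<S>" "\<xi> \<in> dual_group \<inter> \<Inter>F'" "dual_group \<inter> \<Inter>F' \<subseteq> b"
          using bspec[OF Int(4) ab(2)] by (elim exE conjE)
        from F F' show "\<exists>F. finite F \<and> F \<subseteq> \<S> \<and> \<xi> \<in> dual_group \<inter> \<Inter>F \<and> dual_group \<inter> \<Inter>F \<subseteq> a \<inter> b"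
          by (intro exI[of _ "F \<union> F'"]) auto
      qed
    next
      case (UN K)
      show ?case
      proof
        fix \<xi> assume "\<xi> \<in> \<Union>K"
        then obtain k where k: "k \<in> K" "\<xi> \<in> k" by blast
        obtain F where "finite F" "F \<subseteq> \<S>" "\<xi> \<in> dual_group \<inter> \<Inter>F" "dual_group \<inter> \<Inter>F \<subseteq> k"
          using bspec[OF UN(2)[OF k(1)] k(2)] by (elim exE conjE)
        moreover have "k \<subseteq> \<Union>K" using k(1) by blast
        ultimately show "\<exists>F. finite F \<and> F \<subseteq> \<S> \<and> \<xi> \<in> dual_group \<inter> \<Inter>F \<and> dual_group \<inter> \<Inter>F \<subseteq> \<Union>K"
          by (intro exI[of _ F] conjI) (assumption | rule order_trans)+
      qed
    next
      case (Basis s)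
      then obtain K U where s: "s = {ch \<in> dual_group. ch ` K \<subseteq> U}" "compact K" "open U" by auto
      show ?case
      proof
        fix \<xi> assume "\<xi> \<in> s"
        then have \<xi>: "\<xi> \<in> dual_group" "\<xi> ` K \<subseteq> U" using s by auto
        have "\<exists>V W. V \<in> \<B> \<and> W \<in> \<W> \<and> x \<in> V \<and> W \<subseteq> U \<and> \<xi> ` closure V \<subseteq> W" if x: "x \<in> K" for x
        proof -
          obtain W where W: "W \<in> \<W>" "\<xi> x \<in> W" "W \<subseteq> U"
            using topological_basisE[OF \<W>(2) s(3), of "\<xi> x"] x \<xi>(2) by blast
          have "open (\<xi> -` W)"
            using \<xi>(1) topological_basis_open[OF \<W>(2) W(1)]
            by (auto simp: dual_group_iff dest!: is_characterD(1) intro: open_vimage)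
          then obtain V where "V \<in> \<B>" "x \<in> V" "closure V \<subseteq> \<xi> -` W"
            using \<B>(4)[of "\<xi> -` W" x] W(2) by auto
          then show ?thesis using W by blast
        qed
        then obtain V W where VW: "\<And>x. x \<in> K \<Longrightarrow> V x \<in> \<B>" "\<And>x. x \<in> K \<Longrightarrow> W x \<in> \<W>"
          "\<And>x. x \<in> K \<Longrightarrow> x \<in> V x" "\<And>x. x \<in> K \<Longrightarrow> W x \<subseteq> U" "\<And>x. x \<in> K \<Longrightarrow> \<xi> ` closure (V x) \<subseteq> W x"
          by metis
        \<comment> \<open>Finitely many sets \<open>V x\<close> cover \<open>K\<close>, and a
          character that maps each of their closures into \<open>W x\<close> maps all of
          \<open>K\<close> into \<open>U\<close>.\<close>
        obtain K' where K': "K' \<subseteq> K" "finite K'" "K \<subseteq> (\<Union>x\<in>K'. V x)"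
          using compactE_image[OF s(2), of K V] VW(1,3) \<B>(2) by blast
        define F where "F = (\<lambda>x. {\<eta> \<in> dual_group. \<eta> ` closure (V x) \<subseteq> W x}) ` K'"
        have "F \<subseteq> \<S>" unfolding F_def \<S>_def using VW(1,2) K'(1) by auto
        moreover have "\<xi> \<in> \<Inter>F" unfolding F_def using VW(5) K'(1) \<xi>(1) by blast
        moreover have "dual_group \<inter> \<Inter>F \<subseteq> s"
        proof
          fix \<eta> assume \<eta>: "\<eta> \<in> dual_group \<inter> \<Inter>F"
          have "\<eta> y \<in> U" if y: "y \<in> K" for y
          proof -
            obtain x where x: "x \<in> K'" "y \<in> V x" using K'(3) y by blast
            have "\<eta> ` closure (V x) \<subseteq> W x" using \<eta> x(1) unfolding F_def by simp
            then have "\<eta> y \<in> W x" using x(2) closure_subset[of "V x"] by auto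
            moreover have "W x \<subseteq> U" using VW(4) x(1) K'(1) by auto
            ultimately show ?thesis by auto
          qed
          then show "\<eta> \<in> s" using \<eta> s(1) by auto
        qed
        ultimately show "\<exists>F. finite F \<and> F \<subseteq> \<S> \<and> \<xi> \<in> dual_group \<inter> \<Inter>F \<and> dual_group \<inter> \<Inter>F \<subseteq> s"
          using K'(2) \<xi>(1) by (intro exI[of _ F]) (auto simp: F_def)
      qed
    qed auto
    from bspec[OF this that(2)] obtain F where "finite F" "F \<subseteq> \<S>"
      "\<xi> \<in> dual_group \<inter> \<Inter>F" "dual_group \<inter> \<Inter>F \<subseteq> U"
      by (elim exE conjE)
    then show ?thesis unfolding \<F>_def by (intro bexI[of _ "dual_group \<inter> \<Inter>F"]) auto
  qed
  show ?thesis by (rule that[of \<F>, OF c1]) (fact c2, fact c3)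
qed

text \<open>By second countability it suffices to treat basic open sets, and
  \<open>image_closure_subset_iff\<close> expresses these through countably many coordinates. This
  is the criterion by which the action, the multiplication of characters and the decoder
  \<open>j\<close> are shown to be measurable.\<close>

lemma measurable_dualI:
  assumes f: "\<And>\<omega>. \<omega> \<in> space \<Omega> \<Longrightarrow> f \<omega> \<in> dual_group"
    and [measurable]: "\<And>k. (\<lambda>\<omega>. f \<omega> (dense_seq k :: 'a)) \<in> borel_measurable \<Omega>"
  shows "f \<in> \<Omega> \<rightarrow>\<^sub>M N"
proof -
  obtain \<F> where \<F>: "countable \<F>"
    "\<And>G. G \<in> \<F> \<Longrightarrow> dual_basic G"
    "\<And>U \<xi>. openin dual_topology U \<Longrightarrow> \<xi> \<in> U \<Longrightarrow> \<exists>G\<in>\<F>. \<xi> \<in> G \<and> G \<subseteq> U"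
    using dual_open_countable_base by metis
  have sub: "f -` {\<xi> \<in> dual_group. \<xi> ` closure V \<subseteq> W} \<inter> space \<Omega> \<in> sets \<Omega>"
    if V: "open V" "compact (closure V)" and W: "open W" for V :: "'a set" and W
  proof -
    obtain C where C: "\<And>n::nat. compact (C n)" "\<And>n. C n \<subseteq> W" "\<And>K. compact K \<Longrightarrow> K \<subseteq> W \<Longrightarrow> \<exists>N. \<forall>n\<ge>N. K \<subseteq> C n"
      using open_Union_compact_subsets[OF W] by metis
    have [measurable]: "C n \<in> sets borel" for n using C(1) by (rule borel_compact)
    have "f -` {\<xi> \<in> dual_group. \<xi> ` closure V \<subseteq> W} \<inter> space \<Omega> =
       {\<omega> \<in> space \<Omega>. \<exists>n. \<forall>k. dense_seq k \<in> V \<longrightarrow> f \<omega> (dense_seq k) \<in> C n}"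
    proof -
      have "f \<omega> ` closure V \<subseteq> W \<longleftrightarrow> (\<exists>n. \<forall>k. dense_seq k \<in> V \<longrightarrow> f \<omega> (dense_seq k) \<in> C n)"
        if "\<omega> \<in> space \<Omega>" for \<omega>
        by (rule image_closure_subset_iff[OF f[OF that] V C(1,3,2)])
      then show ?thesis using f unfolding vimage_def by blast
    qed
    also have "\<dots> \<in> sets \<Omega>" by measurable
    finally show ?thesis .
  qed
  have G_meas: "f -` G \<inter> space \<Omega> \<in> sets \<Omega>" if G: "G \<in> \<F>" for G
  proof -
    obtain F where F: "finite F" "G = dual_group \<inter> \<Inter>F"
      "\<And>S. S \<in> F \<Longrightarrow> \<exists>V W. open V \<and> compact (closure V) \<and> open W \<and> S = {\<xi> \<in> dual_group. \<xi> ` closure (V::'a set) \<subseteq> W}"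
      using \<F>(2)[OF G] unfolding dual_basic_def by (elim exE conjE) (rule that, auto)
    have "f -` S \<inter> space \<Omega> \<in> sets \<Omega>" if "S \<in> F" for S
      using F(3)[OF that] sub by blast
    then have "{\<omega> \<in> space \<Omega>. \<forall>S\<in>F. f \<omega> \<in> S} \<in> sets \<Omega>"
      using F(1) by (intro sets.sets_Collect_finite_All) (auto simp: vimage_def Int_def conj_commute)
    moreover have "f -` G \<inter> space \<Omega> = {\<omega> \<in> space \<Omega>. \<forall>S\<in>F. f \<omega> \<in> S}" using F(2) f by auto
    ultimately show ?thesis by simp
  qed
  have "f \<in> \<Omega> \<rightarrow>\<^sub>M borel_of dual_topology"
  proof (unfold borel_of_def, rule measurable_measure_of)
    show "f -` U \<inter> space \<Omega> \<in> sets \<Omega>" if "U \<in> {U. openin dual_topology U}" for U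
    proof -
      have "U = \<Union> {G \<in> \<F>. G \<subseteq> U}" using \<F>(3)[of U] that by blast
      then have "f -` U \<inter> space \<Omega> = (\<Union>G\<in>{G \<in> \<F>. G \<subseteq> U}. f -` G \<inter> space \<Omega>)" by blast
      also have "\<dots> \<in> sets \<Omega>" using \<F>(1) G_meas by (intro sets.countable_UN') auto
      finally show ?thesis .
    qed
  qed (use f openin_subset[of dual_topology] in \<open>auto simp: topspace_dual_topology\<close>)
  then show ?thesis using sets_N measurable_cong_sets by blast
qed

text \<open>The second and third conditions are uniform continuity and multiplicativity of
  \<open>dense_seq k \<mapsto> z k\<close>, phrased with approximate relations because the range
  of \<open>dense_seq\<close> need not be a subgroup.\<close>

definition char_cond :: "'a set set \<Rightarrow> (nat \<Rightarrow> complex) \<Rightarrow> bool" where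
  "char_cond \<B> z \<longleftrightarrow> (\<forall>k. cmod (z k) = 1) \<and>
    (\<forall>p::nat. \<exists>V\<in>\<B>. \<forall>k l. dense_seq k - dense_seq l \<in> V \<longrightarrow> cmod (z k - z l) \<le> 1 / Suc p) \<and>
    (\<forall>p::nat. \<exists>V\<in>\<B>. \<forall>k l m. dense_seq k + dense_seq l - dense_seq m \<in> V \<longrightarrow> cmod (z k * z l - z m) \<le> 1 / Suc p)"

text \<open>For the extension of \<open>z\<close> to a character, uniform continuity makes the
  values along a sequence of dense points converging to \<open>a\<close> a Cauchy sequence. Its
  limit is the value at \<open>a\<close>, and approximate multiplicativity becomes exact in the
  limit.\<close>

lemma char_cond_iff:
  assumes \<B>: "\<And>V. V \<in> \<B> \<Longrightarrow> open V \<and> 0 \<in> V" "\<And>U. open U \<Longrightarrow> 0 \<in> U \<Longrightarrow> \<exists>V\<in>\<B>. V \<subseteq> U"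
  shows "char_cond \<B> z \<longleftrightarrow> (\<exists>\<xi>\<in>dual_group. \<forall>k. \<xi> (dense_seq k :: 'a) = z k)"
proof
  assume "\<exists>\<xi>\<in>dual_group. \<forall>k. \<xi> (dense_seq k :: 'a) = z k"
  then obtain \<xi> where "\<xi> \<in> dual_group" "\<forall>k. \<xi> (dense_seq k :: 'a) = z k" by (rule bexE)
  then have \<xi>: "is_character \<xi>" "\<And>k. z k = \<xi> (dense_seq k)" by (simp_all add: dual_group_iff)
  have ex: "\<exists>V\<in>\<B>. \<forall>x\<in>V. cmod (\<xi> x - 1) \<le> 1 / Suc p" for p :: nat
  proof -
    have "open (\<xi> -` ball 1 (1 / Suc p))" using is_characterD(1)[OF \<xi>(1)] by (intro open_vimage) auto
    then obtain V where "V \<in> \<B>" "V \<subseteq> \<xi> -` ball 1 (1 / Suc p)"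
      using \<B>(2)[of "\<xi> -` ball 1 (1 / Suc p)"] is_character_0[OF \<xi>(1)] by auto
    then show ?thesis by (intro bexI[of _ V]) (auto simp: dist_norm norm_minus_commute intro!: less_imp_le)
  qed
  have "cmod (z k - z l) = cmod (\<xi> (dense_seq k - dense_seq l) - 1)" for k l
  proof -
    have "\<xi> (dense_seq k) - \<xi> (dense_seq l) = \<xi> (dense_seq l) * (\<xi> (dense_seq k - dense_seq l) - 1)"
      using is_characterD(2)[OF \<xi>(1), of "dense_seq l" "dense_seq k - dense_seq l"]
        by (simp add: algebra_simps)
    then show ?thesis using is_characterD(3)[OF \<xi>(1)] by (simp add: \<xi>(2) norm_mult)
  qed
  moreover have "cmod (z k * z l - z m) = cmod (\<xi> (dense_seq k + dense_seq l - dense_seq m) - 1)" for k l m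
  proof -
    have "\<xi> (dense_seq k) * \<xi> (dense_seq l) - \<xi> (dense_seq m)
        = \<xi> (dense_seq m) * (\<xi> (dense_seq k + dense_seq l - dense_seq m) - 1)"
      using is_characterD(2)[OF \<xi>(1), of "dense_seq m" "dense_seq k + dense_seq l - dense_seq m"]
        is_characterD(2)[OF \<xi>(1), of "dense_seq k" "dense_seq l"]
      by (simp add: algebra_simps)
    then show ?thesis using is_characterD(3)[OF \<xi>(1)] by (simp add: \<xi>(2) norm_mult)
  qed
  ultimately show "char_cond \<B> z"
    unfolding char_cond_def using ex is_characterD(3)[OF \<xi>(1)] \<xi>(2) by metis
next
  assume Q: "char_cond \<B> z"
  have "\<forall>a::'a. \<exists>r. (\<lambda>n. dense_seq (r n)) \<longlonglongrightarrow> a" using dense_seq_converging by blast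
  then obtain r where r: "\<And>a::'a. (\<lambda>n. dense_seq (r a n)) \<longlonglongrightarrow> a" by metis
  \<comment> \<open>Stated for an arbitrary filter, since it is used on a product of two sequences
    for the Cauchy property and on one sequence for the values at dense points; the limit
    \<open>c\<close> is 0 in both uses.\<close>
  have near: "\<forall>\<^sub>F x in F. cmod (z (f x) - z (g x)) \<le> 1 / Suc p"
    if t: "((\<lambda>x. dense_seq (f x) - dense_seq (g x) :: 'a) \<longlongrightarrow> c) F"
      and c: "\<And>V. V \<in> \<B> \<Longrightarrow> (\<forall>k l. dense_seq k - dense_seq l \<in> V \<longrightarrow> cmod (z k - z l) \<le> 1 / Suc p) \<Longrightarrow> c \<in> V"
    for f g p c and F :: "'c filter"
  proof -
    obtain V where V: "V \<in> \<B>" "\<forall>k l. dense_seq k - dense_seq l \<in> V \<longrightarrow> cmod (z k - z l) \<le> 1 / Suc p"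
      using Q unfolding char_cond_def by blast
    have "\<forall>\<^sub>F x in F. dense_seq (f x) - dense_seq (g x) \<in> V"
      using t c[OF V] \<B>(1)[OF V(1)] by (metis topological_tendstoD)
    then show ?thesis by eventually_elim (use V(2) in auto)
  qed
  have "Cauchy (\<lambda>n. z (r a n))" for a
  proof (rule metric_CauchyI)
    fix e :: real assume "0 < e"
    then obtain p where p: "1 / Suc p < e" using nat_approx_posE by blast
    have "((\<lambda>x. dense_seq (r a (fst x)) - dense_seq (r a (snd x)) :: 'a) \<longlongrightarrow> a - a) (sequentially \<times>\<^sub>F sequentially)"
      using r[of a] by (intro tendsto_diff_group) (auto intro: filterlim_compose filterlim_fst filterlim_snd)
    then have "\<forall>\<^sub>F x in sequentially \<times>\<^sub>F sequentially. cmod (z (r a (fst x)) - z (r a (snd x))) \<le> 1 / Suc p"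
      by (rule near) (use \<B>(1) in auto)
    then obtain K where "\<forall>m\<ge>K. \<forall>n\<ge>K. cmod (z (r a n) - z (r a m)) \<le> 1 / Suc p"
      unfolding eventually_prod_sequentially by auto
    then show "\<exists>K. \<forall>m\<ge>K. \<forall>n\<ge>K. dist (z (r a m)) (z (r a n)) < e"
      using p by (intro exI[of _ K]) (force simp: dist_norm)
  qed
  then have conv: "(\<lambda>n. z (r a n)) \<longlonglongrightarrow> lim (\<lambda>n. z (r a n))" for a
    using Cauchy_convergent convergent_LIMSEQ_iff by blast
  define \<xi> where "\<xi> a = lim (\<lambda>n. z (r a n))" for a
  have conv: "(\<lambda>n. z (r a n)) \<longlonglongrightarrow> \<xi> a" for a unfolding \<xi>_def by (rule conv)
  have small: "x = y" if "\<And>p::nat. cmod (x - y) \<le> 1 / Suc p" for x y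
  proof (rule ccontr)
    assume "x \<noteq> y"
    then have "0 < cmod (x - y)" by simp
    then obtain p where "1 / Suc p < cmod (x - y)" using nat_approx_posE by blast
    then show False using that[of p] by simp
  qed
  have "\<xi> (dense_seq k) = z k" for k
  proof (rule small)
    fix p
    have "(\<lambda>n. dense_seq (r (dense_seq k) n) - dense_seq k :: 'a) \<longlonglongrightarrow> dense_seq k - dense_seq k"
      by (intro tendsto_diff_group r tendsto_const)
    then have "\<forall>\<^sub>F n in sequentially. cmod (z (r (dense_seq k) n) - z k) \<le> 1 / Suc p"
      by (rule near) (use \<B>(1) in auto)
    then show "cmod (\<xi> (dense_seq k) - z k) \<le> 1 / Suc p"
      by (intro tendsto_upperbound[OF tendsto_norm[OF tendsto_diff[OF conv tendsto_const]]]) auto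
  qed
  moreover have "cmod (\<xi> a) = 1" for a
  proof -
    have "(\<lambda>n. cmod (z (r a n))) \<longlonglongrightarrow> cmod (\<xi> a)" by (intro tendsto_norm conv)
    moreover have "cmod (z k) = 1" for k using Q unfolding char_cond_def by blast
    ultimately show ?thesis by (simp add: LIMSEQ_const_iff)
  qed
  moreover have "\<xi> (a + b) = \<xi> a * \<xi> b" for a b
  proof (rule small[symmetric])
    fix p
    obtain V where V: "V \<in> \<B>" "\<forall>k l m. dense_seq k + dense_seq l - dense_seq m \<in> V \<longrightarrow> cmod (z k * z l - z m) \<le> 1 / Suc p"
      using Q unfolding char_cond_def by blast
    have "(\<lambda>n. dense_seq (r a n) + dense_seq (r b n) - dense_seq (r (a + b) n) :: 'a) \<longlonglongrightarrow> a + b - (a + b)"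
      by (intro tendsto_diff_group tendsto_add_group r)
    then have "\<forall>\<^sub>F n in sequentially. dense_seq (r a n) + dense_seq (r b n) - dense_seq (r (a + b) n) \<in> V"
      using \<B>(1)[OF V(1)] by (simp add: topological_tendstoD)
    then have "\<forall>\<^sub>F n in sequentially. cmod (z (r a n) * z (r b n) - z (r (a + b) n)) \<le> 1 / Suc p"
      by eventually_elim (use V(2) in auto)
    then show "cmod (\<xi> a * \<xi> b - \<xi> (a + b)) \<le> 1 / Suc p"
      by (intro tendsto_upperbound[OF tendsto_norm[OF tendsto_diff[OF tendsto_mult[OF conv conv] conv]]]) auto
  qed
  moreover have "continuous_on UNIV \<xi>"
  proof (clarsimp simp: continuous_on_def tendsto_iff)
    fix a :: 'a and e :: real assume "0 < e"
    then obtain p where p: "1 / Suc p < e" using nat_approx_posE by blast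
    obtain V where V: "V \<in> \<B>" "\<forall>k l. dense_seq k - dense_seq l \<in> V \<longrightarrow> cmod (z k - z l) \<le> 1 / Suc p"
      using Q unfolding char_cond_def by blast
    have "((\<lambda>b. b - a) \<longlongrightarrow> a - a) (at a)" by (intro tendsto_diff_group tendsto_const tendsto_ident_at)
    then have "\<forall>\<^sub>F b in at a. b - a \<in> V" using \<B>(1)[OF V(1)] by (simp add: topological_tendstoD)
    then show "\<forall>\<^sub>F b in at a. dist (\<xi> b) (\<xi> a) < e"
    proof eventually_elim
      case (elim b)
      have "(\<lambda>n. dense_seq (r b n) - dense_seq (r a n) :: 'a) \<longlonglongrightarrow> b - a"
        by (intro tendsto_diff_group r)
      then have "\<forall>\<^sub>F n in sequentially. dense_seq (r b n) - dense_seq (r a n) \<in> V"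
        using \<B>(1)[OF V(1)] elim by (simp add: topological_tendstoD)
      then have "\<forall>\<^sub>F n in sequentially. cmod (z (r b n) - z (r a n)) \<le> 1 / Suc p"
        by eventually_elim (use V(2) in auto)
      then have "cmod (\<xi> b - \<xi> a) \<le> 1 / Suc p"
        by (intro tendsto_upperbound[OF tendsto_norm[OF tendsto_diff[OF conv conv]]]) auto
      then show ?case using p by (simp add: dist_norm)
    qed
  qed
  ultimately show "\<exists>\<xi>\<in>dual_group. \<forall>k. \<xi> (dense_seq k :: 'a) = z k"
    by (intro bexI[of _ \<xi>]) (auto simp: dual_group_iff is_character_def)
qed

text \<open>A character is coded by the real and imaginary parts of its coordinates. The decoder
  recognizes codes of characters by \<open>char_cond\<close>, a Borel condition because all its
  quantifiers are countable.\<close>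

theorem dual_standard_borel:
  obtains i j where "i \<in> borel_measurable N" "j \<in> (borel :: real measure) \<rightarrow>\<^sub>M N"
    "\<And>\<xi>. \<xi> \<in> dual_group \<Longrightarrow> j (i \<xi>) = \<xi>"
proof -
  obtain \<B>' :: "'a set set" where \<B>': "countable \<B>'" "\<And>V. V \<in> \<B>' \<Longrightarrow> open V"
    "\<And>U x. open U \<Longrightarrow> x \<in> U \<Longrightarrow> \<exists>V\<in>\<B>'. x \<in> V \<and> closure V \<subseteq> U"
    using compact_closure_base by metis
  define \<B> where "\<B> = {V \<in> \<B>'. 0 \<in> V}"
  have cB: "countable \<B>" using \<B>'(1) by (auto simp: \<B>_def)
  have \<B>: "\<And>V. V \<in> \<B> \<Longrightarrow> open V \<and> 0 \<in> V" "\<And>U. open U \<Longrightarrow> 0 \<in> U \<Longrightarrow> \<exists>V\<in>\<B>. V \<subseteq> U"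
  proof -
    show "open V \<and> 0 \<in> V" if "V \<in> \<B>" for V using that \<B>'(2) by (simp add: \<B>_def)
    fix U :: "'a set" assume "open U" "0 \<in> U"
    from \<B>'(3)[OF this] obtain V where "V \<in> \<B>'" "0 \<in> V" "closure V \<subseteq> U" by blast
    then show "\<exists>V\<in>\<B>. V \<subseteq> U" using closure_subset[of V] by (intro bexI[of _ V]) (auto simp: \<B>_def)
  qed
  have cc: "char_cond \<B> z \<longleftrightarrow> (\<exists>\<xi>\<in>dual_group. \<forall>k. \<xi> (dense_seq k :: 'a) = z k)" for z
    by (rule char_cond_iff) (use \<B> in auto)
  \<comment> \<open>Real parts sit at even indices and imaginary parts at odd ones;
    \<open>zz\<close> reassembles them.\<close>
  define i where "i \<xi> = seq_code (\<lambda>n. if even n then Re (\<xi> (dense_seq (n div 2) :: 'a)) else Im (\<xi> (dense_seq (n div 2))))" for \<xi>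
  define zz where "zz x k = Complex (seq_decode (2 * k) x) (seq_decode (2 * k + 1) x)" for x k
  \<comment> \<open>Reals that code no character are sent to the trivial character, so that
    \<open>j\<close> maps the whole line into the dual.\<close>
  define j where "j x = (if char_cond \<B> (zz x) then (THE \<xi>. \<xi> \<in> dual_group \<and> (\<forall>k. \<xi> (dense_seq k :: 'a) = zz x k)) else (\<lambda>_. 1))" for x
  have zzi: "zz (i \<xi>) k = \<xi> (dense_seq k)" for \<xi> k
    by (simp add: zz_def i_def seq_decode_code)
  have [measurable]: "(\<lambda>x. zz x k) \<in> borel_measurable borel" for k
    unfolding zz_def by (simp add: Complex_eq)
  have uniq: "\<xi> = \<eta>" if "\<xi> \<in> dual_group" "\<eta> \<in> dual_group" "\<And>k. \<xi> (dense_seq k :: 'a) = \<eta> (dense_seq k)" for \<xi> \<eta>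
    using continuous_eq_dense_seq that by (auto simp: dual_group_iff is_character_def)
  have j: "j x \<in> dual_group \<and> (\<forall>k. j x (dense_seq k) = zz x k)" if Q: "char_cond \<B> (zz x)" for x
  proof -
    obtain \<xi> where \<xi>: "\<xi> \<in> dual_group \<and> (\<forall>k. \<xi> (dense_seq k :: 'a) = zz x k)"
      using Q cc by blast
    have "(THE \<xi>. \<xi> \<in> dual_group \<and> (\<forall>k. \<xi> (dense_seq k :: 'a) = zz x k)) = \<xi>"
      using \<xi> by (intro the_equality) (auto intro!: uniq)
    then show ?thesis using \<xi> Q by (simp add: j_def)
  qed
  have one: "(\<lambda>_::'a. 1) \<in> dual_group" by (simp add: dual_group_iff is_character_def)
  have [measurable]: "Measurable.pred borel (\<lambda>x. char_cond \<B> (zz x))"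
    unfolding char_cond_def using cB by measurable
  show ?thesis
  proof (rule that[of i j])
    show "i \<in> borel_measurable N" unfolding i_def
      by (intro borel_measurable_seq_code) (auto intro!: measurable_If borel_measurable_Re borel_measurable_Im measurable_eval_compose)
    have "(\<lambda>x. j x (dense_seq k)) = (\<lambda>x. if char_cond \<B> (zz x) then zz x k else 1)" for k
      using j by (auto simp: j_def)
    then show "j \<in> (borel :: real measure) \<rightarrow>\<^sub>M N"
      using j one by (intro measurable_dualI) (auto simp: j_def)
    show "j (i \<xi>) = \<xi>" if "\<xi> \<in> dual_group" for \<xi>
    proof -
      have "char_cond \<B> (zz (i \<xi>))" using that cc zzi by metis
      from j[OF this] show ?thesis using that by (intro uniq) (auto simp: zzi)
    qed
  qed
qed

end

subsection \<open>The action on the group and on its dual\<close>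

locale quasi_regular_setup =
  fixes M :: "'a::{ab_group_add, t2_space, second_countable_topology} measure"
    and N :: "('a \<Rightarrow> complex) measure"
    and Hs :: "('a \<Rightarrow> 'a) set" and TH :: "('a \<Rightarrow> 'a) topology" and MH :: "('a \<Rightarrow> 'a) measure"
  assumes lca_A: "lca_group TYPE('a)" and haar: "haar_measure_A M"
    and plancherel: "plancherel_measure M N" and aut: "automorphism_group Hs TH MH"

sublocale quasi_regular_setup \<subseteq> lca N
  using lca_A plancherel by unfold_locales (auto simp: plancherel_measure_def)

context quasi_regular_setup
begin

lemma sets_M [measurable_cong]: "sets M = sets borel"
  using haar by (simp add: haar_measure_A_def)

lemma space_M [simp]: "space M = UNIV"
  using sets_eq_imp_space_eq[OF sets_M] by simp

lemma emeasure_M_compact: "compact K \<Longrightarrow> emeasure M K < \<infinity>"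
  using haar by (simp add: haar_measure_A_def)

lemma emeasure_M_open: "open U \<Longrightarrow> U \<noteq> {} \<Longrightarrow> 0 < emeasure M U"
  using haar by (simp add: haar_measure_A_def)

lemma compact_imp_sets_M: "compact K \<Longrightarrow> K \<in> sets M"
  unfolding sets_M
    by (metis compactin_euclidean_iff compactin_imp_closedin Hausdorff_A closed_closedin borel_closed)

lemma sigma_finite_M: "sigma_finite_measure M"
  by (rule sigma_finite_measure_borel_of[OF second_countable_A locally_compact_A Hausdorff_A])
     (auto simp: sets_M sets_borel_of_euclidean emeasure_M_compact[simplified])

lemma measurable_add_A: "(\<lambda>(x, y). x + y) \<in> (borel :: 'a measure) \<Otimes>\<^sub>M borel \<rightarrow>\<^sub>M borel"
  using borel_measurable_continuous_onI[OF continuous_on_add_group] by (simp add: borel_prod split_def)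

lemma measurable_diff_A: "(\<lambda>(x, y). x - y) \<in> (borel :: 'a measure) \<Otimes>\<^sub>M borel \<rightarrow>\<^sub>M borel"
  using borel_measurable_continuous_onI[OF continuous_on_diff_group] by (simp add: borel_prod split_def)

lemma measurable_add_A' [measurable (raw)]:
  assumes "f \<in> borel_measurable \<Omega>" "g \<in> borel_measurable \<Omega>"
  shows "(\<lambda>x. f x + g x :: 'a) \<in> borel_measurable \<Omega>"
  using measurable_compose[OF measurable_Pair[OF assms] measurable_add_A] by simp

lemma measurable_diff_A' [measurable (raw)]:
  assumes "f \<in> borel_measurable \<Omega>" "g \<in> borel_measurable \<Omega>"
  shows "(\<lambda>x. f x - g x :: 'a) \<in> borel_measurable \<Omega>"
  using measurable_compose[OF measurable_Pair[OF assms] measurable_diff_A] by simp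

lemma measurable_uminus_A [measurable]: "uminus \<in> (borel :: 'a measure) \<rightarrow>\<^sub>M borel"
  using lca by (intro borel_measurable_continuous_onI) (simp add: lca_group_def)

lemma distr_translate_M: "distr M M (\<lambda>x. a + x) = M"
proof (rule distr_eqI_invariant[where g = "\<lambda>x. - a + x"])
  show "(\<lambda>x. a + x) -` B \<inter> space M = (\<lambda>x. - a + x) ` B" for B
    by (auto intro!: image_eqI[where x = "a + _"])
  show "emeasure M ((\<lambda>x. - a + x) ` B) = emeasure M B" if "B \<in> sets M" for B
    using haar that unfolding haar_measure_A_def sets_M by blast
qed measurable

lemma compact_pos_M:
  obtains K where "compact K" "interior K \<noteq> {}" "0 < emeasure M K" "emeasure M K < \<infinity>" "K \<in> sets M"
proof -
  obtain \<B> :: "'a set set" where \<B>: "\<And>V. V \<in> \<B> \<Longrightarrow> open V"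
    "\<And>V. V \<in> \<B> \<Longrightarrow> compact (closure V)"
    "\<And>U x. open U \<Longrightarrow> x \<in> U \<Longrightarrow> \<exists>V\<in>\<B>. x \<in> V \<and> closure V \<subseteq> U"
    by (rule compact_closure_base) blast
  obtain V where V: "V \<in> \<B>" "0 \<in> V" using \<B>(3)[of UNIV 0] by auto
  have sub: "V \<subseteq> interior (closure V)" using \<B>(1)[OF V(1)] by (simp add: closure_subset interior_maximal)
  have "0 < emeasure M V" using emeasure_M_open \<B>(1) V by blast
  also have "\<dots> \<le> emeasure M (closure V)"
    by (intro emeasure_mono closure_subset) (simp add: sets_M)
  finally show ?thesis using that[of "closure V"] sub V \<B>(2)[OF V(1)] emeasure_M_compact compact_imp_sets_M
    by auto
qed

subsubsection \<open>The acting group\<close>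

lemma
  shows Hs_id: "id \<in> Hs" and Hs_comp: "g \<in> Hs \<Longrightarrow> h \<in> Hs \<Longrightarrow> g \<circ> h \<in> Hs"
    and Hs_inv: "h \<in> Hs \<Longrightarrow> inv h \<in> Hs" and topspace_TH: "topspace TH = Hs"
    and Hausdorff_TH: "Hausdorff_space TH" and second_countable_TH: "second_countable TH"
    and locally_compact_TH: "locally_compact_space TH"
    and continuous_comp: "continuous_map (prod_topology TH TH) TH (\<lambda>p. fst p \<circ> snd p)"
    and continuous_inv: "continuous_map TH TH inv"
    and continuous_apply: "continuous_map (prod_topology TH euclidean) euclidean (\<lambda>p. fst p (snd p))"
    and space_MH: "space MH = Hs" and sets_MH: "sets MH = sets (borel_of TH)"
    and emeasure_MH_compact: "compactin TH K \<Longrightarrow> emeasure MH K < \<infinity>"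
    and emeasure_MH_open: "openin TH U \<Longrightarrow> U \<noteq> {} \<Longrightarrow> 0 < emeasure MH U"
    and emeasure_MH_left: "g \<in> Hs \<Longrightarrow> E \<in> sets MH \<Longrightarrow> emeasure MH ((\<lambda>h. g \<circ> h) ` E) = emeasure MH E"
  using aut unfolding automorphism_group_def by simp_all

lemma Hs_homeomorphism: "h \<in> Hs \<Longrightarrow> homeomorphism UNIV UNIV h (inv h)"
  and Hs_add: "h \<in> Hs \<Longrightarrow> h (x + y) = h x + h y"
  using aut unfolding automorphism_group_def topological_automorphism_def by auto

lemma Hs_bij: "h \<in> Hs \<Longrightarrow> bij h"
  using Hs_homeomorphism[of h]
    unfolding homeomorphism_def by (metis bij_betw_byWitness[where A = UNIV] subset_UNIV UNIV_I)

lemma Hs_inv_apply [simp]: "h \<in> Hs \<Longrightarrow> inv h (h x) = x" "h \<in> Hs \<Longrightarrow> h (inv h x) = x"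
  using Hs_bij[of h] by (simp_all add: bij_is_inj bij_is_surj surj_f_inv_f)

lemma Hs_inv_comp: "h \<in> Hs \<Longrightarrow> inv h \<circ> h = id" "h \<in> Hs \<Longrightarrow> h \<circ> inv h = id"
  by (auto simp: fun_eq_iff)

lemma Hs_continuous: "h \<in> Hs \<Longrightarrow> continuous_on UNIV h"
  using Hs_homeomorphism[of h] by (simp add: homeomorphism_def)

lemma Hs_measurable: "h \<in> Hs \<Longrightarrow> h \<in> (borel :: 'a measure) \<rightarrow>\<^sub>M borel"
  by (intro borel_measurable_continuous_onI Hs_continuous)

lemma Hs_image_eq: "h \<in> Hs \<Longrightarrow> h ` B = inv h -` B"
  by (metis Hs_bij bij_vimage_eq_inv_image bij_imp_bij_inv inv_inv_eq)

lemma sigma_finite_MH: "sigma_finite_measure MH"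
  by (rule sigma_finite_measure_borel_of[OF second_countable_TH locally_compact_TH Hausdorff_TH sets_MH])
     (rule emeasure_MH_compact)

lemma measurable_apply_H: "(\<lambda>(h, a). h a) \<in> MH \<Otimes>\<^sub>M (borel :: 'a measure) \<rightarrow>\<^sub>M borel"
proof -
  have "(\<lambda>p. fst p (snd p)) \<in> borel_of TH \<Otimes>\<^sub>M borel_of euclidean \<rightarrow>\<^sub>M borel_of (euclidean :: 'a topology)"
    by (rule measurable_continuous_map_prod[OF second_countable_TH second_countable_A continuous_apply])
  also have "borel_of TH \<Otimes>\<^sub>M borel_of euclidean \<rightarrow>\<^sub>M borel_of (euclidean :: 'a topology) =
      MH \<Otimes>\<^sub>M borel \<rightarrow>\<^sub>M borel"
    by (intro measurable_cong_sets sets_pair_measure_cong) (simp_all add: sets_MH sets_borel_of_euclidean)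
  finally show ?thesis by (simp add: split_def)
qed

lemma measurable_apply_H' [measurable (raw)]:
  assumes "f \<in> \<Omega> \<rightarrow>\<^sub>M MH" "g \<in> borel_measurable \<Omega>"
  shows "(\<lambda>x. f x (g x :: 'a)) \<in> borel_measurable \<Omega>"
  using measurable_compose[OF measurable_Pair[OF assms] measurable_apply_H] by simp

lemma measurable_inv_H [measurable]: "inv \<in> MH \<rightarrow>\<^sub>M MH"
  using measurable_continuous_map_borel_of[OF continuous_inv] sets_MH measurable_cong_sets by blast

lemma measurable_comp_H [measurable (raw)]:
  assumes "f \<in> \<Omega> \<rightarrow>\<^sub>M MH" "g \<in> \<Omega> \<rightarrow>\<^sub>M MH"
  shows "(\<lambda>x. f x \<circ> g x) \<in> \<Omega> \<rightarrow>\<^sub>M MH"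
proof -
  have "(\<lambda>p. fst p \<circ> snd p) \<in> borel_of TH \<Otimes>\<^sub>M borel_of TH \<rightarrow>\<^sub>M borel_of TH"
    by (rule measurable_continuous_map_prod[OF second_countable_TH second_countable_TH continuous_comp])
  also have "borel_of TH \<Otimes>\<^sub>M borel_of TH \<rightarrow>\<^sub>M borel_of TH = MH \<Otimes>\<^sub>M MH \<rightarrow>\<^sub>M MH"
    by (intro measurable_cong_sets sets_pair_measure_cong) (simp_all add: sets_MH)
  finally show ?thesis
    using measurable_compose[OF measurable_Pair[OF assms], of "\<lambda>p. fst p \<circ> snd p" MH]
      by (simp only: fst_conv snd_conv)
qed

lemma distr_left_MH:
  assumes g: "g \<in> Hs" shows "distr MH MH (\<lambda>h. g \<circ> h) = MH"
proof (rule distr_eqI_invariant[where g = "\<lambda>h. inv g \<circ> h"])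
  show "(\<lambda>h. g \<circ> h) -` B \<inter> space MH = (\<lambda>h. inv g \<circ> h) ` B" if B: "B \<in> sets MH" for B
  proof (intro antisym subsetI)
    fix h assume "h \<in> (\<lambda>h. g \<circ> h) -` B \<inter> space MH"
    then show "h \<in> (\<lambda>h. inv g \<circ> h) ` B"
      using Hs_inv_comp[OF g] by (intro image_eqI[of _ _ "g \<circ> h"]) (auto simp: comp_assoc[symmetric])
  next
    fix h assume "h \<in> (\<lambda>h. inv g \<circ> h) ` B"
    then obtain k where k: "h = inv g \<circ> k" "k \<in> B" by blast
    have "k \<in> Hs" using sets.sets_into_space[OF B] k(2) space_MH by blast
    then show "h \<in> (\<lambda>h. g \<circ> h) -` B \<inter> space MH"
      using k Hs_inv_comp[OF g] g by (auto simp: comp_assoc[symmetric] space_MH intro!: Hs_comp Hs_inv)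
  qed
  show "(\<lambda>h. g \<circ> h) \<in> MH \<rightarrow>\<^sub>M MH" using g by (intro measurable_comp_H) (auto simp: space_MH)
  show "emeasure MH ((\<lambda>h. inv g \<circ> h) ` B) = emeasure MH B" if "B \<in> sets MH" for B
    using emeasure_MH_left[OF Hs_inv[OF g] that] .
qed

lemma nn_integral_left_MH:
  assumes g: "g \<in> Hs" and [measurable]: "f \<in> borel_measurable MH"
  shows "(\<integral>\<^sup>+h. f (g \<circ> h) \<partial>MH) = (\<integral>\<^sup>+h. f h \<partial>MH)"
proof -
  have [measurable]: "(\<lambda>h. g \<circ> h) \<in> MH \<rightarrow>\<^sub>M MH" using g by (intro measurable_comp_H) (auto simp: space_MH)
  have "(\<integral>\<^sup>+h. f h \<partial>MH) = (\<integral>\<^sup>+h. f h \<partial>distr MH MH (\<lambda>h. g \<circ> h))" by (simp add: distr_left_MH[OF g])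
  also have "\<dots> = (\<integral>\<^sup>+h. f (g \<circ> h) \<partial>MH)" by (intro nn_integral_distr) auto
  finally show ?thesis ..
qed

subsubsection \<open>The action on the dual\<close>

lemma dual_comp: "\<xi> \<in> dual_group \<Longrightarrow> h \<in> Hs \<Longrightarrow> \<xi> \<circ> h \<in> dual_group"
  using Hs_continuous[of h] Hs_add[of h]
  by (auto simp: dual_group_iff is_character_def comp_def
      intro: continuous_on_compose2[of UNIV \<xi> UNIV h])

lemma measurable_dual_comp [measurable (raw)]:
  assumes [measurable]: "f \<in> \<Omega> \<rightarrow>\<^sub>M N" "g \<in> \<Omega> \<rightarrow>\<^sub>M MH"
  shows "(\<lambda>x. f x \<circ> g x) \<in> \<Omega> \<rightarrow>\<^sub>M N"
proof (rule measurable_dualI)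
  show "f x \<circ> g x \<in> dual_group" if "x \<in> space \<Omega>" for x
    using measurable_space[OF assms(1) that] measurable_space[OF assms(2) that]
    by (intro dual_comp) (auto simp: space_N space_MH)
  show "(\<lambda>x. (f x \<circ> g x) (dense_seq k)) \<in> borel_measurable \<Omega>" for k
    unfolding comp_def by measurable
qed

lemma continuous_orbit_eval:
  assumes "\<xi> \<in> dual_group" shows "continuous_map TH euclidean (\<lambda>h. \<xi> (h a))"
proof -
  have "continuous_map TH (prod_topology TH euclidean) (\<lambda>h. (h, a))"
    by (auto intro!: continuous_map_pairedI)
  from continuous_map_compose[OF this continuous_apply]
  have "continuous_map TH euclidean (\<lambda>h. h a)" by (simp add: comp_def)
  moreover have "continuous_map euclidean euclidean \<xi>"
    using assms by (simp add: dual_group_iff is_character_def continuous_map_iff_continuous2)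
  ultimately show ?thesis
    using continuous_map_compose[of TH euclidean "\<lambda>h. h a" euclidean \<xi>] by (simp add: comp_def)
qed

section \<open>The orbit relation is Borel\<close>

lemma compact_dense_sequence:
  assumes "compactin TH L" "L \<noteq> {}"
  obtains r :: "nat \<Rightarrow> 'a \<Rightarrow> 'a" where "\<And>m. r m \<in> L"
    "\<And>U. openin TH U \<Longrightarrow> U \<inter> L \<noteq> {} \<Longrightarrow> \<exists>m. r m \<in> U"
proof -
  obtain \<B> where \<B>: "countable \<B>" "\<And>V. V \<in> \<B> \<Longrightarrow> openin TH V"
    "\<And>U x. openin TH U \<Longrightarrow> x \<in> U \<Longrightarrow> \<exists>V\<in>\<B>. x \<in> V \<and> V \<subseteq> U"
    using second_countable_TH unfolding second_countable_def by metis
  define D where "D = (\<lambda>V. SOME x. x \<in> V \<inter> L) ` {V \<in> \<B>. V \<inter> L \<noteq> {}}"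
  have some: "(SOME x. x \<in> V \<inter> L) \<in> V \<inter> L" if "V \<inter> L \<noteq> {}" for V
    using someI_ex[of "\<lambda>x. x \<in> V \<inter> L"] that by auto
  have cD: "countable D" unfolding D_def using \<B>(1) by auto
  have hit: "\<exists>x\<in>D. x \<in> U" if U: "openin TH U" "U \<inter> L \<noteq> {}" for U
  proof -
    obtain x where x: "x \<in> U" "x \<in> L" using U(2) by blast
    obtain V where V: "V \<in> \<B>" "x \<in> V" "V \<subseteq> U" using \<B>(3)[OF U(1) x(1)] by blast
    have "(SOME x. x \<in> V \<inter> L) \<in> D" unfolding D_def using V x by blast
    moreover have "(SOME x. x \<in> V \<inter> L) \<in> V" using some[of V] V x by blast
    ultimately show ?thesis using V(3) by (intro bexI[of _ "SOME x. x \<in> V \<inter> L"]) auto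
  qed
  have sub: "D \<subseteq> L"
  proof
    fix x assume "x \<in> D"
    then obtain V where "V \<inter> L \<noteq> {}" "x = (SOME x. x \<in> V \<inter> L)" unfolding D_def by auto
    then show "x \<in> L" using some[of V] by simp
  qed
  have "openin TH Hs" using topspace_TH by (metis openin_topspace)
  moreover have "L \<subseteq> Hs" using assms(1) compactin_subset_topspace topspace_TH by blast
  ultimately have "D \<noteq> {}" using hit[of Hs] assms(2) by blast
  show ?thesis
  proof (rule that[of "from_nat_into D"])
    show "from_nat_into D m \<in> L" for m using from_nat_into[OF \<open>D \<noteq> {}\<close>] sub by blast
    show "\<exists>m. from_nat_into D m \<in> U" if "openin TH U" "U \<inter> L \<noteq> {}" for U
      using hit[OF that] from_nat_into_surj[OF cD] by metis
  qed
qed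

text \<open>The right-hand side has countable quantifiers only, hence is a Borel condition on the
  pair. An exact solution \<open>g\<close> is approximated by density of \<open>r\<close> in
  \<open>L\<close> and continuity in \<open>h\<close>. Conversely, approximate solutions for every
  \<open>n\<close> make closed conditions with the finite intersection property on the compact set
  \<open>L\<close>, and a common point solves the equation at all dense points.\<close>

lemma orbit_relation_iff:
  assumes L: "compactin TH L" and r: "\<And>m::nat. r m \<in> L"
    "\<And>U. openin TH U \<Longrightarrow> U \<inter> L \<noteq> {} \<Longrightarrow> \<exists>m. r m \<in> U"
    and \<xi>: "\<xi> \<in> dual_group" and \<eta>: "\<eta> \<in> dual_group"
  shows "(\<exists>g\<in>L. \<xi> \<circ> g = \<eta>) \<longleftrightarrow>
    (\<forall>n::nat. \<exists>m. \<forall>k<n. cmod (\<xi> (r m (dense_seq k)) - \<eta> (dense_seq k)) < 1 / Suc n)"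
proof
  have LH: "L \<subseteq> Hs" using L compactin_subset_topspace topspace_TH by blast
  have cont: "continuous_map TH euclidean (\<lambda>h. cmod (\<xi> (h (dense_seq k)) - \<eta> (dense_seq k)))" for k
    using continuous_orbit_eval[OF \<xi>, of "dense_seq k"]
    by (intro continuous_map_norm continuous_map_diff continuous_map_canonical_const) auto
  {
    assume "\<exists>g\<in>L. \<xi> \<circ> g = \<eta>"
    then obtain g where g: "g \<in> L" "\<xi> \<circ> g = \<eta>" by blast
    show "\<forall>n::nat. \<exists>m. \<forall>k<n. cmod (\<xi> (r m (dense_seq k)) - \<eta> (dense_seq k)) < 1 / Suc n"
    proof
      fix n :: nat
      have op: "openin TH {h \<in> topspace TH. cmod (\<xi> (h (dense_seq k)) - \<eta> (dense_seq k)) \<in> {..<1 / Suc n}}" for k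
        by (rule openin_continuous_map_preimage[OF cont]) simp
      have "openin TH (topspace TH \<inter> (\<Inter>k\<in>{..<n}. {h \<in> topspace TH. cmod (\<xi> (h (dense_seq k)) - \<eta> (dense_seq k)) \<in> {..<1 / Suc n}}))"
      proof (cases "n = 0")
        case False
        then show ?thesis using op by (intro openin_Int openin_topspace openin_INT) auto
      qed auto
      moreover have "g \<in> topspace TH \<inter> (\<Inter>k\<in>{..<n}. {h \<in> topspace TH. cmod (\<xi> (h (dense_seq k)) - \<eta> (dense_seq k)) \<in> {..<1 / Suc n}})"
        using g LH topspace_TH by (auto simp: fun_eq_iff)
      ultimately obtain m where "r m \<in> topspace TH \<inter> (\<Inter>k\<in>{..<n}. {h \<in> topspace TH. cmod (\<xi> (h (dense_seq k)) - \<eta> (dense_seq k)) \<in> {..<1 / Suc n}})"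
        using r(2) g(1) by blast
      then show "\<exists>m. \<forall>k<n. cmod (\<xi> (r m (dense_seq k)) - \<eta> (dense_seq k)) < 1 / Suc n" by auto
    qed
  }
  assume R: "\<forall>n::nat. \<exists>m. \<forall>k<n. cmod (\<xi> (r m (dense_seq k)) - \<eta> (dense_seq k)) < 1 / Suc n"
  \<comment> \<open>Non-strict inequalities make the set closed; as \<open>n\<close> grows there are
    more coordinates and a smaller tolerance, so the sets decrease.\<close>
  define F where "F n = {h \<in> topspace TH. \<forall>k<n. cmod (\<xi> (h (dense_seq k)) - \<eta> (dense_seq k)) \<le> 1 / Suc n}" for n :: nat
  have clF: "closedin TH (F n)" for n
  proof -
    have cl: "closedin TH {h \<in> topspace TH. cmod (\<xi> (h (dense_seq k)) - \<eta> (dense_seq k)) \<in> {..1 / Suc n}}" for k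
      by (rule closedin_continuous_map_preimage[OF cont]) simp
    have "F n = topspace TH \<inter> (\<Inter>k\<in>{..<n}. {h \<in> topspace TH. cmod (\<xi> (h (dense_seq k)) - \<eta> (dense_seq k)) \<in> {..1 / Suc n}})"
      unfolding F_def by auto
    also have "closedin TH \<dots>"
    proof (cases "n = 0")
      case False
      then show ?thesis using cl by (intro closedin_Int closedin_topspace closedin_INT) auto
    qed auto
    finally show ?thesis .
  qed
  have mono: "F n \<subseteq> F m" if "m \<le> n" for m n
  proof -
    have "1 / real (Suc n) \<le> 1 / real (Suc m)" using that by (simp add: frac_le)
    then show ?thesis using that unfolding F_def by (auto intro: order_trans order_less_le_trans)
  qed
  have ne: "L \<inter> F n \<noteq> {}" for n
  proof -
    obtain m where "\<forall>k<n. cmod (\<xi> (r m (dense_seq k)) - \<eta> (dense_seq k)) < 1 / Suc n" using R by blast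
    then have "r m \<in> L \<inter> F n" using r(1)[of m] LH topspace_TH unfolding F_def by (auto intro: less_imp_le)
    then show ?thesis by blast
  qed
  have "L \<inter> \<Inter>(range F) \<noteq> {}"
  proof -
    have "L \<inter> \<Inter>\<F> \<noteq> {}" if fin: "finite \<F>" and sub: "\<F> \<subseteq> range F" for \<F>
    proof -
      obtain I where I: "finite I" "\<F> = F ` I" using finite_subset_image[OF fin sub] by auto
      have "F (Max (insert 0 I)) \<subseteq> \<Inter>\<F>" unfolding I(2) using I(1) by (intro INT_greatest mono) auto
      then show ?thesis using ne[of "Max (insert 0 I)"] by blast
    qed
    moreover have "\<forall>C\<in>range F. closedin TH C" using clF by blast
    ultimately show ?thesis using conjunct2[OF L[unfolded compactin_fip], rule_format, of "range F"] by auto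
  qed
  then obtain g where g: "g \<in> L" "\<And>n. g \<in> F n" by blast
  have "\<xi> (g (dense_seq k)) = \<eta> (dense_seq k)" for k
  proof (rule ccontr)
    assume "\<xi> (g (dense_seq k)) \<noteq> \<eta> (dense_seq k)"
    then have "0 < cmod (\<xi> (g (dense_seq k)) - \<eta> (dense_seq k))" by simp
    then obtain p where p: "1 / Suc p < cmod (\<xi> (g (dense_seq k)) - \<eta> (dense_seq k))"
      using nat_approx_posE by blast
    \<comment> \<open>\<open>Suc k\<close> brings coordinate \<open>k\<close> into play and
      \<open>p\<close> makes the tolerance small enough.\<close>
    have "g \<in> F (max p (Suc k))" using g(2) .
    then have "cmod (\<xi> (g (dense_seq k)) - \<eta> (dense_seq k)) \<le> 1 / Suc (max p (Suc k))"
      unfolding F_def by auto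
    also have "\<dots> \<le> 1 / Suc p" by (simp add: frac_le)
    finally show False using p by simp
  qed
  then have "\<xi> \<circ> g = \<eta>"
    using dual_comp[OF \<xi>, of g] g(1) LH \<eta>
    by (intro continuous_eq_dense_seq) (auto simp: dual_group_iff is_character_def)
  then show "\<exists>g\<in>L. \<xi> \<circ> g = \<eta>" using g(1) by blast
qed

lemma compact_orbit_relation_measurable:
  assumes L: "compactin TH L"
  shows "{p \<in> space (N \<Otimes>\<^sub>M N). \<exists>g\<in>L. fst p \<circ> g = snd p} \<in> sets (N \<Otimes>\<^sub>M N)"
proof (cases "L = {}")
  case False
  obtain r where r: "\<And>m::nat. r m \<in> L"
    "\<And>U. openin TH U \<Longrightarrow> U \<inter> L \<noteq> {} \<Longrightarrow> \<exists>m. r m \<in> U"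
    using compact_dense_sequence[OF L False] by metis
  have "{p \<in> space (N \<Otimes>\<^sub>M N). \<exists>g\<in>L. fst p \<circ> g = snd p} = {p \<in> space (N \<Otimes>\<^sub>M N).
      \<forall>n::nat. \<exists>m. \<forall>k<n. cmod (fst p (r m (dense_seq k)) - snd p (dense_seq k)) < 1 / Suc n}"
  proof (intro Collect_cong conj_cong refl)
    fix p assume "p \<in> space (N \<Otimes>\<^sub>M N)"
    then have "fst p \<in> dual_group" "snd p \<in> dual_group" by (auto simp: space_pair_measure space_N)
    from orbit_relation_iff[OF L r this] show "(\<exists>g\<in>L. fst p \<circ> g = snd p) \<longleftrightarrow>
        (\<forall>n::nat. \<exists>m. \<forall>k<n. cmod (fst p (r m (dense_seq k)) - snd p (dense_seq k)) < 1 / Suc n)" .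
  qed
  also have "\<dots> \<in> sets (N \<Otimes>\<^sub>M N)" by measurable
  finally show ?thesis .
qed auto

text \<open>The acting group is a countable union of compact sets, so the orbit relation is a
  countable union of Borel sets, although as a projection it might be expected to be merely
  analytic.\<close>

lemma orbit_relation_measurable:
  "{p \<in> space (N \<Otimes>\<^sub>M N). \<exists>g\<in>Hs. fst p \<circ> g = snd p} \<in> sets (N \<Otimes>\<^sub>M N)"
proof -
  obtain K :: "nat \<Rightarrow> ('a \<Rightarrow> 'a) set" where K: "\<And>n. compactin TH (K n)" "(\<Union>n. K n) = topspace TH"
    using compact_exhaustion[OF second_countable_TH locally_compact_TH Hausdorff_TH] by metis
  have "{p \<in> space (N \<Otimes>\<^sub>M N). \<exists>g\<in>Hs. fst p \<circ> g = snd p} =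
      (\<Union>n. {p \<in> space (N \<Otimes>\<^sub>M N). \<exists>g\<in>K n. fst p \<circ> g = snd p})"
    using K(2) topspace_TH by blast
  also have "\<dots> \<in> sets (N \<Otimes>\<^sub>M N)"
    using compact_orbit_relation_measurable[OF K(1)] by blast
  finally show ?thesis .
qed

subsubsection \<open>The modulus\<close>

text \<open>\<open>delta\<close> is computed from one chosen set; this frees it from the choice. The
  measure of \<open>h\<close>-images is again translation invariant, because translating by
  \<open>x\<close> before \<open>h\<close> is translating by \<open>h x\<close> after it, so
  uniqueness makes it proportional to \<open>M\<close>.\<close>

lemma emeasure_image_scale:
  assumes h: "h \<in> Hs"
  shows "0 < delta M h" "B \<in> sets M \<Longrightarrow> emeasure M (h ` B) = ennreal (delta M h) * emeasure M B"
proof -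
  have [measurable]: "inv h \<in> borel_measurable borel" using Hs_measurable[OF Hs_inv[OF h]] .
  have im: "inv h \<in> M \<rightarrow>\<^sub>M M" by (simp add: sets_M cong: measurable_cong_sets)
  define \<nu> where "\<nu> = distr M M (inv h)"
  have \<nu>: "emeasure \<nu> B = emeasure M (h ` B)" if "B \<in> sets M" for B
    unfolding \<nu>_def using that im by (simp add: emeasure_distr Hs_image_eq[OF h])
  have sets_\<nu>: "sets \<nu> = sets M" by (simp add: \<nu>_def)
  have "compact (h ` K)" if "compact K" for K
    using that Hs_continuous[OF h] by (meson compact_continuous_image continuous_on_subset subset_UNIV)
  then have fin: "emeasure \<nu> K < \<infinity>" if "compact K" for K
    using that \<nu>[OF compact_imp_sets_M[OF that]] emeasure_M_compact by simp
  have "sigma_finite_measure \<nu>"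
    by (rule sigma_finite_measure_borel_of[OF second_countable_A locally_compact_A Hausdorff_A])
       (auto simp: sets_\<nu> sets_M sets_borel_of_euclidean fin[simplified])
  have inv\<nu>: "distr \<nu> \<nu> ((+) x) = \<nu>" for x
  proof -
    have [measurable]: "(+) x \<in> borel_measurable borel" "(+) (h x) \<in> borel_measurable borel" by measurable
    have "distr \<nu> \<nu> ((+) x) = distr M M ((+) x \<circ> inv h)"
      unfolding \<nu>_def by (subst distr_distr) (auto simp: sets_M cong: measurable_cong_sets distr_cong)
    also have "(+) x \<circ> inv h = inv h \<circ> (+) (h x)"
      using Hs_add[OF Hs_inv[OF h]] h by (auto simp: fun_eq_iff)
    also have "distr M M (inv h \<circ> (+) (h x)) = distr (distr M M ((+) (h x))) M (inv h)"
      by (subst distr_distr) (auto simp: sets_M cong: measurable_cong_sets)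
    finally show ?thesis by (simp add: distr_translate_M \<nu>_def)
  qed
  have uniq: "emeasure M A * emeasure \<nu> B = emeasure \<nu> A * emeasure M B" if "A \<in> sets M" "B \<in> sets M" for A B
  proof -
    have "(\<integral>\<^sup>+x. indicator A x \<partial>M) * (\<integral>\<^sup>+x. indicator B x \<partial>\<nu>) = (\<integral>\<^sup>+x. indicator A x \<partial>\<nu>) * (\<integral>\<^sup>+x. indicator B x \<partial>M)"
    proof (rule invariant_measure_unique[OF sigma_finite_M \<open>sigma_finite_measure \<nu>\<close> sets_\<nu>,
          where m = "(+)" and n = uminus])
      show "(\<lambda>(x, y). x + y) \<in> M \<Otimes>\<^sub>M M \<rightarrow>\<^sub>M M" using measurable_add_A
        by (simp add: sets_M cong: measurable_cong_sets sets_pair_measure_cong)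
      show "uminus \<in> M \<rightarrow>\<^sub>M M" by (simp add: sets_M cong: measurable_cong_sets)
    qed (use that inv\<nu> distr_translate_M in auto)
    then show ?thesis using that by (simp add: sets_\<nu>)
  qed
  \<comment> \<open>The chosen set \<open>A\<close> is known only to have positive finite measure.
    Its image under \<open>h\<close> inherits this by proportionality from the compact set
    \<open>K\<close>, whose image is compact and contains a nonempty open set.\<close>
  obtain K where K: "compact K" "interior K \<noteq> {}" "0 < emeasure M K" "emeasure M K < \<infinity>" "K \<in> sets M"
    by (rule compact_pos_M)
  define A where "A = (SOME B. B \<in> sets M \<and> 0 < emeasure M B \<and> emeasure M B < \<infinity>)"
  have A: "A \<in> sets M" "0 < emeasure M A" "emeasure M A < \<infinity>"
    using someI[of "\<lambda>B. B \<in> sets M \<and> 0 < emeasure M B \<and> emeasure M B < \<infinity>" K] K unfolding A_def by auto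
  have "emeasure \<nu> K > 0"
  proof -
    have "open (inv h -` interior K)" using Hs_continuous[OF Hs_inv[OF h]] by (intro open_vimage) auto
    moreover have "inv h -` interior K \<noteq> {}" using K(2) Hs_image_eq[OF h] by (metis image_is_empty)
    ultimately have "0 < emeasure M (inv h -` interior K)" by (rule emeasure_M_open)
    also have "\<dots> \<le> emeasure M (inv h -` K)"
    proof (rule emeasure_mono)
      have "inv h -` K \<inter> space M \<in> sets M" by (rule measurable_sets[OF im K(5)])
      then show "inv h -` K \<in> sets M" by simp
    qed (use interior_subset in blast)
    finally show ?thesis using \<nu>[OF K(5)] Hs_image_eq[OF h] by simp
  qed
  have e1: "emeasure M K * emeasure \<nu> A = emeasure \<nu> K * emeasure M A" by (rule uniq[OF K(5) A(1)])
  have "emeasure \<nu> K * emeasure M A < \<infinity>" using fin[OF K(1)] A(3) by (simp add: ennreal_mult_less_top)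
  then have fA: "emeasure \<nu> A < \<infinity>"
    using K(3) unfolding e1[symmetric] by (auto simp: ennreal_mult_less_top)
  have pA: "0 < emeasure \<nu> A"
  proof (rule ccontr)
    assume "\<not> 0 < emeasure \<nu> A"
    then have "emeasure \<nu> K * emeasure M A = 0" using e1 by (simp add: zero_less_iff_neq_zero)
    then show False using \<open>emeasure \<nu> K > 0\<close> A(2) by auto
  qed
  have d: "delta M h = measure M (h ` A) / measure M A" by (simp add: delta_def A_def Let_def)
  have mA: "0 < measure M A" using A by (simp add: measure_def enn2real_positive_iff)
  have mh: "0 < measure M (h ` A)" "emeasure M (h ` A) = ennreal (measure M (h ` A))" "emeasure M A = ennreal (measure M A)"
    using fA pA A \<nu>[OF A(1)] by (auto simp: measure_def enn2real_positive_iff less_top[symmetric])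
  show pos: "0 < delta M h" unfolding d using mA mh by simp
  show "emeasure M (h ` B) = ennreal (delta M h) * emeasure M B" if B: "B \<in> sets M"
  proof -
    have e: "ennreal (measure M A) * emeasure M (h ` B) = ennreal (measure M (h ` A)) * emeasure M B"
      using uniq[OF A(1) B] \<nu>[OF A(1)] \<nu>[OF B] mh by simp
    have "emeasure M (h ` B) = ennreal (1 / measure M A) * (ennreal (measure M A) * emeasure M (h ` B))"
      using mA by (simp add: mult.assoc[symmetric] ennreal_mult[symmetric])
    also have "\<dots> = ennreal (1 / measure M A) * (ennreal (measure M (h ` A)) * emeasure M B)" by (simp add: e)
    also have "\<dots> = ennreal (delta M h) * emeasure M B"
      using mA mh by (simp add: mult.assoc[symmetric] ennreal_mult[symmetric] d)
    finally show ?thesis .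
  qed
qed

lemma measurable_M_inv: "h \<in> Hs \<Longrightarrow> inv h \<in> M \<rightarrow>\<^sub>M M"
  using Hs_measurable[OF Hs_inv] by (simp add: sets_M cong: measurable_cong_sets)

lemma distr_inv_M:
  assumes h: "h \<in> Hs" shows "distr M M (inv h) = density M (\<lambda>_. ennreal (delta M h))"
proof (rule measure_eqI)
  fix B assume "B \<in> sets (distr M M (inv h))"
  then show "emeasure (distr M M (inv h)) B = emeasure (density M (\<lambda>_. ennreal (delta M h))) B"
    using measurable_M_inv[OF h] emeasure_image_scale(2)[OF h]
    by (simp add: emeasure_distr emeasure_density nn_integral_cmult_indicator Hs_image_eq[OF h])
qed simp

lemma nn_integral_scale_M:
  assumes h: "h \<in> Hs" and f: "f \<in> borel_measurable M"
  shows "(\<integral>\<^sup>+x. f (inv h x) \<partial>M) = ennreal (delta M h) * (\<integral>\<^sup>+x. f x \<partial>M)"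
proof -
  have "(\<integral>\<^sup>+x. f (inv h x) \<partial>M) = (\<integral>\<^sup>+x. f x \<partial>distr M M (inv h))"
    using measurable_M_inv[OF h] f by (simp add: nn_integral_distr)
  also have "\<dots> = ennreal (delta M h) * (\<integral>\<^sup>+x. f x \<partial>M)"
    unfolding distr_inv_M[OF h] using f by (simp add: nn_integral_density nn_integral_cmult)
  finally show ?thesis .
qed

lemma integral_scale_M:
  fixes f :: "'a \<Rightarrow> complex"
  assumes h: "h \<in> Hs" and f: "f \<in> borel_measurable M"
  shows "(\<integral>x. f (inv h x) \<partial>M) = delta M h * (\<integral>x. f x \<partial>M)"
proof -
  have "(\<integral>x. f (inv h x) \<partial>M) = (\<integral>x. f x \<partial>distr M M (inv h))"
    using measurable_M_inv[OF h] f by (simp add: integral_distr)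
  also have "\<dots> = delta M h * (\<integral>x. f x \<partial>M)"
    unfolding distr_inv_M[OF h] using f emeasure_image_scale(1)[OF h]
    by (subst integral_density) (auto simp: scaleR_conv_of_real)
  finally show ?thesis .
qed

lemma measurable_translate_M: "(\<lambda>x. a + x) \<in> M \<rightarrow>\<^sub>M M"
  by measurable

lemma nn_integral_translate_M:
  assumes f: "f \<in> borel_measurable M"
  shows "(\<integral>\<^sup>+x. f (a + x) \<partial>M) = (\<integral>\<^sup>+x. f x \<partial>M)"
proof -
  have "(\<integral>\<^sup>+x. f x \<partial>M) = (\<integral>\<^sup>+x. f x \<partial>distr M M (\<lambda>x. a + x))" by (simp add: distr_translate_M)
  also have "\<dots> = (\<integral>\<^sup>+x. f (a + x) \<partial>M)" by (rule nn_integral_distr[OF measurable_translate_M]) (use f in simp)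
  finally show ?thesis ..
qed

lemma integral_translate_M:
  fixes f :: "'a \<Rightarrow> complex"
  assumes f: "f \<in> borel_measurable M"
  shows "(\<integral>x. f (a + x) \<partial>M) = (\<integral>x. f x \<partial>M)"
proof -
  have "(\<integral>x. f x \<partial>M) = (\<integral>x. f x \<partial>distr M M (\<lambda>x. a + x))" by (simp add: distr_translate_M)
  also have "\<dots> = (\<integral>x. f (a + x) \<partial>M)" by (rule integral_distr[OF measurable_translate_M f])
  finally show ?thesis ..
qed

text \<open>With the defining set fixed, \<open>delta M h\<close> is a constant times the measure of
  a section of a measurable subset of the product.\<close>

lemma measurable_delta [measurable]: "delta M \<in> borel_measurable MH"
proof -
  interpret M: sigma_finite_measure M by (rule sigma_finite_M)
  define A where "A = (SOME B. B \<in> sets M \<and> 0 < emeasure M B \<and> emeasure M B < \<infinity>)"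
  obtain K where K: "compact K" "interior K \<noteq> {}" "0 < emeasure M K" "emeasure M K < \<infinity>" "K \<in> sets M"
    by (rule compact_pos_M)
  have A: "A \<in> sets M"
    using someI[of "\<lambda>B. B \<in> sets M \<and> 0 < emeasure M B \<and> emeasure M B < \<infinity>" K] K unfolding A_def by auto
  then have [measurable]: "A \<in> sets borel" by (simp add: sets_M)
  have "(\<lambda>h. measure M {x. inv h x \<in> A} / measure M A) \<in> borel_measurable MH"
  proof (intro borel_measurable_divide M.measurable_measure)
    show "{x \<in> space (MH \<Otimes>\<^sub>M M). snd x \<in> {xa. inv (fst x) xa \<in> A}} \<in> sets (MH \<Otimes>\<^sub>M M)"
      by simp measurable
  qed auto
  moreover have "delta M h = measure M {x. inv h x \<in> A} / measure M A" if "h \<in> space MH" for h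
    using that Hs_image_eq[of h A] by (simp add: delta_def A_def Let_def space_MH vimage_def)
  ultimately show ?thesis by (simp cong: measurable_cong)
qed

end

subsection \<open>The Plancherel transform\<close>

lemma L2norm_cong:
  assumes "\<And>x. x \<in> space N \<Longrightarrow> f x = g x" shows "L2norm N f = L2norm N g"
  unfolding L2norm_def
    using assms by (auto intro!: arg_cong[where f = sqrt] Bochner_Integration.integral_cong)

lemma indicator_L2:
  assumes "A \<in> sets N" "emeasure N A < \<infinity>" shows "(\<lambda>x. indicator A x :: complex) \<in> L2 N"
proof -
  have "(cmod (indicator A x))\<^sup>2 = indicator A x" for x by (simp add: indicator_def)
  then show ?thesis unfolding L2_def using assms by simp
qed

text \<open>Polarization: through the free scalar \<open>c\<close>, norms determine inner
  products.\<close>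

lemma L2norm_add_scale_sq:
  assumes f: "f \<in> L2 N" and g: "g \<in> L2 N"
  shows "(L2norm N (\<lambda>x. f x + c * g x))\<^sup>2 =
    (L2norm N f)\<^sup>2 + (cmod c)\<^sup>2 * (L2norm N g)\<^sup>2 + 2 * Re (cnj c * (\<integral>x. f x * cnj (g x) \<partial>N))"
proof -
  have e: "(cmod (f x + c * g x))\<^sup>2 = (cmod (f x))\<^sup>2 + (cmod c)\<^sup>2 * (cmod (g x))\<^sup>2 + 2 * Re (cnj c * (f x * cnj (g x)))" for x
    by (simp only: cmod_power2, simp add: algebra_simps power2_eq_square)
  have i: "integrable N (\<lambda>x. cnj c * (f x * cnj (g x)))" using integrable_L2_cnj[OF f g] by simp
  have "(L2norm N (\<lambda>x. f x + c * g x))\<^sup>2 =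
      (\<integral>x. (cmod (f x))\<^sup>2 + (cmod c)\<^sup>2 * (cmod (g x))\<^sup>2 + 2 * Re (cnj c * (f x * cnj (g x))) \<partial>N)"
    unfolding L2norm_sq e ..
  also have "\<dots> = (\<integral>x. (cmod (f x))\<^sup>2 \<partial>N) + (cmod c)\<^sup>2 * (\<integral>x. (cmod (g x))\<^sup>2 \<partial>N)
      + 2 * (\<integral>x. Re (cnj c * (f x * cnj (g x))) \<partial>N)"
    using f g integrable_Re[OF i]
    by (simp add: L2_integrable del: times_complex.sel)
  also have "(\<integral>x. Re (cnj c * (f x * cnj (g x))) \<partial>N) = Re (cnj c * (\<integral>x. f x * cnj (g x) \<partial>N))"
    using i by (subst integral_Re) simp_all
  finally show ?thesis by (simp add: L2norm_sq)
qed

context quasi_regular_setup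
begin

lemma fourier1_L2: "f \<in> L1 M \<Longrightarrow> f \<in> L2 M \<Longrightarrow> fourier1 M f \<in> L2 N"
  and L2norm_fourier1: "f \<in> L1 M \<Longrightarrow> f \<in> L2 M \<Longrightarrow> L2norm N (fourier1 M f) = L2norm M f"
  and fourier1_dense: "g \<in> L2 N \<Longrightarrow> 0 < e \<Longrightarrow> \<exists>f \<in> L1 M \<inter> L2 M. L2norm N (\<lambda>\<xi>. fourier1 M f \<xi> - g \<xi>) < e"
  using plancherel unfolding plancherel_measure_def by auto

lemma character_measurable: "\<xi> \<in> dual_group \<Longrightarrow> \<xi> \<in> borel_measurable borel"
  by (intro borel_measurable_continuous_onI) (simp add: dual_group_iff is_character_def)

lemma cmod_dual: "\<xi> \<in> dual_group \<Longrightarrow> cmod (\<xi> x) = 1"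
  by (simp add: dual_group_iff is_character_def)

lemma integrable_mult_character:
  assumes "f \<in> L1 M" "\<xi> \<in> dual_group" shows "integrable M (\<lambda>x. f x * cnj (\<xi> x))"
proof -
  have [measurable]: "\<xi> \<in> borel_measurable M"
    using character_measurable[OF assms(2)] measurable_cong_sets[OF sets_M refl] by blast
  have [measurable]: "f \<in> borel_measurable M"
    using assms(1) by (auto simp: L1_def)
  have m: "(\<lambda>x. f x * cnj (\<xi> x)) \<in> borel_measurable M" by measurable
  show ?thesis
    by (rule Bochner_Integration.integrable_bound[of M f, OF _ m])
       (use assms cmod_dual[OF assms(2)] in \<open>auto simp: L1_def norm_mult\<close>)
qed

lemma fourier1_add_scale:
  assumes "f \<in> L1 M" "g \<in> L1 M" "\<xi> \<in> dual_group"
  shows "fourier1 M (\<lambda>x. f x + c * g x) \<xi> = fourier1 M f \<xi> + c * fourier1 M g \<xi>"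
  using integrable_mult_character[OF assms(1,3)] integrable_mult_character[OF assms(2,3)]
  unfolding fourier1_def by (simp add: distrib_right mult.assoc)

lemma fourier1_diff:
  assumes "f \<in> L1 M" "g \<in> L1 M" "\<xi> \<in> dual_group"
  shows "fourier1 M (\<lambda>x. f x - g x) \<xi> = fourier1 M f \<xi> - fourier1 M g \<xi>"
  using fourier1_add_scale[OF assms, of "-1"] by simp

lemma L1_add_scale: "f \<in> L1 M \<Longrightarrow> g \<in> L1 M \<Longrightarrow> (\<lambda>x. f x + c * g x) \<in> L1 M"
  by (simp add: L1_def)

lemma L1_diff: "f \<in> L1 M \<Longrightarrow> g \<in> L1 M \<Longrightarrow> (\<lambda>x. f x - g x) \<in> L1 M"
  by (simp add: L1_def)

lemma L2norm_fourier1_diff: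
  assumes "f \<in> L1 M" "f \<in> L2 M" "g \<in> L1 M" "g \<in> L2 M"
  shows "L2norm N (\<lambda>\<xi>. fourier1 M f \<xi> - fourier1 M g \<xi>) = L2norm M (\<lambda>x. f x - g x)"
proof -
  have "L2norm N (\<lambda>\<xi>. fourier1 M f \<xi> - fourier1 M g \<xi>) = L2norm N (fourier1 M (\<lambda>x. f x - g x))"
    using assms by (intro L2norm_cong) (simp add: fourier1_diff space_N)
  also have "\<dots> = L2norm M (\<lambda>x. f x - g x)"
    using assms by (intro L2norm_fourier1 L1_diff L2_diff)
  finally show ?thesis .
qed

lemma L1_L2_restrict:
  assumes u[measurable]: "u \<in> borel_measurable M" and A[measurable]: "A \<in> sets M" and "emeasure M A < \<infinity>"
    and uA: "(\<lambda>x. u x * indicator A x) \<in> L2 M"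
  shows "(\<lambda>x. u x * indicator A x) \<in> L1 M"
proof -
  have "(\<lambda>x. indicator A x :: complex) \<in> L2 M" using assms by (intro indicator_L2)
  from integrable_L2_mult[OF uA this] have "integrable M (\<lambda>x. u x * indicator A x * indicator A x)" .
  then show ?thesis unfolding L1_def by (simp add: mult.assoc flip: indicator_inter_arith)
qed

text \<open>The Plancherel condition provides only approximation of \<open>g\<close> by transforms
  of functions in \<open>L1\<close> and \<open>L2\<close>. By the isometry the approximating
  functions converge on the group side as well, and their limit is the preimage.\<close>

lemma fourier_L2_surj:
  assumes g: "g \<in> L2 N" obtains f where "is_fourier_L2 M N f g"
proof -
  \<comment> \<open>The tolerance makes two consecutive errors add up to at most the
    \<open>n\<close>-th power of 1/2, the step size demanded by
    \<open>L2_complete_fast\<close>.\<close>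
  have "\<exists>f. f \<in> L1 M \<inter> L2 M \<and> L2norm N (\<lambda>\<xi>. fourier1 M f \<xi> - g \<xi>) < (1/2)^n / 4" for n :: nat
    using fourier1_dense[OF g, of "(1/2)^n / 4"] by auto
  then obtain fs where fs: "\<And>n::nat. fs n \<in> L1 M \<inter> L2 M" "\<And>n. L2norm N (\<lambda>\<xi>. fourier1 M (fs n) \<xi> - g \<xi>) < (1/2)^n / 4"
    by metis
  have "L2norm M (\<lambda>x. fs (Suc n) x - fs n x) \<le> (1/2)^n" for n
  proof -
    have "L2norm M (\<lambda>x. fs (Suc n) x - fs n x) = L2norm N (\<lambda>\<xi>. fourier1 M (fs (Suc n)) \<xi> - fourier1 M (fs n) \<xi>)"
      using fs(1) by (subst L2norm_fourier1_diff) auto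
    also have "\<dots> \<le> L2norm N (\<lambda>\<xi>. fourier1 M (fs (Suc n)) \<xi> - g \<xi>) + L2norm N (\<lambda>\<xi>. g \<xi> - fourier1 M (fs n) \<xi>)"
      using fs(1) g fourier1_L2 by (intro L2norm_diff_triangle) auto
    also have "\<dots> \<le> (1/2)^Suc n / 4 + (1/2)^n / 4"
      using fs(2)[of n] fs(2)[of "Suc n"] by (subst (2) L2norm_minus_commute) simp
    also have "\<dots> \<le> (1/2)^n" by simp
    finally show ?thesis .
  qed
  then obtain f where f: "f \<in> L2 M" "(\<lambda>n. L2norm M (\<lambda>x. fs n x - f x)) \<longlonglongrightarrow> 0"
    using L2_complete_fast[of fs M] fs(1) by auto
  have "(\<lambda>n. L2norm N (\<lambda>\<xi>. fourier1 M (fs n) \<xi> - g \<xi>)) \<longlonglongrightarrow> 0"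
  proof (rule Lim_null_comparison[of _ "\<lambda>n. (1/2)^n / 4"])
    show "\<forall>\<^sub>F n in sequentially. norm (L2norm N (\<lambda>\<xi>. fourier1 M (fs n) \<xi> - g \<xi>)) \<le> (1/2)^n / 4"
      unfolding real_norm_def abs_of_nonneg[OF L2norm_nonneg]
      by (intro always_eventually allI less_imp_le fs(2))
    show "(\<lambda>n. (1/2::real)^n / 4) \<longlonglongrightarrow> 0" by (intro tendsto_divide_zero LIMSEQ_power_zero) auto
  qed
  then show ?thesis using that f fs(1) g unfolding is_fourier_L2_def by blast
qed

lemma is_fourier_L2D:
  assumes "is_fourier_L2 M N f g" shows "f \<in> L2 M" "g \<in> L2 N"
  using assms by (auto simp: is_fourier_L2_def)

lemma fourier_L2_norm:
  assumes "is_fourier_L2 M N f g" shows "L2norm N g = L2norm M f"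
proof -
  obtain fs where fs: "\<And>n. fs n \<in> L1 M \<inter> L2 M" "(\<lambda>n. L2norm M (\<lambda>x. fs n x - f x)) \<longlonglongrightarrow> 0"
    "(\<lambda>n. L2norm N (\<lambda>\<xi>. fourier1 M (fs n) \<xi> - g \<xi>)) \<longlonglongrightarrow> 0"
    using assms unfolding is_fourier_L2_def by blast
  have "(\<lambda>n. L2norm M (fs n)) \<longlonglongrightarrow> L2norm M f"
    using fs is_fourier_L2D[OF assms] by (intro L2norm_tendsto) auto
  moreover have "(\<lambda>n. L2norm N (fourier1 M (fs n))) \<longlonglongrightarrow> L2norm N g"
    using fs is_fourier_L2D[OF assms] fourier1_L2 by (intro L2norm_tendsto) auto
  moreover have "L2norm N (fourier1 M (fs n)) = L2norm M (fs n)" for n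
    using fs(1)[of n] L2norm_fourier1 by auto
  ultimately show ?thesis using LIMSEQ_unique by auto
qed

lemma is_fourier_L2_add_scale:
  assumes "is_fourier_L2 M N f g" "is_fourier_L2 M N f' g'"
  shows "is_fourier_L2 M N (\<lambda>x. f x + c * f' x) (\<lambda>\<xi>. g \<xi> + c * g' \<xi>)"
proof -
  note L = is_fourier_L2D[OF assms(1)] is_fourier_L2D[OF assms(2)]
  obtain fs where fs: "\<And>n. fs n \<in> L1 M" "\<And>n. fs n \<in> L2 M" "(\<lambda>n. L2norm M (\<lambda>x. fs n x - f x)) \<longlonglongrightarrow> 0"
    "(\<lambda>n. L2norm N (\<lambda>\<xi>. fourier1 M (fs n) \<xi> - g \<xi>)) \<longlonglongrightarrow> 0"
    using assms(1) unfolding is_fourier_L2_def by blast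
  obtain fs' where fs': "\<And>n. fs' n \<in> L1 M" "\<And>n. fs' n \<in> L2 M" "(\<lambda>n. L2norm M (\<lambda>x. fs' n x - f' x)) \<longlonglongrightarrow> 0"
    "(\<lambda>n. L2norm N (\<lambda>\<xi>. fourier1 M (fs' n) \<xi> - g' \<xi>)) \<longlonglongrightarrow> 0"
    using assms(2) unfolding is_fourier_L2_def by blast
  have "(\<lambda>n. L2norm M (\<lambda>x. (fs n x + c * fs' n x) - (f x + c * f' x))) \<longlonglongrightarrow> 0"
  proof (rule Lim_null_comparison)
    show "\<forall>\<^sub>F n in sequentially. norm (L2norm M (\<lambda>x. (fs n x + c * fs' n x) - (f x + c * f' x)))
        \<le> L2norm M (\<lambda>x. fs n x - f x) + cmod c * L2norm M (\<lambda>x. fs' n x - f' x)"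
    proof (intro always_eventually allI)
      fix n
      have "L2norm M (\<lambda>x. (fs n x - f x) + c * (fs' n x - f' x)) \<le>
          L2norm M (\<lambda>x. fs n x - f x) + L2norm M (\<lambda>x. c * (fs' n x - f' x))"
        using fs fs' L by (intro L2norm_triangle L2_scale L2_diff)
      moreover have "L2norm M (\<lambda>x. (fs n x + c * fs' n x) - (f x + c * f' x)) =
          L2norm M (\<lambda>x. (fs n x - f x) + c * (fs' n x - f' x))"
        by (rule L2norm_cong) (simp add: algebra_simps)
      ultimately show "norm (L2norm M (\<lambda>x. (fs n x + c * fs' n x) - (f x + c * f' x)))
        \<le> L2norm M (\<lambda>x. fs n x - f x) + cmod c * L2norm M (\<lambda>x. fs' n x - f' x)"
        unfolding L2norm_scale by (simp add: L2norm_nonneg)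
    qed
    show "(\<lambda>n. L2norm M (\<lambda>x. fs n x - f x) + cmod c * L2norm M (\<lambda>x. fs' n x - f' x)) \<longlonglongrightarrow> 0"
      using fs(3) fs'(3) by (auto intro!: tendsto_eq_intros)
  qed
  moreover have "(\<lambda>n. L2norm N (\<lambda>\<xi>. fourier1 M (\<lambda>x. fs n x + c * fs' n x) \<xi> - (g \<xi> + c * g' \<xi>))) \<longlonglongrightarrow> 0"
  proof (rule Lim_null_comparison)
    show "\<forall>\<^sub>F n in sequentially. norm (L2norm N (\<lambda>\<xi>. fourier1 M (\<lambda>x. fs n x + c * fs' n x) \<xi> - (g \<xi> + c * g' \<xi>)))
        \<le> L2norm N (\<lambda>\<xi>. fourier1 M (fs n) \<xi> - g \<xi>) + cmod c * L2norm N (\<lambda>\<xi>. fourier1 M (fs' n) \<xi> - g' \<xi>)"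
    proof (intro always_eventually allI)
      fix n
      have "L2norm N (\<lambda>\<xi>. fourier1 M (\<lambda>x. fs n x + c * fs' n x) \<xi> - (g \<xi> + c * g' \<xi>)) =
          L2norm N (\<lambda>\<xi>. (fourier1 M (fs n) \<xi> - g \<xi>) + c * (fourier1 M (fs' n) \<xi> - g' \<xi>))"
        using fs fs' by (intro L2norm_cong) (simp add: fourier1_add_scale space_N algebra_simps)
      also have "\<dots> \<le> L2norm N (\<lambda>\<xi>. fourier1 M (fs n) \<xi> - g \<xi>) + L2norm N (\<lambda>\<xi>. c * (fourier1 M (fs' n) \<xi> - g' \<xi>))"
        using fs fs' L fourier1_L2 by (intro L2norm_triangle L2_scale L2_diff) auto
      finally show "norm (L2norm N (\<lambda>\<xi>. fourier1 M (\<lambda>x. fs n x + c * fs' n x) \<xi> - (g \<xi> + c * g' \<xi>)))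
        \<le> L2norm N (\<lambda>\<xi>. fourier1 M (fs n) \<xi> - g \<xi>) + cmod c * L2norm N (\<lambda>\<xi>. fourier1 M (fs' n) \<xi> - g' \<xi>)"
        by (simp add: L2norm_scale L2norm_nonneg)
    qed
    show "(\<lambda>n. L2norm N (\<lambda>\<xi>. fourier1 M (fs n) \<xi> - g \<xi>) + cmod c * L2norm N (\<lambda>\<xi>. fourier1 M (fs' n) \<xi> - g' \<xi>)) \<longlonglongrightarrow> 0"
      using fs(4) fs'(4) by (auto intro!: tendsto_eq_intros)
  qed
  moreover have "(\<lambda>x. fs n x + c * fs' n x) \<in> L1 M \<inter> L2 M" for n
    using fs fs' by (auto intro!: L1_add_scale L2_add L2_scale)
  ultimately show ?thesis
    unfolding is_fourier_L2_def
    by (intro conjI L2_add L2_scale L exI[of _ "\<lambda>n x. fs n x + c * fs' n x"] allI)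
qed

lemma is_fourier_L2_fourier1:
  assumes "f \<in> L1 M" "f \<in> L2 M" shows "is_fourier_L2 M N f (fourier1 M f)"
  unfolding is_fourier_L2_def using assms fourier1_L2
  by (auto intro!: exI[of _ "\<lambda>_. f"] simp: L2norm_def)

text \<open>Linear combinations keep their norms under the transform, so by polarization the inner
  products agree after multiplication by \<open>cnj c\<close> and taking real parts;
  \<open>c = 1\<close> and \<open>c = \<i>\<close> yield the real and imaginary parts.\<close>

lemma parseval:
  assumes "is_fourier_L2 M N f g" "is_fourier_L2 M N f' g'"
  shows "(\<integral>x. f x * cnj (f' x) \<partial>M) = (\<integral>\<xi>. g \<xi> * cnj (g' \<xi>) \<partial>N)"
proof -
  note L = is_fourier_L2D[OF assms(1)] is_fourier_L2D[OF assms(2)]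
  have "Re (cnj c * (\<integral>x. f x * cnj (f' x) \<partial>M)) = Re (cnj c * (\<integral>\<xi>. g \<xi> * cnj (g' \<xi>) \<partial>N))" for c
    using L2norm_add_scale_sq[OF L(1,3), of c] L2norm_add_scale_sq[OF L(2,4), of c]
      fourier_L2_norm[OF is_fourier_L2_add_scale[OF assms, of c]] fourier_L2_norm[OF assms(1)]
      fourier_L2_norm[OF assms(2)]
    by simp
  from this[of 1] this[of \<i>] show ?thesis by (intro complex_eqI) auto
qed

lemma fourier_L2_eq_0_iff:
  assumes "is_fourier_L2 M N f g"
  shows "(AE x in M. f x = 0) \<longleftrightarrow> (AE \<xi> in N. g \<xi> = 0)"
  using fourier_L2_norm[OF assms] L2norm_eq_0_iff is_fourier_L2D[OF assms] by metis

subsubsection \<open>Plancherel measure\<close>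

text \<open>If \<xi> stays within 1/4 of 1 on a neighbourhood \<open>V\<close> of 0, the Fourier
  transform of the indicator of \<open>V\<close> has modulus at least 3/4 of the measure of
  \<open>V\<close> at \<xi>. That transform is square-integrable, so such characters form a set of
  finite measure. Continuity at 0 puts every character into one of these sets, and countably many
  \<open>V\<close> suffice.\<close>

lemma sigma_finite_N: "sigma_finite_measure N"
proof -
  obtain \<B> :: "'a set set" where \<B>: "countable \<B>" "\<And>V. V \<in> \<B> \<Longrightarrow> open V"
    "\<And>V. V \<in> \<B> \<Longrightarrow> compact (closure V)"
    "\<And>U x. open U \<Longrightarrow> x \<in> U \<Longrightarrow> \<exists>V\<in>\<B>. x \<in> V \<and> closure V \<subseteq> U"
    by (rule compact_closure_base) blast
  define S where "S V = {\<xi> \<in> dual_group. \<xi> ` closure V \<subseteq> ball 1 (1/4)}" for V :: "'a set"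
  have S: "S V \<in> sets N" if "V \<in> \<B>" for V
    unfolding S_def by (rule sets_N_subbase[OF \<B>(3)[OF that]]) simp
  have fin: "emeasure N (S V) \<noteq> \<infinity>" if V: "V \<in> \<B>" "0 \<in> V" for V
  proof -
    have [measurable]: "V \<in> sets M" using \<B>(2)[OF V(1)] by (simp add: sets_M)
    have mV: "0 < emeasure M V" using emeasure_M_open \<B>(2) V by blast
    have "emeasure M V \<le> emeasure M (closure V)"
      using \<B>(3)[OF V(1)] by (intro emeasure_mono closure_subset compact_imp_sets_M)
    then have fV: "emeasure M V < \<infinity>" using emeasure_M_compact[OF \<B>(3)[OF V(1)]] by (rule le_less_trans)
    define f where "f x = (indicator V x :: complex)" for x
    have f2: "f \<in> L2 M" unfolding f_def using fV by (intro indicator_L2) auto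
    have f1: "f \<in> L1 M" using integrable_L2_mult[OF f2 f2]
      by (simp add: f_def[abs_def] L1_def flip: indicator_inter_arith)
    define m where "m = measure M V"
    have m: "0 < m" using mV fV by (simp add: m_def measure_def enn2real_positive_iff)
    have big: "3/4 * m \<le> cmod (fourier1 M f \<xi>)" if \<xi>: "\<xi> \<in> S V" for \<xi>
    proof -
      have d: "\<xi> \<in> dual_group" using \<xi> by (simp add: S_def)
      have i: "integrable M (\<lambda>x. f x * cnj (\<xi> x))" by (rule integrable_mult_character[OF f1 d])
      have "3/4 * m = (\<integral>x. 3/4 * indicator V x \<partial>M)" using fV by (simp add: m_def)
      also have "\<dots> \<le> (\<integral>x. Re (f x * cnj (\<xi> x)) \<partial>M)"
      proof (rule integral_mono)
        show "3/4 * indicator V x \<le> Re (f x * cnj (\<xi> x))" for x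
        proof (cases "x \<in> V")
          case True
          then have "\<xi> x \<in> ball 1 (1/4)" using \<xi> closure_subset[of V] unfolding S_def by blast
          then have "cmod (1 - \<xi> x) < 1/4" by (simp add: dist_norm)
          then have "Re (1 - \<xi> x) < 1/4" using complex_Re_le_cmod[of "1 - \<xi> x"] by linarith
          then show ?thesis using True by (simp add: f_def)
        qed (simp add: f_def)
      qed (use fV integrable_Re[OF i] in simp_all)
      also have "\<dots> = Re (fourier1 M f \<xi>)" unfolding fourier1_def using i by (rule integral_Re)
      also have "\<dots> \<le> cmod (fourier1 M f \<xi>)" by (rule complex_Re_le_cmod)
      finally show ?thesis .
    qed
    have F: "fourier1 M f \<in> L2 N" by (rule fourier1_L2[OF f1 f2])
    have "ennreal ((3/4 * m)\<^sup>2) * emeasure N (S V) = (\<integral>\<^sup>+\<xi>. ennreal ((3/4 * m)\<^sup>2) * indicator (S V) \<xi> \<partial>N)"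
      using S[OF V(1)] by (simp add: nn_integral_cmult_indicator)
    also have "\<dots> \<le> (\<integral>\<^sup>+\<xi>. ennreal ((cmod (fourier1 M f \<xi>))\<^sup>2) \<partial>N)"
      using big m by (intro nn_integral_mono) (auto simp: indicator_def intro!: ennreal_leI power_mono)
    also have "\<dots> < \<infinity>" using F L2_iff_nn_integral[of "fourier1 M f" N] by (simp add: L2_def)
    finally show ?thesis using m by (auto simp: ennreal_mult_less_top)
  qed
  show ?thesis
  proof
    show "\<exists>A. countable A \<and> A \<subseteq> sets N \<and> \<Union>A = space N \<and> (\<forall>a\<in>A. emeasure N a \<noteq> \<infinity>)"
    proof (intro exI[of _ "S ` {V \<in> \<B>. 0 \<in> V}"] conjI ballI)
      show "\<Union>(S ` {V \<in> \<B>. 0 \<in> V}) = space N"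
      proof (intro antisym subsetI)
        fix \<xi> assume "\<xi> \<in> space N"
        then have \<xi>: "is_character \<xi>" "\<xi> \<in> dual_group" by (auto simp: space_N dual_group_iff)
        have "open (\<xi> -` ball 1 (1/4))" using is_characterD(1)[OF \<xi>(1)] by (intro open_vimage) auto
        then obtain V where "V \<in> \<B>" "0 \<in> V" "closure V \<subseteq> \<xi> -` ball 1 (1/4)"
          using \<B>(4)[of "\<xi> -` ball 1 (1/4)" 0] is_character_0[OF \<xi>(1)] by auto
        then show "\<xi> \<in> \<Union>(S ` {V \<in> \<B>. 0 \<in> V})" using \<xi>(2) unfolding S_def by blast
      qed (auto simp: S_def space_N)
    qed (use \<B>(1) S fin in auto)
  qed
qed

section \<open>Translations of the dual group\<close>

definition char_mult :: "('a \<Rightarrow> complex) \<Rightarrow> ('a \<Rightarrow> complex) \<Rightarrow> 'a \<Rightarrow> complex" where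
  "char_mult \<eta> \<xi> = (\<lambda>x. \<eta> x * \<xi> x)"

lemma char_mult_dual: "\<eta> \<in> dual_group \<Longrightarrow> \<xi> \<in> dual_group \<Longrightarrow> char_mult \<eta> \<xi> \<in> dual_group"
  by (auto simp: dual_group_iff is_character_def char_mult_def norm_mult intro!: continuous_intros)

lemma char_cnj_dual: "\<eta> \<in> dual_group \<Longrightarrow> cnj \<circ> \<eta> \<in> dual_group"
  by (auto simp: dual_group_iff is_character_def intro!: continuous_intros)

lemma cnj_char_mult [simp]: "\<xi> \<in> dual_group \<Longrightarrow> cnj (\<xi> x) * (\<xi> x * z) = z" "\<xi> \<in> dual_group \<Longrightarrow> \<xi> x * (cnj (\<xi> x) * z) = z"
  using cnj_eq_inverse_unimodular[OF cmod_dual, of \<xi> x]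
  by (simp_all add: mult.assoc[symmetric] mult.commute[of "cnj (\<xi> x)"])

lemma measurable_char_mult: "(\<lambda>(\<eta>, \<xi>). char_mult \<eta> \<xi>) \<in> N \<Otimes>\<^sub>M N \<rightarrow>\<^sub>M N"
proof (rule measurable_dualI)
  show "(case p of (\<eta>, \<xi>) \<Rightarrow> char_mult \<eta> \<xi>) \<in> dual_group" if "p \<in> space (N \<Otimes>\<^sub>M N)" for p
    using that by (auto simp: space_pair_measure space_N char_mult_dual)
  show "(\<lambda>p. (case p of (\<eta>, \<xi>) \<Rightarrow> char_mult \<eta> \<xi>) (dense_seq k)) \<in> borel_measurable (N \<Otimes>\<^sub>M N)" for k
    by (simp add: char_mult_def split_def)
qed

lemma measurable_char_mult': "\<eta> \<in> dual_group \<Longrightarrow> char_mult \<eta> \<in> N \<rightarrow>\<^sub>M N"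
  using measurable_compose[OF measurable_Pair1' measurable_char_mult, of \<eta>] by (simp add: space_N)

lemma measurable_char_cnj: "(\<lambda>\<xi>. cnj \<circ> \<xi>) \<in> N \<rightarrow>\<^sub>M N"
  by (rule measurable_dualI) (auto simp: space_N intro: char_cnj_dual)

lemma distr_char_mult_N:
  assumes \<eta>: "\<eta> \<in> dual_group" shows "distr N N (char_mult \<eta>) = N"
proof (rule distr_eqI_invariant[where g = "\<lambda>\<xi> x. (cnj \<circ> \<eta>) x * \<xi> x"])
  show "char_mult \<eta> -` B \<inter> space N = (\<lambda>\<xi> x. (cnj \<circ> \<eta>) x * \<xi> x) ` B" if B: "B \<in> sets N" for B
  proof (intro antisym subsetI)
    fix \<xi> assume "\<xi> \<in> char_mult \<eta> -` B \<inter> space N"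
    then show "\<xi> \<in> (\<lambda>\<xi> x. (cnj \<circ> \<eta>) x * \<xi> x) ` B"
      using \<eta> by (intro image_eqI[of _ _ "char_mult \<eta> \<xi>"]) (auto simp: char_mult_def)
  next
    fix \<xi> assume "\<xi> \<in> (\<lambda>\<xi> x. (cnj \<circ> \<eta>) x * \<xi> x) ` B"
    then obtain \<zeta> where z: "\<zeta> \<in> B" "\<xi> = char_mult (cnj \<circ> \<eta>) \<zeta>" unfolding char_mult_def by auto
    have "\<zeta> \<in> dual_group" using z(1) sets.sets_into_space[OF B] space_N by auto
    then have "\<xi> \<in> dual_group" using z(2) char_mult_dual[OF char_cnj_dual[OF \<eta>]] by simp
    moreover have "char_mult \<eta> \<xi> = \<zeta>" using \<eta> z(2) by (auto simp: char_mult_def)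
    ultimately show "\<xi> \<in> char_mult \<eta> -` B \<inter> space N" using z(1) by (simp add: space_N)
  qed
  show "emeasure N ((\<lambda>\<xi> x. (cnj \<circ> \<eta>) x * \<xi> x) ` B) = emeasure N B" if "B \<in> sets N" for B
    using plancherel char_cnj_dual[OF \<eta>] that unfolding plancherel_measure_def by blast
qed (rule measurable_char_mult'[OF \<eta>])

end

lemma L2norm_eqI:
  assumes "f \<in> borel_measurable N" "g \<in> borel_measurable N'"
    "(\<integral>\<^sup>+x. ennreal ((cmod (f x))\<^sup>2) \<partial>N) = (\<integral>\<^sup>+x. ennreal ((cmod (g x))\<^sup>2) \<partial>N')"
  shows "L2norm N f = L2norm N' g"
  unfolding L2norm_def using assms by (simp add: integral_eq_nn_integral)

context quasi_regular_setup
begin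

section \<open>Automorphisms under the Fourier transform\<close>

lemma measurable_comp_inv: "f \<in> borel_measurable M \<Longrightarrow> h \<in> Hs \<Longrightarrow> (\<lambda>x. f (inv h x)) \<in> borel_measurable M"
  by (rule measurable_compose[OF measurable_M_inv])

lemma comp_inv_L1: "f \<in> L1 M \<Longrightarrow> h \<in> Hs \<Longrightarrow> (\<lambda>x. f (inv h x)) \<in> L1 M"
  using measurable_comp_inv[of f h] nn_integral_scale_M[of h "\<lambda>x. ennreal (norm (f x))"]
  by (auto simp: L1_def integrable_iff_bounded ennreal_mult_less_top)

lemma nn_integral_comp_inv_sq:
  assumes [measurable]: "f \<in> borel_measurable M" and h: "h \<in> Hs"
  shows "(\<integral>\<^sup>+x. ennreal ((cmod (f (inv h x)))\<^sup>2) \<partial>M)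
    = ennreal (delta M h) * (\<integral>\<^sup>+x. ennreal ((cmod (f x))\<^sup>2) \<partial>M)"
  by (rule nn_integral_scale_M[OF h]) measurable

lemma comp_inv_L2:
  assumes "f \<in> L2 M" "h \<in> Hs" shows "(\<lambda>x. f (inv h x)) \<in> L2 M"
proof -
  have m: "f \<in> borel_measurable M" using assms by (simp add: L2_def)
  show ?thesis
    using assms nn_integral_comp_inv_sq[OF m assms(2)] L2_iff_nn_integral[OF m]
      L2_iff_nn_integral[OF measurable_comp_inv[OF m assms(2)]]
    by (simp add: ennreal_mult_less_top)
qed

lemma fourier1_comp:
  assumes f: "f \<in> L1 M" and h: "h \<in> Hs" and \<xi>: "\<xi> \<in> dual_group"
  shows "fourier1 M (\<lambda>x. f (inv h x)) \<xi> = delta M h * fourier1 M f (\<xi> \<circ> h)"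
proof -
  have "(\<lambda>x. f x * cnj ((\<xi> \<circ> h) x)) \<in> borel_measurable M"
    using integrable_mult_character[OF f dual_comp[OF \<xi> h]] by (rule borel_measurable_integrable)
  from integral_scale_M[OF h this] show ?thesis using h by (simp add: fourier1_def)
qed

lemma measurable_comp_right: "h \<in> Hs \<Longrightarrow> (\<lambda>\<xi>. \<xi> \<circ> h) \<in> N \<rightarrow>\<^sub>M N"
  by (rule measurable_dual_comp) (auto simp: space_MH)

text \<open>The right action of \<open>h\<close> multiplies the measure of sets in the dual by the
  same factor as \<open>h\<close> does on the group. Composition with \<open>h\<close> commutes with
  translations up to a change of the translating character, so the image \<nu> of \<open>N\<close>
  is invariant and thus proportional to \<open>N\<close>. A single test function determines the
  factor.\<close>

lemma nn_integral_dual_scale: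
  assumes h: "h \<in> Hs" and F: "F \<in> borel_measurable N"
  shows "ennreal (delta M h) * (\<integral>\<^sup>+\<xi>. F (\<xi> \<circ> h) \<partial>N) = (\<integral>\<^sup>+\<xi>. F \<xi> \<partial>N)"
proof -
  interpret N: sigma_finite_measure N by (rule sigma_finite_N)
  note mh[measurable] = measurable_comp_right[OF h] measurable_comp_right[OF Hs_inv[OF h]]
  define \<nu> where "\<nu> = distr N N (\<lambda>\<xi>. \<xi> \<circ> h)"
  have sets_\<nu>: "sets \<nu> = sets N" by (simp add: \<nu>_def)
  have int_\<nu>: "(\<integral>\<^sup>+\<xi>. g \<xi> \<partial>\<nu>) = (\<integral>\<^sup>+\<xi>. g (\<xi> \<circ> h) \<partial>N)" if "g \<in> borel_measurable N" for g
    unfolding \<nu>_def by (rule nn_integral_distr) (use that in simp_all)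
  have hinv: "(\<xi> \<circ> h) \<circ> inv h = \<xi>" "(\<xi> \<circ> inv h) \<circ> h = \<xi>" for \<xi> :: "'a \<Rightarrow> complex"
    using h by (auto simp: fun_eq_iff)
  have "sigma_finite_measure \<nu>"
  proof
    obtain A :: "nat \<Rightarrow> ('a \<Rightarrow> complex) set" where A: "range A \<subseteq> sets N" "(\<Union>i. A i) = space N"
      "\<And>i. emeasure N (A i) \<noteq> \<infinity>" by (rule N.sigma_finite) blast
    have [measurable]: "A i \<in> sets N" for i using A(1) by auto
    define B where "B i = (\<lambda>\<xi>. \<xi> \<circ> inv h) -` A i \<inter> space N" for i
    have B: "B i \<in> sets N" for i unfolding B_def by measurable
    have "emeasure \<nu> (B i) = emeasure N (A i)" for i
    proof -
      have "(\<lambda>\<xi>. \<xi> \<circ> h) -` B i \<inter> space N = A i"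
        using A(2) dual_comp[OF _ h] by (auto simp: B_def hinv space_N)
      then show ?thesis unfolding \<nu>_def using B by (simp add: emeasure_distr)
    qed
    moreover have "(\<Union>i. B i) = space N"
      using A(2) measurable_space[OF mh(2)] by (auto simp: B_def) blast
    ultimately show "\<exists>B. countable B \<and> B \<subseteq> sets \<nu> \<and> \<Union>B = space \<nu> \<and> (\<forall>b\<in>B. emeasure \<nu> b \<noteq> \<infinity>)"
      using A(3) B by (intro exI[of _ "range B"]) (auto simp: sets_\<nu> sets_eq_imp_space_eq[OF sets_\<nu>])
  qed
  have inv\<nu>: "distr \<nu> \<nu> (char_mult \<eta>) = \<nu>" if \<eta>: "\<eta> \<in> dual_group" for \<eta>
  proof -
    have \<eta>': "\<eta> \<circ> inv h \<in> dual_group" by (rule dual_comp[OF \<eta> Hs_inv[OF h]])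
    note [measurable] = measurable_char_mult'[OF \<eta>] measurable_char_mult'[OF \<eta>']
    have "distr \<nu> \<nu> (char_mult \<eta>) = distr \<nu> N (char_mult \<eta>)"
      by (rule distr_cong) (simp_all add: sets_\<nu>)
    also have "\<dots> = distr N N (char_mult \<eta> \<circ> (\<lambda>\<xi>. \<xi> \<circ> h))"
      unfolding \<nu>_def by (rule distr_distr) measurable
    also have "char_mult \<eta> \<circ> (\<lambda>\<xi>. \<xi> \<circ> h) = (\<lambda>\<xi>. \<xi> \<circ> h) \<circ> char_mult (\<eta> \<circ> inv h)"
      using h by (auto simp: fun_eq_iff char_mult_def)
    also have "distr N N ((\<lambda>\<xi>. \<xi> \<circ> h) \<circ> char_mult (\<eta> \<circ> inv h)) = distr (distr N N (char_mult (\<eta> \<circ> inv h))) N (\<lambda>\<xi>. \<xi> \<circ> h)"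
      by (rule distr_distr[symmetric]) measurable
    finally show ?thesis by (simp add: distr_char_mult_N[OF \<eta>'] \<nu>_def)
  qed
  have uniq: "(\<integral>\<^sup>+x. f x \<partial>N) * (\<integral>\<^sup>+x. g x \<partial>\<nu>) = (\<integral>\<^sup>+x. f x \<partial>\<nu>) * (\<integral>\<^sup>+x. g x \<partial>N)"
    if "f \<in> borel_measurable N" "g \<in> borel_measurable N" for f g
  proof (rule invariant_measure_unique[OF sigma_finite_N \<open>sigma_finite_measure \<nu>\<close> sets_\<nu> measurable_char_mult measurable_char_cnj])
    show "char_mult (char_mult (cnj \<circ> x) y) x = y" if "x \<in> space N" "y \<in> space N" for x y
    proof -
      have "cnj (x t) * y t * x t = cnj (x t) * (x t * y t)" for t by (simp add: mult_ac)
      then have "cnj (x t) * y t * x t = y t" for t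
        using that cnj_char_mult(1)[of x t "y t"] by (simp only: space_N)
      then show ?thesis by (simp add: char_mult_def fun_eq_iff)
    qed
    show "cnj \<circ> char_mult (cnj \<circ> y) x = char_mult (cnj \<circ> x) y" if "x \<in> space N" "y \<in> space N" for x y
      by (auto simp: char_mult_def fun_eq_iff)
  qed (use that inv\<nu> distr_char_mult_N in \<open>auto simp: space_N\<close>)
  obtain K where K: "compact K" "interior K \<noteq> {}" "0 < emeasure M K" "emeasure M K < \<infinity>" "K \<in> sets M"
    by (rule compact_pos_M)
  define f where "f x = (indicator K x :: complex)" for x
  have f2: "f \<in> L2 M" unfolding f_def using K by (intro indicator_L2)
  have f1: "f \<in> L1 M" using integrable_L2_mult[OF f2 f2]
    by (simp add: f_def[abs_def] L1_def flip: indicator_inter_arith)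
  have fm: "f \<in> borel_measurable M" using f2 by (simp add: L2_def)
  \<comment> \<open>The squared modulus of the transform of the indicator of \<open>K\<close>. By
    the isometry its integral is the measure of \<open>K\<close>, which is positive and
    finite.\<close>
  define F0 where "F0 \<xi> = ennreal ((cmod (fourier1 M f \<xi>))\<^sup>2)" for \<xi>
  have F1[measurable]: "fourier1 M f \<in> borel_measurable N" using fourier1_L2[OF f1 f2] by (simp add: L2_def)
  have F0m: "F0 \<in> borel_measurable N" unfolding F0_def by measurable
  define d where "d = ennreal (delta M h)"
  have dpos: "0 < delta M h" by (rule emeasure_image_scale(1)[OF h])
  have d0: "d \<noteq> 0" "d \<noteq> \<infinity>" using dpos by (auto simp: d_def)
  have pl: "(\<integral>\<^sup>+\<xi>. ennreal ((cmod (fourier1 M u \<xi>))\<^sup>2) \<partial>N) = (\<integral>\<^sup>+x. ennreal ((cmod (u x))\<^sup>2) \<partial>M)"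
    if "u \<in> L1 M" "u \<in> L2 M" for u
    using ennreal_L2norm_sq[OF that(2)] ennreal_L2norm_sq[OF fourier1_L2[OF that]] L2norm_fourier1[OF that]
      by simp
  define c where "c = (\<integral>\<^sup>+\<xi>. F0 \<xi> \<partial>N)"
  have "c = (\<integral>\<^sup>+x. ennreal ((cmod (f x))\<^sup>2) \<partial>M)" unfolding c_def F0_def by (rule pl[OF f1 f2])
  also have "\<dots> = (\<integral>\<^sup>+x. indicator K x \<partial>M)" by (intro nn_integral_cong) (simp add: f_def indicator_def)
  also have "\<dots> = emeasure M K" using K by simp
  finally have c: "c = emeasure M K" .
  \<comment> \<open>The transform of a dilated function carries one factor \<open>d\<close>, hence
    two after squaring, while its squared norm on the group side grows by \<open>d\<close> only. One
    factor is left over.\<close>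
  have "d * (d * (\<integral>\<^sup>+\<xi>. F0 \<xi> \<partial>\<nu>)) = (\<integral>\<^sup>+\<xi>. d * (d * F0 (\<xi> \<circ> h)) \<partial>N)"
    using F0m by (simp add: int_\<nu>[OF F0m] nn_integral_cmult)
  also have "\<dots> = (\<integral>\<^sup>+\<xi>. ennreal ((cmod (fourier1 M (\<lambda>x. f (inv h x)) \<xi>))\<^sup>2) \<partial>N)"
  proof (rule nn_integral_cong)
    fix \<xi> assume "\<xi> \<in> space N"
    then have "\<xi> \<in> dual_group" by (simp add: space_N)
    from fourier1_comp[OF f1 h this] show "d * (d * F0 (\<xi> \<circ> h)) = ennreal ((cmod (fourier1 M (\<lambda>x. f (inv h x)) \<xi>))\<^sup>2)"
      using dpos
        by (simp add: F0_def d_def norm_mult power_mult_distrib ennreal_mult power2_eq_square mult_ac)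
  qed
  also have "\<dots> = (\<integral>\<^sup>+x. ennreal ((cmod (f (inv h x)))\<^sup>2) \<partial>M)"
    by (rule pl[OF comp_inv_L1[OF f1 h] comp_inv_L2[OF f2 h]])
  also have "\<dots> = d * c"
    unfolding nn_integral_comp_inv_sq[OF fm h] d_def c_def F0_def pl[OF f1 f2] ..
  finally have e: "d * (\<integral>\<^sup>+\<xi>. F0 \<xi> \<partial>\<nu>) = c" using d0 by (simp add: ennreal_mult_cancel_left)
  have "c * (d * (\<integral>\<^sup>+\<xi>. F \<xi> \<partial>\<nu>)) = d * (\<integral>\<^sup>+\<xi>. F0 \<xi> \<partial>\<nu>) * (\<integral>\<^sup>+\<xi>. F \<xi> \<partial>N)"
    using uniq[OF F0m F] unfolding c_def by (simp add: mult_ac)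
  then have "c * (d * (\<integral>\<^sup>+\<xi>. F \<xi> \<partial>\<nu>)) = c * (\<integral>\<^sup>+\<xi>. F \<xi> \<partial>N)" by (simp add: e)
  then have "d * (\<integral>\<^sup>+\<xi>. F \<xi> \<partial>\<nu>) = (\<integral>\<^sup>+\<xi>. F \<xi> \<partial>N)"
    using K by (auto simp: ennreal_mult_cancel_left c)
  then show ?thesis by (simp add: int_\<nu>[OF F] d_def)
qed

lemma comp_right_L2:
  assumes p: "p \<in> L2 N" and h: "h \<in> Hs" shows "(\<lambda>\<xi>. p (\<xi> \<circ> h)) \<in> L2 N"
proof -
  have [measurable]: "p \<in> borel_measurable N" using p by (simp add: L2_def)
  have m: "(\<lambda>\<xi>. p (\<xi> \<circ> h)) \<in> borel_measurable N"
    by (rule measurable_compose[OF measurable_comp_right[OF h]]) measurable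
  have "ennreal (delta M h) * (\<integral>\<^sup>+\<xi>. ennreal ((cmod (p (\<xi> \<circ> h)))\<^sup>2) \<partial>N) = (\<integral>\<^sup>+\<xi>. ennreal ((cmod (p \<xi>))\<^sup>2) \<partial>N)"
    by (rule nn_integral_dual_scale[OF h]) measurable
  also have "\<dots> < \<infinity>" using p L2_iff_nn_integral[of p N] by simp
  finally have "(\<integral>\<^sup>+\<xi>. ennreal ((cmod (p (\<xi> \<circ> h)))\<^sup>2) \<partial>N) < \<infinity>"
    using emeasure_image_scale(1)[OF h] by (auto simp: ennreal_mult_less_top)
  then show ?thesis using L2_iff_nn_integral[OF m] by simp
qed

subsubsection \<open>The quasi-regular representation on the Fourier side\<close>

lemma quasi_regular_measurable:
  assumes "f \<in> borel_measurable M" "h \<in> Hs" shows "quasi_regular M a h f \<in> borel_measurable M"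
proof -
  have "(\<lambda>t. f (inv h (- a + t))) \<in> borel_measurable M"
    by (rule measurable_compose[OF measurable_translate_M measurable_comp_inv[OF assms]])
  then show ?thesis unfolding quasi_regular_def[abs_def] by simp
qed

lemma delta_powr_sq:
  assumes "h \<in> Hs"
  shows "(cmod (complex_of_real (delta M h powr (-1/2))))\<^sup>2 = 1 / delta M h"
    "(cmod (complex_of_real (delta M h powr (1/2))))\<^sup>2 = delta M h"
    "delta M h powr (-1/2) * delta M h = delta M h powr (1/2)"
proof -
  have d: "0 < delta M h" by (rule emeasure_image_scale(1)[OF assms])
  show "(cmod (complex_of_real (delta M h powr (1/2))))\<^sup>2 = delta M h"
    using d by (simp add: powr_half_sqrt)
  show "(cmod (complex_of_real (delta M h powr (-1/2))))\<^sup>2 = 1 / delta M h"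
    using d by (simp add: powr_minus powr_half_sqrt power_divide inverse_eq_divide norm_divide)
  show "delta M h powr (-1/2) * delta M h = delta M h powr (1/2)"
    using d powr_add[of "delta M h" "-1/2" 1] by simp
qed

lemma nn_integral_quasi_regular_sq:
  assumes f: "f \<in> borel_measurable M" and h: "h \<in> Hs"
  shows "(\<integral>\<^sup>+t. ennreal ((cmod (quasi_regular M a h f t))\<^sup>2) \<partial>M) = (\<integral>\<^sup>+t. ennreal ((cmod (f t))\<^sup>2) \<partial>M)"
proof -
  have d: "0 < delta M h" by (rule emeasure_image_scale(1)[OF h])
  note [measurable] = f measurable_comp_inv[OF f h]
  have m: "(\<lambda>t. ennreal (1 / delta M h) * ennreal ((cmod (f (inv h t)))\<^sup>2)) \<in> borel_measurable M"
    by measurable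
  have "(\<integral>\<^sup>+t. ennreal ((cmod (quasi_regular M a h f t))\<^sup>2) \<partial>M)
      = (\<integral>\<^sup>+t. ennreal (1 / delta M h) * ennreal ((cmod (f (inv h (- a + t))))\<^sup>2) \<partial>M)"
    unfolding quasi_regular_def norm_mult power_mult_distrib delta_powr_sq[OF h]
    using d by (simp add: ennreal_mult[symmetric])
  also have "\<dots> = (\<integral>\<^sup>+t. ennreal (1 / delta M h) * ennreal ((cmod (f (inv h t)))\<^sup>2) \<partial>M)"
    by (rule nn_integral_translate_M[OF m])
  also have "\<dots> = ennreal (1 / delta M h) * (ennreal (delta M h) * (\<integral>\<^sup>+t. ennreal ((cmod (f t))\<^sup>2) \<partial>M))"
    by (simp add: nn_integral_cmult nn_integral_comp_inv_sq[OF f h])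
  also have "\<dots> = (\<integral>\<^sup>+t. ennreal ((cmod (f t))\<^sup>2) \<partial>M)"
    using d by (simp add: mult.assoc[symmetric] ennreal_mult[symmetric])
  finally show ?thesis .
qed

lemma quasi_regular_L2:
  assumes "f \<in> L2 M" "h \<in> Hs" shows "quasi_regular M a h f \<in> L2 M"
proof -
  have m: "f \<in> borel_measurable M" using assms by (simp add: L2_def)
  show ?thesis
    using assms(1) L2_iff_nn_integral[OF m] L2_iff_nn_integral[OF quasi_regular_measurable[OF m assms(2)]]
    by (simp add: nn_integral_quasi_regular_sq[OF m assms(2)])
qed

lemma quasi_regular_L1:
  assumes "f \<in> L1 M" "h \<in> Hs" shows "quasi_regular M a h f \<in> L1 M"
proof -
  have i: "integrable M (\<lambda>x. f (inv h x))" using comp_inv_L1[OF assms] by (simp add: L1_def)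
  then have "integrable (distr M M (\<lambda>x. - a + x)) (\<lambda>x. f (inv h x))" by (simp only: distr_translate_M)
  then have "integrable M (\<lambda>x. f (inv h (- a + x)))" by (rule integrable_distr[OF measurable_translate_M])
  then show ?thesis unfolding L1_def quasi_regular_def[abs_def] by simp
qed

text \<open>The operator \<open>quasi_regular\<close> conjugated by the Plancherel transform: the
  translation becomes multiplication by a character value, and the dilation becomes composition with
  \<open>h\<close> with the opposite exponent of the modulus.\<close>

definition dual_quasi_regular :: "'a \<Rightarrow> ('a \<Rightarrow> 'a) \<Rightarrow> (('a \<Rightarrow> complex) \<Rightarrow> complex) \<Rightarrow> ('a \<Rightarrow> complex) \<Rightarrow> complex" where
  "dual_quasi_regular a h p \<xi> = complex_of_real (delta M h powr (1/2)) * cnj (\<xi> a) * p (\<xi> \<circ> h)"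

lemma fourier1_quasi_regular:
  assumes f: "f \<in> L1 M" and h: "h \<in> Hs" and \<xi>: "\<xi> \<in> dual_group"
  shows "fourier1 M (quasi_regular M a h f) \<xi> = dual_quasi_regular a h (fourier1 M f) \<xi>"
proof -
  have ch: "is_character \<xi>" using \<xi> by (simp add: dual_group_iff)
  have m: "(\<lambda>t. quasi_regular M a h f t * cnj (\<xi> t)) \<in> borel_measurable M"
    using integrable_mult_character[OF quasi_regular_L1[OF f h] \<xi>] by (rule borel_measurable_integrable)
  have "fourier1 M (quasi_regular M a h f) \<xi> = (\<integral>t. quasi_regular M a h f (a + t) * cnj (\<xi> (a + t)) \<partial>M)"
    unfolding fourier1_def using integral_translate_M[OF m, of a] by simp
  also have "\<dots> = (\<integral>t. complex_of_real (delta M h powr (-1/2)) * cnj (\<xi> a) * (f (inv h t) * cnj (\<xi> t)) \<partial>M)"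
    by (intro Bochner_Integration.integral_cong) (simp_all add: quasi_regular_def is_characterD(2)[OF ch] mult_ac)
  also have "\<dots> = complex_of_real (delta M h powr (-1/2)) * cnj (\<xi> a) * fourier1 M (\<lambda>x. f (inv h x)) \<xi>"
    unfolding fourier1_def by simp
  also have "\<dots> = complex_of_real (delta M h powr (-1/2) * delta M h) * cnj (\<xi> a) * fourier1 M f (\<xi> \<circ> h)"
    by (simp add: fourier1_comp[OF f h \<xi>] mult_ac)
  finally show ?thesis unfolding delta_powr_sq(3)[OF h] dual_quasi_regular_def .
qed

lemma measurable_eval_at: "(\<lambda>\<xi>. \<xi> a) \<in> borel_measurable N"
  by (rule measurable_eval_compose) auto

lemma dual_quasi_regular_measurable:
  assumes "p \<in> borel_measurable N" "h \<in> Hs"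
  shows "dual_quasi_regular a h p \<in> borel_measurable N"
proof -
  note [measurable] = measurable_compose[OF measurable_comp_right[OF assms(2)] assms(1)] measurable_eval_at
  show ?thesis unfolding dual_quasi_regular_def[abs_def] by measurable
qed

lemma nn_integral_dual_quasi_regular_sq:
  assumes p: "p \<in> borel_measurable N" and h: "h \<in> Hs"
  shows "(\<integral>\<^sup>+\<xi>. ennreal ((cmod (dual_quasi_regular a h p \<xi>))\<^sup>2) \<partial>N) = (\<integral>\<^sup>+\<xi>. ennreal ((cmod (p \<xi>))\<^sup>2) \<partial>N)"
proof -
  have d: "0 < delta M h" by (rule emeasure_image_scale(1)[OF h])
  note [measurable] = p measurable_compose[OF measurable_comp_right[OF h] p]
  have "(\<integral>\<^sup>+\<xi>. ennreal ((cmod (dual_quasi_regular a h p \<xi>))\<^sup>2) \<partial>N) =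
      (\<integral>\<^sup>+\<xi>. ennreal (delta M h) * ennreal ((cmod (p (\<xi> \<circ> h)))\<^sup>2) \<partial>N)"
  proof (rule nn_integral_cong)
    fix \<xi> assume "\<xi> \<in> space N"
    then have "cmod (\<xi> a) = 1" by (simp add: space_N cmod_dual)
    then show "ennreal ((cmod (dual_quasi_regular a h p \<xi>))\<^sup>2) = ennreal (delta M h) * ennreal ((cmod (p (\<xi> \<circ> h)))\<^sup>2)"
      unfolding dual_quasi_regular_def norm_mult power_mult_distrib delta_powr_sq[OF h]
      using d by (simp add: ennreal_mult)
  qed
  also have "\<dots> = ennreal (delta M h) * (\<integral>\<^sup>+\<xi>. ennreal ((cmod (p (\<xi> \<circ> h)))\<^sup>2) \<partial>N)"
    by (rule nn_integral_cmult) measurable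
  also have "\<dots> = (\<integral>\<^sup>+\<xi>. ennreal ((cmod (p \<xi>))\<^sup>2) \<partial>N)"
    by (rule nn_integral_dual_scale[OF h]) measurable
  finally show ?thesis .
qed

lemma dual_quasi_regular_L2:
  assumes "p \<in> L2 N" "h \<in> Hs" shows "dual_quasi_regular a h p \<in> L2 N"
proof -
  have m: "p \<in> borel_measurable N" using assms by (simp add: L2_def)
  show ?thesis
    using assms(1) L2_iff_nn_integral[OF m] L2_iff_nn_integral[OF dual_quasi_regular_measurable[OF m assms(2)]]
    by (simp add: nn_integral_dual_quasi_regular_sq[OF m assms(2)])
qed

text \<open>The identity holds for integrable functions by direct computation. Both operators are
  isometries, so an approximating sequence for \<psi> is carried to one for its image with unchanged
  errors.\<close>

lemma is_fourier_L2_quasi_regular: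
  assumes \<psi>: "is_fourier_L2 M N \<psi> p" and h: "h \<in> Hs"
  shows "is_fourier_L2 M N (quasi_regular M a h \<psi>) (dual_quasi_regular a h p)"
proof -
  note L = is_fourier_L2D[OF \<psi>]
  obtain fs where fs: "\<And>n. fs n \<in> L1 M" "\<And>n. fs n \<in> L2 M" "(\<lambda>n. L2norm M (\<lambda>x. fs n x - \<psi> x)) \<longlonglongrightarrow> 0"
    "(\<lambda>n. L2norm N (\<lambda>\<xi>. fourier1 M (fs n) \<xi> - p \<xi>)) \<longlonglongrightarrow> 0"
    using \<psi> unfolding is_fourier_L2_def by blast
  have d1: "(\<lambda>x. fs n x - \<psi> x) \<in> borel_measurable M" for n using L2_diff[OF fs(2) L(1)] by (simp add: L2_def)
  have d2: "(\<lambda>\<xi>. fourier1 M (fs n) \<xi> - p \<xi>) \<in> borel_measurable N" for n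
    using L2_diff[OF fourier1_L2[OF fs(1,2)] L(2)] by (simp add: L2_def)
  have e1: "L2norm M (\<lambda>x. quasi_regular M a h (fs n) x - quasi_regular M a h \<psi> x) = L2norm M (\<lambda>x. fs n x - \<psi> x)" for n
  proof -
    have "(\<lambda>x. quasi_regular M a h (fs n) x - quasi_regular M a h \<psi> x) = quasi_regular M a h (\<lambda>x. fs n x - \<psi> x)"
      by (simp add: quasi_regular_def fun_eq_iff algebra_simps)
    then show ?thesis
      using L2norm_eqI[OF quasi_regular_measurable[OF d1 h] d1 nn_integral_quasi_regular_sq[OF d1 h]] by simp
  qed
  have e2: "L2norm N (\<lambda>\<xi>. fourier1 M (quasi_regular M a h (fs n)) \<xi> - dual_quasi_regular a h p \<xi>) =
      L2norm N (\<lambda>\<xi>. fourier1 M (fs n) \<xi> - p \<xi>)" for n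
  proof -
    have "L2norm N (\<lambda>\<xi>. fourier1 M (quasi_regular M a h (fs n)) \<xi> - dual_quasi_regular a h p \<xi>) =
        L2norm N (dual_quasi_regular a h (\<lambda>\<xi>. fourier1 M (fs n) \<xi> - p \<xi>))"
      by (rule L2norm_cong) (simp add: fourier1_quasi_regular[OF fs(1) h] space_N, simp add: dual_quasi_regular_def algebra_simps)
    then show ?thesis
      using L2norm_eqI[OF dual_quasi_regular_measurable[OF d2 h] d2 nn_integral_dual_quasi_regular_sq[OF d2 h]]
        by simp
  qed
  show ?thesis unfolding is_fourier_L2_def
    using fs quasi_regular_L2[OF L(1) h] dual_quasi_regular_L2[OF L(2) h] quasi_regular_L1[OF fs(1) h] quasi_regular_L2[OF fs(2) h]
    by (intro conjI exI[of _ "\<lambda>n. quasi_regular M a h (fs n)"]) (auto simp: e1 e2)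
qed

lemma voice_eq:
  assumes f: "is_fourier_L2 M N f F" and \<psi>: "is_fourier_L2 M N \<psi> p" and h: "h \<in> Hs"
  shows "voice M \<psi> f (a, h) = complex_of_real (delta M h powr (1/2)) * (\<integral>\<xi>. F \<xi> * cnj (p (\<xi> \<circ> h)) * \<xi> a \<partial>N)"
proof -
  have "voice M \<psi> f (a, h) = (\<integral>\<xi>. F \<xi> * cnj (dual_quasi_regular a h p \<xi>) \<partial>N)"
    unfolding voice_def using parseval[OF f is_fourier_L2_quasi_regular[OF \<psi> h]] by simp
  also have "\<dots> = (\<integral>\<xi>. complex_of_real (delta M h powr (1/2)) * (F \<xi> * cnj (p (\<xi> \<circ> h)) * \<xi> a) \<partial>N)"
    by (simp add: dual_quasi_regular_def mult_ac)
  finally show ?thesis by simp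
qed

text \<open>The isometry concerns the preimage \<open>g\<close> of \<open>G\<close>, while the voice
  transform contains the pointwise integral \<open>u\<close>. That they agree almost everywhere is
  checked on each set \<open>A\<close> of finite measure: pairing the difference on \<open>A\<close>
  with \<open>g\<close> by Parseval and with \<open>u\<close> by Fubini gives the same
  number.\<close>

lemma nn_integral_inverse_fourier:
  assumes G1: "integrable N G" and G2: "G \<in> L2 N"
  shows "(\<integral>\<^sup>+a. ennreal ((cmod (\<integral>\<xi>. G \<xi> * \<xi> a \<partial>N))\<^sup>2) \<partial>M) = (\<integral>\<^sup>+\<xi>. ennreal ((cmod (G \<xi>))\<^sup>2) \<partial>N)"
proof -
  interpret M: sigma_finite_measure M by (rule sigma_finite_M)
  interpret N: sigma_finite_measure N by (rule sigma_finite_N)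
  interpret pair_sigma_finite M N ..
  obtain g where g: "is_fourier_L2 M N g G" by (rule fourier_L2_surj[OF G2])
  have [measurable]: "G \<in> borel_measurable N" using G2 by (simp add: L2_def)
  have gL: "g \<in> L2 M" using is_fourier_L2D[OF g] by simp
  then have [measurable]: "g \<in> borel_measurable M" by (simp add: L2_def)
  define u where "u a = (\<integral>\<xi>. G \<xi> * \<xi> a \<partial>N)" for a
  have evm[measurable]: "(\<lambda>p. snd p (fst p)) \<in> borel_measurable (M \<Otimes>\<^sub>M N)"
    by (rule measurable_eval_compose) (auto simp: measurable_cong_sets[OF refl sets_M[symmetric]])
  have [measurable]: "u \<in> borel_measurable M" unfolding u_def
    by (rule N.borel_measurable_lebesgue_integral) (simp add: split_def)
  define b where "b = (\<integral>\<xi>. cmod (G \<xi>) \<partial>N)"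
  have ub: "cmod (u a) \<le> b" for a
  proof -
    have "cmod (u a) \<le> (\<integral>\<xi>. cmod (G \<xi> * \<xi> a) \<partial>N)" unfolding u_def by (rule integral_norm_bound)
    also have "\<dots> = b"
      unfolding b_def by (intro Bochner_Integration.integral_cong) (simp_all add: norm_mult cmod_dual space_N)
    finally show ?thesis .
  qed
  have key: "AE x in M. (g x - u x) * indicator A x = 0" if A[measurable]: "A \<in> sets M" and fA: "emeasure M A < \<infinity>" for A
  proof -
    \<comment> \<open>The restricted difference is its own test function: its inner product with
      \<open>g - u\<close> is its squared norm. It lies in \<open>L1\<close> and \<open>L2\<close>
      because \<open>u\<close> is bounded and \<open>A\<close> has finite measure.\<close>
    define f where "f x = (g x - u x) * indicator A x" for x
    have "(\<lambda>x. g x * indicator A x) \<in> L2 M"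
      by (rule L2_mult_bounded[OF gL, of _ 1]) (auto simp: indicator_def)
    moreover have "(\<lambda>x. indicator A x * u x) \<in> L2 M"
      using ub by (intro L2_mult_bounded[OF indicator_L2[OF A fA], of _ b]) auto
    ultimately have f2: "f \<in> L2 M" using L2_diff[of "\<lambda>x. g x * indicator A x" M "\<lambda>x. indicator A x * u x"]
      by (simp add: f_def[abs_def] algebra_simps)
    have f1: "f \<in> L1 M" unfolding f_def[abs_def] using f2 fA
      by (intro L1_L2_restrict) (auto simp: f_def[abs_def])
    have [measurable]: "f \<in> borel_measurable M" using f2 by (simp add: L2_def)
    have i1: "integrable M f" using f1 by (simp add: L1_def)
    have "integrable (M \<Otimes>\<^sub>M N) (\<lambda>p. f (fst p) * cnj (G (snd p)) * cnj (snd p (fst p)))"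
    proof (rule Fubini_integrable)
      have "(\<integral>\<xi>. cmod (f x * cnj (G \<xi>) * cnj (\<xi> x)) \<partial>N) = cmod (f x) * b" for x
      proof -
        have "(\<integral>\<xi>. cmod (f x * cnj (G \<xi>) * cnj (\<xi> x)) \<partial>N) = (\<integral>\<xi>. cmod (f x) * cmod (G \<xi>) \<partial>N)"
          by (intro Bochner_Integration.integral_cong) (simp_all add: norm_mult cmod_dual space_N)
        then show ?thesis by (simp add: b_def)
      qed
      then show "integrable M (\<lambda>x. \<integral>y. cmod (f (fst (x, y)) * cnj (G (snd (x, y))) * cnj (snd (x, y) (fst (x, y)))) \<partial>N)"
        using i1 by simp
      show "AE x in M. integrable N (\<lambda>y. f (fst (x, y)) * cnj (G (snd (x, y))) * cnj (snd (x, y) (fst (x, y))))"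
      proof (rule AE_I2)
        fix x
        note [measurable] = measurable_eval_at[of x]
        have "integrable N (\<lambda>\<xi>. f x * cnj (G \<xi>))" using G1 by simp
        moreover have "(\<lambda>\<xi>. f x * cnj (G \<xi>) * cnj (\<xi> x)) \<in> borel_measurable N" by measurable
        ultimately have "integrable N (\<lambda>\<xi>. f x * cnj (G \<xi>) * cnj (\<xi> x))"
        proof (rule Bochner_Integration.integrable_bound)
          show "AE \<xi> in N. norm (f x * cnj (G \<xi>) * cnj (\<xi> x)) \<le> norm (f x * cnj (G \<xi>))"
          proof (rule AE_I2)
            fix \<xi> assume "\<xi> \<in> space N"
            then show "norm (f x * cnj (G \<xi>) * cnj (\<xi> x)) \<le> norm (f x * cnj (G \<xi>))"
              by (simp add: norm_mult cmod_dual space_N)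
          qed
        qed
        then show "integrable N (\<lambda>y. f (fst (x, y)) * cnj (G (snd (x, y))) * cnj (snd (x, y) (fst (x, y))))"
          by simp
      qed
    qed measurable
    then have i: "integrable (M \<Otimes>\<^sub>M N) (\<lambda>(x, \<xi>). f x * cnj (G \<xi>) * cnj (\<xi> x))" by (simp add: split_def)
    have "(\<integral>x. f x * cnj (u x) \<partial>M) = (\<integral>x. (\<integral>\<xi>. f x * cnj (G \<xi>) * cnj (\<xi> x) \<partial>N) \<partial>M)"
    proof (intro Bochner_Integration.integral_cong refl)
      fix x
      have "cnj (u x) = (\<integral>\<xi>. cnj (G \<xi> * \<xi> x) \<partial>N)"
        unfolding u_def by (rule Bochner_Integration.integral_cnj[symmetric])
      then show "f x * cnj (u x) = (\<integral>\<xi>. f x * cnj (G \<xi>) * cnj (\<xi> x) \<partial>N)" by (simp add: mult.assoc)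
    qed
    also have "\<dots> = (\<integral>\<xi>. (\<integral>x. f x * cnj (G \<xi>) * cnj (\<xi> x) \<partial>M) \<partial>N)"
      by (rule Fubini_integral[OF i, symmetric])
    also have "\<dots> = (\<integral>\<xi>. fourier1 M f \<xi> * cnj (G \<xi>) \<partial>N)"
    proof (intro Bochner_Integration.integral_cong refl)
      fix \<xi>
      have "(\<integral>x. f x * cnj (G \<xi>) * cnj (\<xi> x) \<partial>M) = (\<integral>x. f x * cnj (\<xi> x) * cnj (G \<xi>) \<partial>M)"
        by (simp add: mult_ac)
      then show "(\<integral>x. f x * cnj (G \<xi>) * cnj (\<xi> x) \<partial>M) = fourier1 M f \<xi> * cnj (G \<xi>)"
        by (simp add: fourier1_def)
    qed
    also have "\<dots> = (\<integral>x. f x * cnj (g x) \<partial>M)"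
      by (rule parseval[OF is_fourier_L2_fourier1[OF f1 f2] g, symmetric])
    finally have eq: "(\<integral>x. f x * cnj (u x) \<partial>M) = (\<integral>x. f x * cnj (g x) \<partial>M)" .
    have iu: "integrable M (\<lambda>x. f x * cnj (u x))"
    proof (rule Bochner_Integration.integrable_bound[of M "\<lambda>x. b * f x"])
      show "AE x in M. norm (f x * cnj (u x)) \<le> norm (complex_of_real b * f x)"
      proof (rule AE_I2)
        fix x
        have "0 \<le> b" using ub[of x] norm_ge_zero order_trans by blast
        then show "norm (f x * cnj (u x)) \<le> norm (complex_of_real b * f x)"
          using mult_left_mono[OF ub[of x], of "cmod (f x)"] by (simp add: norm_mult mult.commute[of b])
      qed
    qed (use i1 in auto)
    have "(\<integral>x. f x * cnj (g x) - f x * cnj (u x) \<partial>M) = 0"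
      using eq integrable_L2_cnj[OF f2 gL] iu by simp
    moreover have "f x * cnj (g x) - f x * cnj (u x) = complex_of_real ((cmod (f x))\<^sup>2)" for x
    proof -
      have "f x * cnj (g x) - f x * cnj (u x) = f x * cnj (f x)"
        by (simp add: f_def indicator_def algebra_simps)
      then show ?thesis by (simp only: complex_norm_square)
    qed
    ultimately have "complex_of_real (\<integral>x. (cmod (f x))\<^sup>2 \<partial>M) = 0"
      by (simp only: integral_complex_of_real)
    then have "L2norm M f = 0" by (simp add: L2norm_def)
    then show ?thesis using L2norm_eq_0_iff[OF f2] by (simp add: f_def)
  qed
  obtain A :: "nat \<Rightarrow> 'a set" where A: "range A \<subseteq> sets M" "(\<Union>i. A i) = space M" "\<And>i. emeasure M (A i) \<noteq> \<infinity>"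
    by (rule M.sigma_finite) blast
  have "AE x in M. \<forall>i. (g x - u x) * indicator (A i) x = 0"
    unfolding AE_all_countable using key A by (auto simp: less_top)
  then have "AE x in M. u x = g x"
  proof eventually_elim
    case (elim x)
    obtain i where "x \<in> A i" using A(2) by auto
    then show ?case using spec[OF elim, of i] by simp
  qed
  then have "(\<integral>\<^sup>+a. ennreal ((cmod (u a))\<^sup>2) \<partial>M) = (\<integral>\<^sup>+a. ennreal ((cmod (g a))\<^sup>2) \<partial>M)"
    by (intro nn_integral_cong_AE) auto
  also have "\<dots> = (\<integral>\<^sup>+\<xi>. ennreal ((cmod (G \<xi>))\<^sup>2) \<partial>N)"
    using ennreal_L2norm_sq[OF gL] ennreal_L2norm_sq[OF G2] fourier_L2_norm[OF g] by simp
  finally show ?thesis unfolding u_def .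
qed

subsubsection \<open>The norm of the voice transform\<close>

text \<open>The function \<Phi>, with values in \<open>ennreal\<close> because its finiteness is a
  conclusion to be drawn from admissibility.\<close>

definition orbit_weight :: "(('a \<Rightarrow> complex) \<Rightarrow> complex) \<Rightarrow> ('a \<Rightarrow> complex) \<Rightarrow> ennreal" where
  "orbit_weight p \<xi> = (\<integral>\<^sup>+h. ennreal ((cmod (p (\<xi> \<circ> h)))\<^sup>2) \<partial>MH)"

lemma measurable_orbit [measurable (raw)]:
  assumes "p \<in> borel_measurable N" "f \<in> \<Omega> \<rightarrow>\<^sub>M N" "g \<in> \<Omega> \<rightarrow>\<^sub>M MH"
  shows "(\<lambda>x. p (f x \<circ> g x)) \<in> borel_measurable \<Omega>"
  by (rule measurable_compose[OF measurable_dual_comp[OF assms(2,3)] assms(1)])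

lemma measurable_orbit_weight:
  assumes [measurable]: "p \<in> borel_measurable N" shows "orbit_weight p \<in> borel_measurable N"
proof -
  interpret MH: sigma_finite_measure MH by (rule sigma_finite_MH)
  show ?thesis unfolding orbit_weight_def[abs_def] by measurable
qed

lemma measurable_voice:
  assumes [measurable]: "f \<in> borel_measurable M" "\<psi> \<in> borel_measurable M"
  shows "voice M \<psi> f \<in> borel_measurable (M \<Otimes>\<^sub>M MH)"
proof -
  interpret M: sigma_finite_measure M by (rule sigma_finite_M)
  have [measurable]: "\<psi> \<in> borel_measurable borel"
    using assms(2) by (simp cong: measurable_cong_sets add: measurable_cong_sets[OF sets_M refl])
  show ?thesis unfolding voice_def[abs_def] quasi_regular_def by measurable
qed

lemma nn_integral_G_measure:
  assumes [measurable]: "f \<in> borel_measurable (M \<Otimes>\<^sub>M MH)"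
  shows "(\<integral>\<^sup>+p. f p \<partial>G_measure M MH) = (\<integral>\<^sup>+h. ennreal (1 / delta M h) * (\<integral>\<^sup>+a. f (a, h) \<partial>M) \<partial>MH)"
proof -
  interpret M: sigma_finite_measure M by (rule sigma_finite_M)
  interpret MH: sigma_finite_measure MH by (rule sigma_finite_MH)
  interpret pair_sigma_finite M MH ..
  have "(\<integral>\<^sup>+p. f p \<partial>G_measure M MH) = (\<integral>\<^sup>+p. ennreal (1 / delta M (snd p)) * f p \<partial>(M \<Otimes>\<^sub>M MH))"
    unfolding G_measure_def by (rule nn_integral_density) measurable
  also have "\<dots> = (\<integral>\<^sup>+h. (\<integral>\<^sup>+a. ennreal (1 / delta M h) * f (a, h) \<partial>M) \<partial>MH)"
    by (subst nn_integral_snd[symmetric]) auto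
  also have "\<dots> = (\<integral>\<^sup>+h. ennreal (1 / delta M h) * (\<integral>\<^sup>+a. f (a, h) \<partial>M) \<partial>MH)"
    by (intro nn_integral_cong nn_integral_cmult) measurable
  finally show ?thesis .
qed

text \<open>At a fixed \<open>h\<close> the voice transform is the root of \<open>delta M h\<close>
  times an inverse Fourier transform in \<open>a\<close>; the squared norm therefore carries
  \<open>delta M h\<close>, which the Haar measure of the semidirect product cancels, and Tonelli
  does the rest. A product of two square-integrable functions need not be square-integrable, whence
  \<open>G2\<close>: it holds for indicator functions \<open>F\<close>, and for general
  \<open>F\<close> once the total integral is known to be finite.\<close>

theorem nn_integral_voice:
  assumes f: "is_fourier_L2 M N f F" and \<psi>: "is_fourier_L2 M N \<psi> p"
    and G2: "AE h in MH. (\<lambda>\<xi>. F \<xi> * cnj (p (\<xi> \<circ> h))) \<in> L2 N"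
  shows "(\<integral>\<^sup>+x. ennreal ((cmod (voice M \<psi> f x))\<^sup>2) \<partial>G_measure M MH) =
    (\<integral>\<^sup>+\<xi>. ennreal ((cmod (F \<xi>))\<^sup>2) * orbit_weight p \<xi> \<partial>N)"
proof -
  interpret N: sigma_finite_measure N by (rule sigma_finite_N)
  interpret MH: sigma_finite_measure MH by (rule sigma_finite_MH)
  interpret pair_sigma_finite N MH ..
  note L = is_fourier_L2D[OF f] is_fourier_L2D[OF \<psi>]
  have [measurable]: "f \<in> borel_measurable M" "\<psi> \<in> borel_measurable M" "F \<in> borel_measurable N" "p \<in> borel_measurable N"
    using L by (auto simp: L2_def)
  note [measurable] = measurable_voice[of f \<psi>]
  have "(\<integral>\<^sup>+x. ennreal ((cmod (voice M \<psi> f x))\<^sup>2) \<partial>G_measure M MH) =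
      (\<integral>\<^sup>+h. ennreal (1 / delta M h) * (\<integral>\<^sup>+a. ennreal ((cmod (voice M \<psi> f (a, h)))\<^sup>2) \<partial>M) \<partial>MH)"
    by (rule nn_integral_G_measure) measurable
  also have "\<dots> = (\<integral>\<^sup>+h. (\<integral>\<^sup>+\<xi>. ennreal ((cmod (F \<xi>))\<^sup>2) * ennreal ((cmod (p (\<xi> \<circ> h)))\<^sup>2) \<partial>N) \<partial>MH)"
  proof (rule nn_integral_cong_AE)
    show "AE h in MH. ennreal (1 / delta M h) * (\<integral>\<^sup>+a. ennreal ((cmod (voice M \<psi> f (a, h)))\<^sup>2) \<partial>M) =
        (\<integral>\<^sup>+\<xi>. ennreal ((cmod (F \<xi>))\<^sup>2) * ennreal ((cmod (p (\<xi> \<circ> h)))\<^sup>2) \<partial>N)"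
      using G2 AE_space
    proof eventually_elim
      case (elim h)
      then have h: "h \<in> Hs" by (simp add: space_MH)
      have d: "0 < delta M h" by (rule emeasure_image_scale(1)[OF h])
      define G where "G \<xi> = F \<xi> * cnj (p (\<xi> \<circ> h))" for \<xi>
      have GL: "G \<in> L2 N" using elim(1) by (simp add: G_def[abs_def])
      have "(\<lambda>\<xi>. p (\<xi> \<circ> h)) \<in> L2 N" by (rule comp_right_L2[OF L(4) h])
      then have G1: "integrable N G" unfolding G_def[abs_def] by (rule integrable_L2_cnj[OF L(2)])
      have vm: "(\<lambda>a. voice M \<psi> f (a, h)) \<in> borel_measurable M"
        using measurable_compose[OF measurable_Pair2' measurable_voice, of h f \<psi>] h by (simp add: space_MH)
      have um: "(\<lambda>a. \<integral>\<xi>. G \<xi> * \<xi> a \<partial>N) \<in> borel_measurable M"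
      proof -
        have [measurable]: "G \<in> borel_measurable N" using GL by (simp add: L2_def)
        have [measurable]: "(\<lambda>p. snd p (fst p)) \<in> borel_measurable (M \<Otimes>\<^sub>M N)"
          by (rule measurable_eval_compose) (auto simp: measurable_cong_sets[OF refl sets_M[symmetric]])
        show ?thesis by (rule N.borel_measurable_lebesgue_integral) (simp add: split_def)
      qed
      have "(\<integral>\<^sup>+a. ennreal ((cmod (voice M \<psi> f (a, h)))\<^sup>2) \<partial>M) =
          (\<integral>\<^sup>+a. ennreal (delta M h) * ennreal ((cmod (\<integral>\<xi>. G \<xi> * \<xi> a \<partial>N))\<^sup>2) \<partial>M)"
        unfolding voice_eq[OF f \<psi> h] norm_mult power_mult_distrib delta_powr_sq[OF h] G_def
        using d by (simp add: ennreal_mult)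
      also have "\<dots> = ennreal (delta M h) * (\<integral>\<^sup>+a. ennreal ((cmod (\<integral>\<xi>. G \<xi> * \<xi> a \<partial>N))\<^sup>2) \<partial>M)"
        using measurable_compose[OF um, of "\<lambda>z. ennreal ((cmod z)\<^sup>2)" borel]
        by (intro nn_integral_cmult) simp
      also have "\<dots> = ennreal (delta M h) * (\<integral>\<^sup>+\<xi>. ennreal ((cmod (G \<xi>))\<^sup>2) \<partial>N)"
        by (simp add: nn_integral_inverse_fourier[OF G1 GL])
      finally have "ennreal (1 / delta M h) * (\<integral>\<^sup>+a. ennreal ((cmod (voice M \<psi> f (a, h)))\<^sup>2) \<partial>M)
          = (\<integral>\<^sup>+\<xi>. ennreal ((cmod (G \<xi>))\<^sup>2) \<partial>N)"
        using d by (simp add: mult.assoc[symmetric] ennreal_mult[symmetric])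
      then show ?case by (simp add: G_def norm_mult power_mult_distrib ennreal_mult)
    qed
  qed
  also have "\<dots> = (\<integral>\<^sup>+\<xi>. (\<integral>\<^sup>+h. ennreal ((cmod (F \<xi>))\<^sup>2) * ennreal ((cmod (p (\<xi> \<circ> h)))\<^sup>2) \<partial>MH) \<partial>N)"
    by (rule Fubini') measurable
  also have "\<dots> = (\<integral>\<^sup>+\<xi>. ennreal ((cmod (F \<xi>))\<^sup>2) * orbit_weight p \<xi> \<partial>N)"
    unfolding orbit_weight_def by (intro nn_integral_cong nn_integral_cmult) measurable
  finally show ?thesis .
qed

end

context quasi_regular_setup
begin

subsection \<open>Orbits and stabilizers\<close>

lemma orbit_weight_comp:
  assumes "p \<in> borel_measurable N" "\<xi> \<in> dual_group" "g \<in> Hs"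
  shows "orbit_weight p (\<xi> \<circ> g) = orbit_weight p \<xi>"
proof -
  note [measurable] = assms(1)
  have "(\<lambda>h. p (\<xi> \<circ> h)) \<in> borel_measurable MH"
    using assms(2) by (intro measurable_orbit[OF assms(1)]) (auto simp: space_N)
  then have m: "(\<lambda>h. ennreal ((cmod (p (\<xi> \<circ> h)))\<^sup>2)) \<in> borel_measurable MH"
    by (rule measurable_compose) measurable
  show ?thesis unfolding orbit_weight_def using nn_integral_left_MH[OF assms(3) m] by (simp add: comp_assoc)
qed

lemma compactin_comp_inv:
  assumes "compactin TH K" "compactin TH L"
  shows "compactin TH ((\<lambda>(g, h). g \<circ> inv h) ` (K \<times> L))"
proof -
  have "continuous_map (prod_topology TH TH) (prod_topology TH TH) (\<lambda>p. (fst p, inv (snd p)))"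
    by (intro continuous_map_pairedI continuous_map_fst continuous_map_compose[OF continuous_map_snd continuous_inv, unfolded comp_def])
  from continuous_map_compose[OF this continuous_comp]
  have "continuous_map (prod_topology TH TH) TH (\<lambda>(g, h). g \<circ> inv h)" by (simp add: comp_def split_def)
  moreover have "compactin (prod_topology TH TH) (K \<times> L)" using assms by (simp add: compactin_Times)
  ultimately show ?thesis by (rule image_compactin[rotated])
qed

lemma continuous_left: "g \<in> Hs \<Longrightarrow> continuous_map TH TH (\<lambda>h. g \<circ> h)"
proof -
  assume g: "g \<in> Hs"
  have "continuous_map TH (prod_topology TH TH) (\<lambda>h. (g, h))"
    using g by (intro continuous_map_pairedI) (auto simp: topspace_TH)
  from continuous_map_compose[OF this continuous_comp] show ?thesis by (simp add: comp_def)
qed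

lemma closedin_stabilizer:
  assumes "\<xi> \<in> dual_group" shows "closedin TH (stabilizer Hs \<xi>)"
proof -
  have "closedin TH {h \<in> topspace TH. \<xi> (h a) \<in> {\<xi> a}}" for a
    by (rule closedin_continuous_map_preimage[OF continuous_orbit_eval[OF assms]]) simp
  then have "closedin TH (\<Inter>a. {h \<in> topspace TH. \<xi> (h a) \<in> {\<xi> a}})" by (intro closedin_INT) auto
  also have "(\<Inter>a. {h \<in> topspace TH. \<xi> (h a) \<in> {\<xi> a}}) = stabilizer Hs \<xi>"
    by (auto simp: stabilizer_def topspace_TH fun_eq_iff)
  finally show ?thesis .
qed

text \<open>If the stabilizer were not compact, infinitely many disjoint translates of a relatively
  compact set of positive measure would fit into a left invariant set of finite measure.\<close>

lemma compactin_stabilizer: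
  assumes \<xi>: "\<xi> \<in> dual_group" and p: "p \<in> borel_measurable N"
    and pos: "0 < orbit_weight p \<xi>" and fin: "orbit_weight p \<xi> < \<infinity>"
  shows "compactin TH (stabilizer Hs \<xi>)"
proof (rule ccontr)
  assume nc: "\<not> compactin TH (stabilizer Hs \<xi>)"
  interpret MH: sigma_finite_measure MH by (rule sigma_finite_MH)
  define w where "w h = (cmod (p (\<xi> \<circ> h)))\<^sup>2" for h
  have "(\<lambda>h. p (\<xi> \<circ> h)) \<in> borel_measurable MH"
    using \<xi> by (intro measurable_orbit[OF p]) (auto simp: space_N)
  then have wm[measurable]: "w \<in> borel_measurable MH" unfolding w_def by (rule measurable_compose) measurable
  have wint: "(\<integral>\<^sup>+h. ennreal (w h) \<partial>MH) = orbit_weight p \<xi>" by (simp add: w_def orbit_weight_def)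
  \<comment> \<open>Level sets of the weight have finite measure by Markov's inequality, and
    together they exhaust the set where it is positive.\<close>
  define S where "S n = {h \<in> Hs. 1 / Suc n < w h}" for n :: nat
  have S[measurable]: "S n \<in> sets MH" for n unfolding S_def space_MH[symmetric] by measurable
  have finS: "emeasure MH (S n) < \<infinity>" for n
  proof -
    have "ennreal (1 / Suc n) * emeasure MH (S n) = (\<integral>\<^sup>+h. ennreal (1 / Suc n) * indicator (S n) h \<partial>MH)"
      using S by (simp add: nn_integral_cmult_indicator)
    also have "\<dots> \<le> (\<integral>\<^sup>+h. ennreal (w h) \<partial>MH)"
      by (intro nn_integral_mono) (auto simp: S_def indicator_def intro!: ennreal_leI)
    finally have "ennreal (1 / Suc n) * emeasure MH (S n) < \<infinity>" using fin wint by simp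
    moreover have "ennreal (1 / Suc n) \<noteq> 0" by simp
    ultimately show ?thesis by (auto simp: ennreal_mult_less_top simp del: of_nat_Suc ennreal_eq_0_iff)
  qed
  obtain K :: "nat \<Rightarrow> ('a \<Rightarrow> 'a) set" where K: "\<And>n. compactin TH (K n)" "(\<Union>n. K n) = topspace TH"
    using compact_exhaustion[OF second_countable_TH locally_compact_TH Hausdorff_TH] by metis
  have Km: "K n \<in> sets MH" for n
    unfolding sets_MH by (intro closedin_sets_borel_of compactin_imp_closedin Hausdorff_TH K)
  \<comment> \<open>Otherwise the weight would vanish almost everywhere and its integral, the
    positive number \<open>orbit_weight p \<xi>\<close>, would be 0.\<close>
  have "\<exists>n m. emeasure MH (S n \<inter> K m) \<noteq> 0"
  proof (rule ccontr)
    assume "\<not> ?thesis"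
    then have z: "S n \<inter> K m \<in> null_sets MH" for n m using S Km by auto
    have "(\<Union>n. \<Union>m. S n \<inter> K m) \<in> null_sets MH" using z by (intro null_sets_UN) auto
    moreover have "{h \<in> Hs. 0 < w h} \<subseteq> (\<Union>n. \<Union>m. S n \<inter> K m)"
    proof
      fix h assume h: "h \<in> {h \<in> Hs. 0 < w h}"
      then obtain n where "1 / Suc n < w h" using nat_approx_posE by blast
      moreover obtain m where "h \<in> K m" using h K(2) topspace_TH by auto
      ultimately show "h \<in> (\<Union>n. \<Union>m. S n \<inter> K m)" using h by (auto simp: S_def)
    qed
    ultimately have "AE h in MH. ennreal (w h) = 0"
      by (intro AE_I'[of "\<Union>n. \<Union>m. S n \<inter> K m"]) (auto simp: space_MH ennreal_eq_0_iff not_le)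
    then have "(\<integral>\<^sup>+h. ennreal (w h) \<partial>MH) = 0" by (subst nn_integral_0_iff_AE) auto
    then show False using pos wint by simp
  qed
  then obtain n m where nm: "emeasure MH (S n \<inter> K m) \<noteq> 0" by blast
  define T where "T = S n \<inter> K m"
  have T: "T \<in> sets MH" "emeasure MH T \<noteq> 0" "T \<subseteq> Hs"
  proof -
    show "T \<in> sets MH" unfolding T_def by (rule sets.Int[OF S Km])
    show "emeasure MH T \<noteq> 0" unfolding T_def by (rule nm)
    have "S n \<subseteq> Hs" unfolding S_def by blast
    then show "T \<subseteq> Hs" unfolding T_def by blast
  qed
  \<comment> \<open>The weight at \<open>h\<close> depends only on \<open>\<xi> \<circ> h\<close>,
    which left translation by an element of the stabilizer does not change.\<close>
  have TS: "(\<lambda>h. k \<circ> h) ` T \<subseteq> S n" if k: "k \<in> stabilizer Hs \<xi>" for k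
  proof (intro image_subsetI)
    fix h assume "h \<in> T"
    then have h: "h \<in> Hs" "1 / Suc n < w h" by (simp_all add: T_def S_def)
    have "\<xi> \<circ> (k \<circ> h) = \<xi> \<circ> h" using k by (simp add: stabilizer_def comp_assoc[symmetric])
    then show "k \<circ> h \<in> S n" using h k Hs_comp by (simp add: S_def w_def stabilizer_def)
  qed
  have Tk: "(\<lambda>h. k \<circ> h) ` T \<in> sets MH" if "k \<in> Hs" for k
  proof -
    have m: "(\<lambda>h. inv k \<circ> h) \<in> MH \<rightarrow>\<^sub>M MH" using that by (intro measurable_comp_H) (auto simp: space_MH Hs_inv)
    have "(\<lambda>h. k \<circ> h) ` T = (\<lambda>h. inv k \<circ> h) -` T \<inter> space MH"
    proof (intro antisym subsetI)
      fix g assume "g \<in> (\<lambda>h. k \<circ> h) ` T"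
      then show "g \<in> (\<lambda>h. inv k \<circ> h) -` T \<inter> space MH"
        using that T(3) Hs_inv_comp[OF that] by (auto simp: comp_assoc[symmetric] space_MH intro!: Hs_comp)
    next
      fix g assume "g \<in> (\<lambda>h. inv k \<circ> h) -` T \<inter> space MH"
      then show "g \<in> (\<lambda>h. k \<circ> h) ` T"
        using Hs_inv_comp[OF that] by (intro image_eqI[of _ _ "inv k \<circ> g"]) (auto simp: comp_assoc[symmetric])
    qed
    then show ?thesis using measurable_sets[OF m T(1)] by simp
  qed
  have "\<exists>J. finite J \<and> card J = l \<and> J \<subseteq> stabilizer Hs \<xi> \<and> disjoint_family_on (\<lambda>k. (\<lambda>h. k \<circ> h) ` T) J" for l
  proof (induction l)
    case 0
    then show ?case by (intro exI[of _ "{}"]) (auto simp: disjoint_family_on_def)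
  next
    case (Suc l)
    then obtain J where J: "finite J" "card J = l" "J \<subseteq> stabilizer Hs \<xi>" "disjoint_family_on (\<lambda>k. (\<lambda>h. k \<circ> h) ` T) J"
      by blast
    \<comment> \<open>The compact set of all \<open>k\<close> whose translate of \<open>K m\<close>
      can meet one of the earlier translates; any element of the stabilizer outside it gives a
      translate of \<open>T\<close> disjoint from them.\<close>
    define Q where "Q = (\<Union>k\<in>J. (\<lambda>h. k \<circ> h) ` ((\<lambda>(g, h). g \<circ> inv h) ` (K m \<times> K m)))"
    have "compactin TH Q" unfolding Q_def
      using J(1,3) by (intro compactin_Union finite_imageI)
        (auto simp: stabilizer_def intro!: image_compactin[OF compactin_comp_inv[OF K(1) K(1)]] continuous_left)
    then have "\<not> stabilizer Hs \<xi> \<subseteq> Q"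
      using nc closed_compactin[OF _ _ closedin_stabilizer[OF \<xi>]] by blast
    then obtain k where k: "k \<in> stabilizer Hs \<xi>" "k \<notin> Q" by blast
    have kH: "k \<in> Hs" using k(1) by (simp add: stabilizer_def)
    have disj: "(\<lambda>h. k \<circ> h) ` T \<inter> (\<lambda>h. j \<circ> h) ` T = {}" if j: "j \<in> J" for j
    proof (rule ccontr)
      assume "(\<lambda>h. k \<circ> h) ` T \<inter> (\<lambda>h. j \<circ> h) ` T \<noteq> {}"
      then obtain s t where st: "s \<in> T" "t \<in> T" "k \<circ> s = j \<circ> t" by auto
      have sH: "s \<in> Hs" using st T(3) by blast
      have "k = k \<circ> (s \<circ> inv s)" using Hs_inv_comp(2)[OF sH] by simp
      also have "\<dots> = j \<circ> (t \<circ> inv s)" using st(3) by (metis comp_assoc)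
      finally have "k = j \<circ> (t \<circ> inv s)" .
      then have "k \<in> Q" unfolding Q_def using j st(1,2) by (force simp: T_def)
      then show False using k(2) by simp
    qed
    have "k \<notin> J"
    proof
      assume "k \<in> J"
      moreover have "T \<noteq> {}" using T(2) by auto
      ultimately show False using disj[of k] by auto
    qed
    moreover have "disjoint_family_on (\<lambda>k. (\<lambda>h. k \<circ> h) ` T) (insert k J)"
      unfolding disjoint_family_on_insert[OF \<open>k \<notin> J\<close>] using disj J(4) by (simp add: Int_UN_distrib)
    ultimately show ?case using J(1,2,3) k(1) \<open>k \<notin> J\<close>
      by (intro exI[of _ "insert k J"] conjI) (assumption | simp)+
  qed
  then have bound: "of_nat l * emeasure MH T \<le> emeasure MH (S n)" for l
  proof -
    obtain J where J: "finite J" "card J = l" "J \<subseteq> stabilizer Hs \<xi>" "disjoint_family_on (\<lambda>k. (\<lambda>h. k \<circ> h) ` T) J"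
      using \<open>\<And>l. \<exists>J. finite J \<and> card J = l \<and> _ J\<close>[of l] by blast
    have JH: "J \<subseteq> Hs" using J(3) by (auto simp: stabilizer_def)
    have "of_nat l * emeasure MH T = (\<Sum>k\<in>J. emeasure MH ((\<lambda>h. k \<circ> h) ` T))"
      using emeasure_MH_left[OF _ T(1)] JH J(2) by (simp add: subset_iff)
    also have "\<dots> = emeasure MH (\<Union>k\<in>J. (\<lambda>h. k \<circ> h) ` T)"
      using Tk JH J by (intro sum_emeasure) auto
    also have "\<dots> \<le> emeasure MH (S n)" using TS J(3) S by (intro emeasure_mono) auto
    finally show ?thesis .
  qed
  have "emeasure MH (S n) = \<infinity>"
  proof (rule ccontr)
    assume "emeasure MH (S n) \<noteq> \<infinity>"
    moreover have "emeasure MH T \<le> emeasure MH (S n)" using S by (intro emeasure_mono) (auto simp: T_def)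
    ultimately have fT: "emeasure MH T \<noteq> \<infinity>" by (auto simp: top_unique)
    define a b where "a = measure MH T" and "b = measure MH (S n)"
    have a: "emeasure MH T = ennreal a" unfolding a_def by (rule emeasure_eq_ennreal_measure) (use fT in simp)
    have "a \<noteq> 0" using a T(2) by auto
    then have a_pos: "0 < a" by (simp add: a_def order_less_le)
    have b: "emeasure MH (S n) = ennreal b" "0 \<le> b"
      using emeasure_eq_ennreal_measure[of MH "S n"] \<open>emeasure MH (S n) \<noteq> \<infinity>\<close> by (simp_all add: b_def)
    obtain l where "b < real l * a" using reals_Archimedean3[OF a_pos] by blast
    moreover have "real l * a \<le> b"
      using bound[of l] a_pos b(2) unfolding a b(1)
      by (simp add: ennreal_of_nat_eq_real_of_nat ennreal_mult[symmetric])
    ultimately show False by simp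
  qed
  then show False using finS[of n] by simp
qed

subsection \<open>From a weakly admissible vector to a cross-section\<close>

lemma mem_H_space:
  assumes "is_fourier_L2 M N f F" "\<And>\<xi>. \<xi> \<notin> X \<Longrightarrow> F \<xi> = 0"
  shows "f \<in> H_space M N X"
  unfolding H_space_def using assms is_fourier_L2D[OF assms(1)]
  by (auto intro!: exI[of _ F] AE_I2 simp: indicator_def)

text \<open>Admissibility is tested on functions whose transform is the indicator of a set
  \<open>E\<close> of finite measure in \<open>X\<close>: the squared norm of the voice transform is
  the integral of \<Phi> over \<open>E\<close>. Square-integrability forbids \<Phi> to be infinite
  on a set of positive measure, and injectivity forbids it to vanish on one.\<close>

lemma weakly_admissible_orbit_weight:
  assumes adm: "weakly_admissible M MH (H_space M N X) \<psi>" and X[measurable]: "X \<in> sets N"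
    and \<psi>: "is_fourier_L2 M N \<psi> p"
  shows "AE \<xi> in N. \<xi> \<in> X \<longrightarrow> 0 < orbit_weight p \<xi> \<and> orbit_weight p \<xi> < \<infinity>"
proof -
  interpret N: sigma_finite_measure N by (rule sigma_finite_N)
  note L = is_fourier_L2D[OF \<psi>]
  have pm[measurable]: "p \<in> borel_measurable N" using L by (simp add: L2_def)
  note ow[measurable] = measurable_orbit_weight[OF pm]
  have key: "(\<integral>\<^sup>+\<xi>. indicator E \<xi> * orbit_weight p \<xi> \<partial>N) < \<infinity> \<and>
      ((\<integral>\<^sup>+\<xi>. indicator E \<xi> * orbit_weight p \<xi> \<partial>N) = 0 \<longrightarrow> emeasure N E = 0)"
    if E[measurable]: "E \<in> sets N" and EX: "E \<subseteq> X" and fE: "emeasure N E < \<infinity>" for E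
  proof -
    define F where "F \<xi> = (indicator E \<xi> :: complex)" for \<xi>
    have F: "F \<in> L2 N" unfolding F_def using fE by (intro indicator_L2) auto
    obtain f where f: "is_fourier_L2 M N f F" by (rule fourier_L2_surj[OF F])
    have fH: "f \<in> H_space M N X" by (rule mem_H_space[OF f]) (use EX in \<open>auto simp: F_def indicator_def\<close>)
    have vL: "voice M \<psi> f \<in> L2 (G_measure M MH)" using adm fH unfolding weakly_admissible_def by blast
    have "AE h in MH. (\<lambda>\<xi>. F \<xi> * cnj (p (\<xi> \<circ> h))) \<in> L2 N"
    proof (rule AE_I2)
      fix h assume "h \<in> space MH"
      then have h: "h \<in> Hs" by (simp add: space_MH)
      have "(\<lambda>\<xi>. cnj (p (\<xi> \<circ> h)) * F \<xi>) \<in> L2 N"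
        by (rule L2_mult_bounded[OF L2_cnj[OF comp_right_L2[OF L(2) h]], of _ 1])
           (auto simp: F_def indicator_def)
      then show "(\<lambda>\<xi>. F \<xi> * cnj (p (\<xi> \<circ> h))) \<in> L2 N" by (simp add: mult.commute)
    qed
    from nn_integral_voice[OF f \<psi> this]
    have eq: "(\<integral>\<^sup>+x. ennreal ((cmod (voice M \<psi> f x))\<^sup>2) \<partial>G_measure M MH) = (\<integral>\<^sup>+\<xi>. indicator E \<xi> * orbit_weight p \<xi> \<partial>N)"
      by (simp add: F_def indicator_def of_bool_def if_distrib[of cmod] if_distrib[of "\<lambda>z. z\<^sup>2"] if_distrib[of ennreal] cong: if_cong)
    have vm: "voice M \<psi> f \<in> borel_measurable (G_measure M MH)" using vL by (simp add: L2_def)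
    have "emeasure N E = 0" if z: "(\<integral>\<^sup>+\<xi>. indicator E \<xi> * orbit_weight p \<xi> \<partial>N) = 0"
    proof -
      have "AE x in G_measure M MH. ennreal ((cmod (voice M \<psi> f x))\<^sup>2) = 0"
        using eq z vm by (subst nn_integral_0_iff_AE[symmetric]) auto
      then have "AE x in G_measure M MH. voice M \<psi> f x = 0" by eventually_elim auto
      then have "AE x in M. f x = 0" using adm fH unfolding weakly_admissible_def by blast
      then have "AE \<xi> in N. F \<xi> = 0" using fourier_L2_eq_0_iff[OF f] by blast
      then have "AE \<xi> in N. \<xi> \<notin> E" by eventually_elim (auto simp: F_def)
      then show ?thesis using AE_iff_measurable[of E N "\<lambda>\<xi>. \<xi> \<notin> E"] sets.sets_into_space[OF E] by auto
    qed
    then show ?thesis using eq vL vm L2_iff_nn_integral[OF vm] by simp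
  qed
  obtain A :: "nat \<Rightarrow> ('a \<Rightarrow> complex) set" where A: "range A \<subseteq> sets N" "(\<Union>i. A i) = space N"
    "\<And>i. emeasure N (A i) \<noteq> \<infinity>" by (rule N.sigma_finite) blast
  have [measurable]: "A i \<in> sets N" for i using A(1) by auto
  have "AE \<xi> in N. \<xi> \<in> X \<inter> A i \<longrightarrow> 0 < orbit_weight p \<xi> \<and> orbit_weight p \<xi> < \<infinity>" for i
  proof -
    \<comment> \<open>The bad sets are cut by \<open>A i\<close>, of finite measure, so that their
      indicators are square-integrable.\<close>
    define E0 where "E0 = {\<xi> \<in> space N. \<xi> \<in> X \<inter> A i \<and> orbit_weight p \<xi> = 0}"
    define E1 where "E1 = {\<xi> \<in> space N. \<xi> \<in> X \<inter> A i \<and> orbit_weight p \<xi> = \<infinity>}"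
    have m[measurable]: "E0 \<in> sets N" "E1 \<in> sets N" unfolding E0_def E1_def by measurable
    have f: "emeasure N E0 < \<infinity>" "emeasure N E1 < \<infinity>"
    proof -
      have "E0 \<subseteq> A i" "E1 \<subseteq> A i" by (auto simp: E0_def E1_def)
      then have "emeasure N E0 \<le> emeasure N (A i)" "emeasure N E1 \<le> emeasure N (A i)"
        by (auto intro: emeasure_mono)
      moreover have "emeasure N (A i) < \<infinity>" using A(3)[of i] by (simp add: less_top)
      ultimately show "emeasure N E0 < \<infinity>" "emeasure N E1 < \<infinity>" by (auto intro: le_less_trans)
    qed
    have "(\<integral>\<^sup>+\<xi>. indicator E0 \<xi> * orbit_weight p \<xi> \<partial>N) = (\<integral>\<^sup>+\<xi>. 0 \<partial>N)"
      by (intro nn_integral_cong) (auto simp: E0_def indicator_def)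
    then have "emeasure N E0 = 0" using key[OF m(1) _ f(1)] by (auto simp: E0_def)
    moreover have "emeasure N E1 = 0"
    proof -
      have "(\<integral>\<^sup>+\<xi>. indicator E1 \<xi> * orbit_weight p \<xi> \<partial>N) = (\<integral>\<^sup>+\<xi>. \<infinity> * indicator E1 \<xi> \<partial>N)"
        by (intro nn_integral_cong) (auto simp: E1_def indicator_def)
      also have "\<dots> = \<infinity> * emeasure N E1" by (rule nn_integral_cmult_indicator) measurable
      finally have "\<infinity> * emeasure N E1 < \<infinity>" using key[OF m(2) _ f(2)] by (auto simp: E1_def)
      then show ?thesis by (auto simp: ennreal_mult_less_top)
    qed
    ultimately have "AE \<xi> in N. \<xi> \<notin> E0" "AE \<xi> in N. \<xi> \<notin> E1"
      by (auto intro!: AE_not_in simp: null_sets_def)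
    then show ?thesis using AE_space
    proof eventually_elim
      case (elim \<xi>)
      then show ?case by (auto simp: E0_def E1_def zero_less_iff_neq_zero less_top)
    qed
  qed
  then have "AE \<xi> in N. \<forall>i. \<xi> \<in> X \<inter> A i \<longrightarrow> 0 < orbit_weight p \<xi> \<and> orbit_weight p \<xi> < \<infinity>"
    unfolding AE_all_countable by blast
  then show ?thesis using AE_space
  proof eventually_elim
    case (elim \<xi>)
    then show ?case using A(2) by blast
  qed
qed

text \<open>The normalized image of \<open>|p(\<xi> h)|\<^sup>2 dh\<close> on the orbit of \<open>\<xi>\<close> depends only on the orbit. A random
  point of this distribution, chosen as a function of the distribution alone, hits almost every orbit
  for almost every value of the random parameter.\<close>

lemma orbit_cross_section:
  assumes p: "p \<in> borel_measurable N" and B0: "B0 \<in> sets N" and inv: "H_invariant Hs B0"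
    and pos: "\<And>\<xi>. \<xi> \<in> B0 \<Longrightarrow> 0 < orbit_weight p \<xi>" and fin: "\<And>\<xi>. \<xi> \<in> B0 \<Longrightarrow> orbit_weight p \<xi> < \<infinity>"
  obtains B C where "B \<subseteq> B0" "B \<in> sets N" "H_invariant Hs B" "emeasure N (B0 - B) = 0"
    "C \<subseteq> B" "C \<in> sets N" "\<And>\<xi>. \<xi> \<in> B \<Longrightarrow> \<exists>!\<eta>. \<eta> \<in> C \<inter> dual_orbit Hs \<xi>"
proof -
  interpret N: sigma_finite_measure N by (rule sigma_finite_N)
  interpret MH: sigma_finite_measure MH by (rule sigma_finite_MH)
  obtain i j where i[measurable]: "i \<in> borel_measurable N" and j[measurable]: "j \<in> (borel :: real measure) \<rightarrow>\<^sub>M N"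
    and ji: "\<And>\<xi>. \<xi> \<in> dual_group \<Longrightarrow> j (i \<xi>) = \<xi>" by (rule dual_standard_borel) blast
  note [measurable] = p
  note ow[measurable] = measurable_orbit_weight[OF p]
  have B0d: "B0 \<subseteq> dual_group" using sets.sets_into_space[OF B0] space_N by simp
  define \<Omega> where "\<Omega> = restrict_space N B0"
  have sp\<Omega>: "space \<Omega> = B0" using B0d by (auto simp: \<Omega>_def space_restrict_space space_N)
  have sf: "sigma_finite_measure \<Omega>" unfolding \<Omega>_def
    by (rule sigma_finite_measure_restrict_space[OF sigma_finite_N]) (use B0 in simp)
  define \<rho> where "\<rho> \<xi> h = ennreal ((cmod (p (\<xi> \<circ> h)))\<^sup>2) / orbit_weight p \<xi>" for \<xi> h
  \<comment> \<open>The normalized orbit measure, moved to the line by the coordinate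
    \<open>i\<close> so that it has a distribution function.\<close>
  define D where "D \<xi> = distr (density MH (\<rho> \<xi>)) (borel :: real measure) (\<lambda>h. i (\<xi> \<circ> h))" for \<xi>
  have om[measurable]: "(\<lambda>h. \<xi> \<circ> h) \<in> MH \<rightarrow>\<^sub>M N" if "\<xi> \<in> dual_group" for \<xi>
    using that by (intro measurable_dual_comp) (auto simp: space_N)
  have \<rho>m[measurable]: "\<rho> \<xi> \<in> borel_measurable MH" if "\<xi> \<in> dual_group" for \<xi>
    unfolding \<rho>_def using measurable_compose[OF om[OF that] p] by measurable
  have im[measurable]: "(\<lambda>h. i (\<xi> \<circ> h)) \<in> borel_measurable MH" if "\<xi> \<in> dual_group" for \<xi>
    by (rule measurable_compose[OF om[OF that] i])
  have emD: "emeasure (D \<xi>) A = (\<integral>\<^sup>+h. \<rho> \<xi> h * indicator A (i (\<xi> \<circ> h)) \<partial>MH)"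
    if \<xi>: "\<xi> \<in> dual_group" and A: "A \<in> sets borel" for \<xi> A
  proof -
    have s: "(\<lambda>h. i (\<xi> \<circ> h)) -` A \<inter> space MH \<in> sets MH" by (rule measurable_sets[OF im[OF \<xi>] A])
    have "emeasure (D \<xi>) A = emeasure (density MH (\<rho> \<xi>)) ((\<lambda>h. i (\<xi> \<circ> h)) -` A \<inter> space MH)"
      unfolding D_def using im[OF \<xi>] A by (simp add: emeasure_distr)
    also have "\<dots> = (\<integral>\<^sup>+h. \<rho> \<xi> h * indicator ((\<lambda>h. i (\<xi> \<circ> h)) -` A \<inter> space MH) h \<partial>MH)"
      using \<rho>m[OF \<xi>] s by (rule emeasure_density)
    also have "\<dots> = (\<integral>\<^sup>+h. \<rho> \<xi> h * indicator A (i (\<xi> \<circ> h)) \<partial>MH)"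
      by (intro nn_integral_cong) (simp add: indicator_def)
    finally show ?thesis .
  qed
  \<comment> \<open>Replacing \<xi> by \<open>\<xi> \<circ> g\<close> is a left translation of the
    integration variable, which leaves both the integral and the normalizing weight
    unchanged.\<close>
  have D_inv: "D (\<xi> \<circ> g) = D \<xi>" if \<xi>: "\<xi> \<in> dual_group" and g: "g \<in> Hs" for \<xi> g
  proof (rule measure_eqI)
    fix A assume "A \<in> sets (D (\<xi> \<circ> g))"
    then have A[measurable]: "A \<in> sets borel" by (simp add: D_def)
    have m: "(\<lambda>h. \<rho> \<xi> h * indicator A (i (\<xi> \<circ> h))) \<in> borel_measurable MH"
      using \<rho>m[OF \<xi>] measurable_compose[OF im[OF \<xi>], of "indicator A" borel] A
      by (intro borel_measurable_times_ennreal) auto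
    have "emeasure (D (\<xi> \<circ> g)) A = (\<integral>\<^sup>+h. \<rho> \<xi> (g \<circ> h) * indicator A (i (\<xi> \<circ> (g \<circ> h))) \<partial>MH)"
      unfolding emD[OF dual_comp[OF \<xi> g] A] \<rho>_def orbit_weight_comp[OF p \<xi> g] by (simp add: comp_assoc)
    also have "\<dots> = emeasure (D \<xi>) A" unfolding emD[OF \<xi> A] by (rule nn_integral_left_MH[OF g m])
    finally show "emeasure (D (\<xi> \<circ> g)) A = emeasure (D \<xi>) A" .
  qed (simp add: D_def)
  have D_prob: "real_distribution (D \<xi>)" if "\<xi> \<in> B0" for \<xi>
  proof -
    have \<xi>: "\<xi> \<in> dual_group" using that B0d by blast
    have U: "UNIV \<in> sets (borel :: real measure)" by simp
    have "emeasure (D \<xi>) UNIV = orbit_weight p \<xi> / orbit_weight p \<xi>"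
      unfolding emD[OF \<xi> U] \<rho>_def
      using measurable_compose[OF om[OF \<xi>] p] by (simp add: orbit_weight_def nn_integral_divide)
    also have "\<dots> = 1" using pos[OF that] fin[OF that] by (intro ennreal_divide_self) auto
    finally show ?thesis
      by (intro real_distribution.intro prob_spaceI real_distribution_axioms.intro) (auto simp: D_def)
  qed
  have cdf_m: "(\<lambda>\<xi>. cdf (D \<xi>) x) \<in> borel_measurable \<Omega>" for x
  proof -
    have "(\<lambda>\<xi>. enn2real (\<integral>\<^sup>+h. \<rho> \<xi> h * indicator {..x} (i (\<xi> \<circ> h)) \<partial>MH)) \<in> borel_measurable N"
      unfolding \<rho>_def by measurable
    then have "(\<lambda>\<xi>. enn2real (\<integral>\<^sup>+h. \<rho> \<xi> h * indicator {..x} (i (\<xi> \<circ> h)) \<partial>MH)) \<in> borel_measurable \<Omega>"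
      unfolding \<Omega>_def by (rule measurable_restrict_space1)
    moreover have "cdf (D \<xi>) x = enn2real (\<integral>\<^sup>+h. \<rho> \<xi> h * indicator {..x} (i (\<xi> \<circ> h)) \<partial>MH)" if "\<xi> \<in> space \<Omega>" for \<xi>
      using emD[of \<xi> "{..x}"] that B0d unfolding sp\<Omega> by (auto simp: cdf_def measure_def)
    ultimately show ?thesis by (simp cong: measurable_cong)
  qed
  define R where "R = {q \<in> space (N \<Otimes>\<^sub>M N). \<exists>g\<in>Hs. fst q \<circ> g = snd q}"
  have R[measurable]: "R \<in> sets (N \<Otimes>\<^sub>M N)" unfolding R_def by (rule orbit_relation_measurable)
  have id\<Omega>[measurable]: "(\<lambda>\<xi>. \<xi>) \<in> \<Omega> \<rightarrow>\<^sub>M N" unfolding \<Omega>_def by (intro measurable_restrict_space1) simp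
  have D_prob': "real_distribution (D \<xi>)" if "\<xi> \<in> space \<Omega>" for \<xi> using D_prob that by (simp add: sp\<Omega>)
  have Pm: "Measurable.pred (\<Omega> \<Otimes>\<^sub>M borel) (\<lambda>q. (fst q, j (snd q)) \<in> R)" by measurable
  have AE_R: "AE y in D \<xi>. (fst (\<xi>, y), j (snd (\<xi>, y))) \<in> R" if \<xi>\<Omega>: "\<xi> \<in> space \<Omega>" for \<xi>
  proof -
    have \<xi>: "\<xi> \<in> dual_group" using \<xi>\<Omega> B0d sp\<Omega> by blast
    have pm: "Measurable.pred borel (\<lambda>y. (\<xi>, j y) \<in> R)"
    proof -
      have "(\<lambda>y. (\<xi>, j y)) \<in> borel \<rightarrow>\<^sub>M N \<Otimes>\<^sub>M N" using \<xi> by (intro measurable_Pair) (auto simp: space_N)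
      then show ?thesis by (rule measurable_compose) measurable
    qed
    have "(\<xi>, j (i (\<xi> \<circ> h))) \<in> R" if "h \<in> Hs" for h
      using \<xi> dual_comp[OF \<xi> that] that ji[OF dual_comp[OF \<xi> that]]
        by (auto simp: R_def space_pair_measure space_N)
    then have "AE h in density MH (\<rho> \<xi>). (\<xi>, j (i (\<xi> \<circ> h))) \<in> R"
      by (intro AE_I2) (simp add: space_MH)
    then show ?thesis unfolding D_def using im[OF \<xi>] pm
      by (subst AE_distr_iff) (auto simp: pred_def)
  qed
  obtain s where s[measurable]: "s \<in> borel_measurable \<Omega>" and s_eq: "\<And>\<xi> \<eta>. D \<xi> = D \<eta> \<Longrightarrow> s \<xi> = s \<eta>"
    and s_R: "AE \<xi> in \<Omega>. (fst (\<xi>, s \<xi>), j (snd (\<xi>, s \<xi>))) \<in> R"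
    by (rule random_selection[OF sf D_prob' cdf_m Pm AE_R]) (assumption | rule that)+
  define c where "c \<xi> = j (s \<xi>)" for \<xi>
  have cm[measurable]: "c \<in> \<Omega> \<rightarrow>\<^sub>M N" unfolding c_def by measurable
  \<comment> \<open>The points whose own orbit contains the selected point. The selection is
    constant on orbits, so this set is invariant.\<close>
  define B where "B = {\<xi> \<in> space \<Omega>. (\<xi>, c \<xi>) \<in> R}"
  \<comment> \<open>The fixed points of \<open>c\<close>. Equality of characters is tested through
    \<open>i\<close>, which is injective on the dual since \<open>j\<close> undoes it; this makes
    the set measurable.\<close>
  define C where "C = {\<xi> \<in> space \<Omega>. (\<xi>, c \<xi>) \<in> R \<and> i (c \<xi>) = i \<xi>}"
  have cR: "Measurable.pred \<Omega> (\<lambda>\<xi>. (\<xi>, c \<xi>) \<in> R)"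
    by (rule measurable_compose[OF measurable_Pair[OF id\<Omega> cm]]) measurable
  have "B \<in> sets \<Omega>" unfolding B_def using cR by (simp add: pred_def)
  moreover have "C = B \<inter> {\<xi> \<in> space \<Omega>. i (c \<xi>) = i \<xi>}" by (auto simp: B_def C_def)
  moreover have "{\<xi> \<in> space \<Omega>. i (c \<xi>) = i \<xi>} \<in> sets \<Omega>"
    by (rule borel_measurable_eq[OF measurable_compose[OF cm i] measurable_compose[OF id\<Omega> i]])
  ultimately have "B \<in> sets \<Omega>" "C \<in> sets \<Omega>" by simp_all
  then have BN: "B \<in> sets N" and CN: "C \<in> sets N"
    unfolding \<Omega>_def using B0 by (auto simp: sets_restrict_space_iff)
  have BB0: "B \<subseteq> B0" by (auto simp: B_def sp\<Omega>)
  have c_inv: "c (\<xi> \<circ> g) = c \<xi>" if "\<xi> \<in> dual_group" "g \<in> Hs" for \<xi> g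
    unfolding c_def by (simp add: s_eq[OF D_inv[OF that]])
  have c_dual: "c \<xi> \<in> dual_group" for \<xi> unfolding c_def using measurable_space[OF j] by (simp add: space_N)
  have B_iff: "\<xi> \<in> B \<longleftrightarrow> \<xi> \<in> B0 \<and> (\<exists>g\<in>Hs. \<xi> \<circ> g = c \<xi>)" for \<xi>
    using B0d c_dual by (auto simp: B_def sp\<Omega> R_def space_pair_measure space_N)
  have C_iff: "\<xi> \<in> C \<longleftrightarrow> \<xi> \<in> B \<and> c \<xi> = \<xi>" for \<xi>
    using ji[OF c_dual, of \<xi>] ji[of \<xi>] B0d by (auto simp: B_def C_def sp\<Omega>)
  have Binv: "H_invariant Hs B" unfolding H_invariant_def
  proof (intro ballI)
    fix \<xi> h assume \<xi>: "\<xi> \<in> B" and h: "h \<in> Hs"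
    obtain g where g: "g \<in> Hs" "\<xi> \<circ> g = c \<xi>" using \<xi> B_iff by blast
    have "\<xi> \<circ> h \<in> B0" using inv \<xi> h BB0 unfolding H_invariant_def by blast
    moreover have "(\<xi> \<circ> h) \<circ> (inv h \<circ> g) = c (\<xi> \<circ> h)"
    proof -
      have "(\<xi> \<circ> h) \<circ> (inv h \<circ> g) = \<xi> \<circ> (h \<circ> inv h) \<circ> g" by (simp add: comp_assoc)
      also have "\<dots> = c (\<xi> \<circ> h)" using Hs_inv_comp(2)[OF h] g(2) c_inv[OF _ h, of \<xi>] \<xi> BB0 B0d by auto
      finally show ?thesis .
    qed
    moreover have "inv h \<circ> g \<in> Hs" using g(1) h by (intro Hs_comp Hs_inv)
    ultimately show "\<xi> \<circ> h \<in> B" unfolding B_iff by blast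
  qed
  have null: "emeasure N (B0 - B) = 0"
  proof -
    have "AE \<xi> in \<Omega>. \<xi> \<in> B" using s_R AE_space by eventually_elim (auto simp: B_def c_def)
    then have "AE \<xi> in N. \<xi> \<in> B0 \<longrightarrow> \<xi> \<in> B" unfolding \<Omega>_def using B0 by (subst (asm) AE_restrict_space_iff) auto
    then have "AE \<xi> in N. \<not> \<xi> \<in> B0 - B" by eventually_elim auto
    then show ?thesis
      using AE_iff_measurable[of "B0 - B" N "\<lambda>\<xi>. \<not> \<xi> \<in> B0 - B"] B0 BN sets.sets_into_space[OF B0] by auto
  qed
  have uniq: "\<exists>!\<eta>. \<eta> \<in> C \<inter> dual_orbit Hs \<xi>" if \<xi>: "\<xi> \<in> B" for \<xi>
  proof -
    have d: "\<xi> \<in> dual_group" using \<xi> BB0 B0d by blast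
    obtain g where g: "g \<in> Hs" "\<xi> \<circ> g = c \<xi>" using \<xi> B_iff by blast
    have "c \<xi> \<in> B" using Binv \<xi> g unfolding H_invariant_def by metis
    moreover have "c (c \<xi>) = c \<xi>" using c_inv[OF d g(1)] g(2) by simp
    ultimately have "c \<xi> \<in> C \<inter> dual_orbit Hs \<xi>" using C_iff g(1) g(2)[symmetric]
      by (auto simp: dual_orbit_def)
    moreover have "\<eta> = c \<xi>" if \<eta>: "\<eta> \<in> C \<inter> dual_orbit Hs \<xi>" for \<eta>
    proof -
      obtain h where h: "h \<in> Hs" "\<eta> = \<xi> \<circ> h" using \<eta> by (auto simp: dual_orbit_def)
      have "c \<eta> = \<eta>" using \<eta> C_iff by blast
      then show ?thesis using c_inv[OF d h(1)] h(2) by simp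
    qed
    ultimately show ?thesis by blast
  qed
  show ?thesis
    by (rule that[OF BB0 BN Binv null _ CN uniq]) (use C_iff in auto)
qed

end

context quasi_regular_setup
begin

subsection \<open>From a cross-section to a weakly admissible vector\<close>

lemma mem_dual_orbit_iff: "\<eta> \<in> dual_orbit H \<xi> \<longleftrightarrow> (\<exists>g\<in>H. \<xi> \<circ> g = \<eta>)"
  unfolding dual_orbit_def by blast

text \<open>A function with Borel graph is Borel: the preimages of \<open>D\<close> and of its complement are the
  projections of Borel sets, hence are separated by a Borel set.\<close>

lemma cross_section_map_measurable:
  assumes B: "B \<in> sets N" and C: "C \<in> sets N"
    and uniq: "\<And>\<xi>. \<xi> \<in> B \<Longrightarrow> \<exists>!\<eta>. \<eta> \<in> C \<inter> dual_orbit Hs \<xi>"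
  obtains c where "c \<in> restrict_space N B \<rightarrow>\<^sub>M N" "\<And>\<xi>. \<xi> \<in> B \<Longrightarrow> c \<xi> \<in> C" "\<And>\<xi>. \<xi> \<in> B \<Longrightarrow> \<exists>g\<in>Hs. \<xi> \<circ> g = c \<xi>"
proof -
  obtain i j where i: "i \<in> borel_measurable N" and j: "j \<in> (borel :: real measure) \<rightarrow>\<^sub>M N"
    and ji: "\<And>\<xi>. \<xi> \<in> dual_group \<Longrightarrow> j (i \<xi>) = \<xi>" by (rule dual_standard_borel) blast
  have Bd: "B \<subseteq> dual_group" and Cd: "C \<subseteq> dual_group"
    using sets.sets_into_space[OF B] sets.sets_into_space[OF C] space_N by simp_all
  define R where "R = {q \<in> space (N \<Otimes>\<^sub>M N). \<exists>g\<in>Hs. fst q \<circ> g = snd q}"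
  have R: "R \<in> sets (N \<Otimes>\<^sub>M N)" unfolding R_def by (rule orbit_relation_measurable)
  define c where "c \<xi> = (THE \<eta>. \<eta> \<in> C \<inter> dual_orbit Hs \<xi>)" for \<xi>
  have c: "c \<xi> \<in> C" "c \<xi> \<in> dual_orbit Hs \<xi>" if "\<xi> \<in> B" for \<xi>
    using theI'[OF uniq[OF that]] by (auto simp: c_def)
  have c_eq: "\<eta> = c \<xi>" if "\<xi> \<in> B" "\<eta> \<in> C" "\<eta> \<in> dual_orbit Hs \<xi>" for \<xi> \<eta>
    using uniq[OF that(1)] c[OF that(1)] that by blast
  have orbit: "\<exists>g\<in>Hs. \<xi> \<circ> g = c \<xi>" if "\<xi> \<in> B" for \<xi>
    using c(2)[OF that] by (simp add: mem_dual_orbit_iff)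
  \<comment> \<open>On \<open>B\<close> times \<open>C\<close> the orbit relation is the graph of
    \<open>c\<close>. Its part with values in \<open>D\<close> is transported to the plane by
    \<open>j\<close>, where it is Borel.\<close>
  define P where "P D = (\<lambda>q. (j (fst q), j (snd q))) -` (R \<inter> (B \<times> (C \<inter> D)))" for D
  have P: "P D \<in> sets borel" if "D \<in> sets N" for D
  proof -
    have m: "(\<lambda>q. (j (fst q), j (snd q))) \<in> (borel \<Otimes>\<^sub>M borel) \<rightarrow>\<^sub>M N \<Otimes>\<^sub>M N"
      by (intro measurable_Pair measurable_compose[OF measurable_fst j] measurable_compose[OF measurable_snd j])
    have "R \<inter> (B \<times> (C \<inter> D)) \<in> sets (N \<Otimes>\<^sub>M N)" using R B C that by auto
    from measurable_sets[OF m this] show ?thesis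
      unfolding P_def borel_prod by (simp only: space_borel Int_UNIV_right)
  qed
  have P_iff: "(x, y) \<in> P D \<longleftrightarrow> j x \<in> B \<and> j y \<in> D \<and> j y = c (j x)" for x y D
    using c_eq[of "j x" "j y"] c(1)[of "j x"] orbit[of "j x"] Bd Cd
    by (auto simp: P_def R_def space_pair_measure space_N mem_dual_orbit_iff)
  have cm: "c \<in> restrict_space N B \<rightarrow>\<^sub>M N"
  proof (rule measurableI)
    show "c \<xi> \<in> space N" if "\<xi> \<in> space (restrict_space N B)" for \<xi>
      using that c(1) Cd by (auto simp: space_restrict_space space_N)
    fix D assume D: "D \<in> sets N"
    have "fst ` P D \<inter> fst ` P (space N - D) = {}" by (auto simp: P_iff)
    \<comment> \<open>Since \<open>c\<close> has a single value at each point, the graphs over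
      \<open>D\<close> and over its complement have disjoint projections. A Borel set separating
      them is, read through \<open>i\<close>, the preimage of \<open>D\<close>.\<close>
    then obtain S where S: "S \<in> sets borel" "fst ` P D \<subseteq> S" "fst ` P (space N - D) \<inter> S = {}"
      using lusin_separation[OF P[OF D] P[OF sets.compl_sets[OF D]]] by blast
    have "c \<xi> \<in> D \<longleftrightarrow> i \<xi> \<in> S" if \<xi>: "\<xi> \<in> B" for \<xi>
    proof -
      have d: "\<xi> \<in> dual_group" "c \<xi> \<in> dual_group" using \<xi> Bd c(1)[OF \<xi>] Cd by auto
      have "(i \<xi>, i (c \<xi>)) \<in> P E \<longleftrightarrow> c \<xi> \<in> E" for E using \<xi> ji d by (simp add: P_iff)
      then have mem: "i \<xi> \<in> fst ` P E" if "c \<xi> \<in> E" for E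
        using that by (intro image_eqI[of _ _ "(i \<xi>, i (c \<xi>))"]) auto
      show ?thesis
      proof
        assume "c \<xi> \<in> D"
        then show "i \<xi> \<in> S" using mem S(2) by blast
      next
        assume "i \<xi> \<in> S"
        then have "i \<xi> \<notin> fst ` P (space N - D)" using S(3) by blast
        then have "c \<xi> \<notin> space N - D" using mem by blast
        then show "c \<xi> \<in> D" using d(2) space_N by simp
      qed
    qed
    then have "c -` D \<inter> space (restrict_space N B) = (i -` S \<inter> space N) \<inter> B"
      using Bd by (auto simp: space_restrict_space space_N)
    also have "\<dots> \<in> sets (restrict_space N B)"
      using measurable_sets[OF i S(1)] B by (auto simp: sets_restrict_space_iff)
    finally show "c -` D \<inter> space (restrict_space N B) \<in> sets (restrict_space N B)" .
  qed
  show ?thesis by (rule that[of c]) (use cm c(1) orbit in auto)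
qed

text \<open>Let \<open>h0\<close> carry \<xi> to its representative. The elements \<open>h\<close>
  with \<open>\<xi> \<circ> h\<close> in \<open>W\<close> include a neighbourhood of
  \<open>h0\<close>, which gives positive measure. They all lie in the product of the stabilizer,
  \<open>h0\<close> and the inverses of elements of \<open>L\<close>, which is compact because the
  stabilizer is; this gives finite measure.\<close>

lemma orbit_hitting_set:
  assumes B: "B \<in> sets N" and inv: "H_invariant Hs B" and C: "C \<in> sets N"
    and stab: "\<And>\<xi>. \<xi> \<in> B \<Longrightarrow> compactin TH (stabilizer Hs \<xi>)"
    and uniq: "\<And>\<xi>. \<xi> \<in> B \<Longrightarrow> \<exists>!\<eta>. \<eta> \<in> C \<inter> dual_orbit Hs \<xi>"
  obtains W where "W \<in> sets N" "W \<subseteq> B"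
    "\<And>\<xi>. \<xi> \<in> B \<Longrightarrow> 0 < emeasure MH {h \<in> Hs. \<xi> \<circ> h \<in> W}"
    "\<And>\<xi>. \<xi> \<in> B \<Longrightarrow> emeasure MH {h \<in> Hs. \<xi> \<circ> h \<in> W} < \<infinity>"
proof -
  obtain c where cm: "c \<in> restrict_space N B \<rightarrow>\<^sub>M N" and cC: "\<And>\<xi>. \<xi> \<in> B \<Longrightarrow> c \<xi> \<in> C"
    and c: "\<And>\<xi>. \<xi> \<in> B \<Longrightarrow> \<exists>g\<in>Hs. \<xi> \<circ> g = c \<xi>"
    by (rule cross_section_map_measurable[OF B C uniq]) blast+
  have Bd: "B \<subseteq> dual_group" and Cd: "C \<subseteq> dual_group"
    using sets.sets_into_space[OF B] sets.sets_into_space[OF C] space_N by simp_all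
  obtain U L where UL: "openin TH U" "compactin TH L" "id \<in> U" "U \<subseteq> L"
    using locally_compact_TH Hs_id topspace_TH unfolding locally_compact_space_def by blast
  have LH: "L \<subseteq> Hs" using UL(2) compactin_subset_topspace topspace_TH by blast
  define R where "R = {q \<in> space (N \<Otimes>\<^sub>M N). \<exists>g\<in>L. fst q \<circ> g = snd q}"
  have R: "R \<in> sets (N \<Otimes>\<^sub>M N)" unfolding R_def by (rule compact_orbit_relation_measurable[OF UL(2)])
  define W where "W = {\<xi> \<in> B. \<exists>g\<in>L. \<xi> \<circ> g = c \<xi>}"
  have "(\<lambda>\<xi>. \<xi>) \<in> restrict_space N B \<rightarrow>\<^sub>M N" by (intro measurable_restrict_space1) simp
  from measurable_sets[OF measurable_Pair[OF this cm] R]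
  have "(\<lambda>\<xi>. (\<xi>, c \<xi>)) -` R \<inter> space (restrict_space N B) \<in> sets (restrict_space N B)" .
  also have "(\<lambda>\<xi>. (\<xi>, c \<xi>)) -` R \<inter> space (restrict_space N B) = W"
    using Bd Cd cC by (auto simp: R_def W_def space_restrict_space space_pair_measure space_N)
  finally have WN: "W \<in> sets N" using B by (simp add: sets_restrict_space_iff)
  have c_inv: "c (\<xi> \<circ> g) = c \<xi>" if \<xi>: "\<xi> \<in> B" and g: "g \<in> Hs" for \<xi> g
  proof -
    have b: "\<xi> \<circ> g \<in> B" using inv \<xi> g unfolding H_invariant_def by blast
    obtain k where k: "k \<in> Hs" "(\<xi> \<circ> g) \<circ> k = c (\<xi> \<circ> g)" using c[OF b] by blast
    have "c (\<xi> \<circ> g) \<in> dual_orbit Hs \<xi>" unfolding dual_orbit_def using k g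
      by (auto intro!: exI[of _ "g \<circ> k"] Hs_comp simp: comp_assoc)
    moreover have "c \<xi> \<in> dual_orbit Hs \<xi>" using c[OF \<xi>] by (simp add: mem_dual_orbit_iff)
    ultimately show ?thesis using uniq[OF \<xi>] cC[OF b] cC[OF \<xi>] by blast
  qed
  have both: "0 < emeasure MH {h \<in> Hs. \<xi> \<circ> h \<in> W} \<and> emeasure MH {h \<in> Hs. \<xi> \<circ> h \<in> W} < \<infinity>" if \<xi>: "\<xi> \<in> B" for \<xi>
  proof -
    have d: "\<xi> \<in> dual_group" using \<xi> Bd by blast
    define T where "T = {h \<in> Hs. \<xi> \<circ> h \<in> W}"
    have "(\<lambda>h. \<xi> \<circ> h) \<in> MH \<rightarrow>\<^sub>M N" using d by (intro measurable_dual_comp) (auto simp: space_N)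
    from measurable_sets[OF this WN] have Tm: "T \<in> sets MH"
      by (simp add: T_def vimage_def space_MH Int_def conj_commute)
    obtain h0 where h0: "h0 \<in> Hs" "\<xi> \<circ> h0 = c \<xi>" using c[OF \<xi>] by blast
    have T_iff: "h \<in> T \<longleftrightarrow> h \<in> Hs \<and> (\<exists>g\<in>L. \<xi> \<circ> h \<circ> g = c \<xi>)" for h
      using c_inv[OF \<xi>, of h] inv \<xi> by (auto simp: T_def W_def H_invariant_def)
    \<comment> \<open>For such \<open>h\<close>, the element \<open>inv h \<circ> h0\<close> of
      \<open>L\<close> takes \<open>\<xi> \<circ> h\<close> to the representative.\<close>
    define O' where "O' = {h \<in> topspace TH. inv h \<circ> h0 \<in> U}"
    have "continuous_map TH TH (\<lambda>h. inv h \<circ> h0)"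
    proof -
      have "continuous_map TH (prod_topology TH TH) (\<lambda>h. (inv h, h0))"
        using h0(1) continuous_inv by (intro continuous_map_pairedI) (auto simp: topspace_TH)
      from continuous_map_compose[OF this continuous_comp] show ?thesis by (simp add: comp_def)
    qed
    then have O'o: "openin TH O'" unfolding O'_def by (rule openin_continuous_map_preimage[OF _ UL(1)])
    have "h0 \<in> O'" unfolding O'_def using h0(1) UL(3) Hs_inv_comp(1)[OF h0(1)] by (simp add: topspace_TH)
    then have "0 < emeasure MH O'" using emeasure_MH_open[OF O'o] by blast
    also have "\<dots> \<le> emeasure MH T"
    proof (rule emeasure_mono[OF _ Tm], rule subsetI)
      fix h assume "h \<in> O'"
      then have h: "h \<in> Hs" "inv h \<circ> h0 \<in> L" using UL(4) by (auto simp: O'_def topspace_TH)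
      have "\<xi> \<circ> h \<circ> (inv h \<circ> h0) = \<xi> \<circ> (h \<circ> inv h) \<circ> h0" by (simp add: comp_assoc)
      also have "\<dots> = c \<xi>" using Hs_inv_comp(2)[OF h(1)] h0(2) by simp
      finally show "h \<in> T" using h T_iff by blast
    qed
    finally have pos: "0 < emeasure MH T" .
    \<comment> \<open>If \<open>g\<close> in \<open>L\<close> takes \<open>\<xi> \<circ> h\<close>
      to the representative, then with \<open>k = g \<circ> inv h0\<close> the composite
      \<open>h \<circ> k\<close> stabilizes \<xi>, and \<open>h\<close> is recovered by composing
      with \<open>inv k\<close>.\<close>
    define Q where "Q = (\<lambda>(g, h). g \<circ> inv h) ` (stabilizer Hs \<xi> \<times> (\<lambda>(g, h). g \<circ> inv h) ` (L \<times> {h0}))"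
    have "compactin TH {h0}" using h0(1) by (simp add: topspace_TH)
    then have Qc: "compactin TH Q" unfolding Q_def
      by (intro compactin_comp_inv stab[OF \<xi>] UL(2))
    have "T \<subseteq> Q"
    proof
      fix h assume "h \<in> T"
      then obtain g where g: "h \<in> Hs" "g \<in> L" "\<xi> \<circ> h \<circ> g = c \<xi>" using T_iff by blast
      have gH: "g \<in> Hs" using g LH by blast
      define k where "k = g \<circ> inv h0"
      have kH: "k \<in> Hs" unfolding k_def using gH h0(1) by (intro Hs_comp Hs_inv)
      have "\<xi> \<circ> (h \<circ> k) = (\<xi> \<circ> h \<circ> g) \<circ> inv h0" by (simp add: k_def comp_assoc)
      also have "\<dots> = \<xi> \<circ> (h0 \<circ> inv h0)" unfolding g(3) h0(2)[symmetric] by (simp add: comp_assoc)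
      also have "\<dots> = \<xi>" using Hs_inv_comp(2)[OF h0(1)] by simp
      finally have "h \<circ> k \<in> stabilizer Hs \<xi>" using Hs_comp[OF g(1) kH] by (simp add: stabilizer_def)
      moreover have "h = (h \<circ> k) \<circ> inv k" using Hs_inv_comp(2)[OF kH] by (simp add: comp_assoc)
      moreover have "k \<in> (\<lambda>(g, h). g \<circ> inv h) ` (L \<times> {h0})" unfolding k_def using g(2) by force
      ultimately show "h \<in> Q" unfolding Q_def by (intro image_eqI[of _ _ "(h \<circ> k, k)"]) auto
    qed
    moreover have "Q \<in> sets MH" unfolding sets_MH
      by (intro closedin_sets_borel_of compactin_imp_closedin Hausdorff_TH Qc)
    ultimately have "emeasure MH T \<le> emeasure MH Q" by (intro emeasure_mono)
    also have "\<dots> < \<infinity>" by (rule emeasure_MH_compact[OF Qc])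
    finally show ?thesis using pos unfolding T_def by simp
  qed
  show ?thesis by (rule that[OF WN]) (use both in \<open>auto simp: W_def\<close>)
qed

text \<open>The vector has to be square-integrable over the whole dual and at the same time to have
  positive, bounded weight on each orbit. The first demand is met by a cut-off with an integrable
  function, the second by division by the orbit weight of \<open>W\<close>. The bound 1 for the
  resulting weight gives the operator bound 1, and its positivity gives injectivity.\<close>

lemma exists_weakly_admissible:
  assumes X: "X \<in> sets N" and B: "B \<in> sets N" "B \<subseteq> X" and inv: "H_invariant Hs B" and null: "emeasure N (X - B) = 0"
    and C: "C \<in> sets N" and stab: "\<And>\<xi>. \<xi> \<in> B \<Longrightarrow> compactin TH (stabilizer Hs \<xi>)"
    and uniq: "\<And>\<xi>. \<xi> \<in> B \<Longrightarrow> \<exists>!\<eta>. \<eta> \<in> C \<inter> dual_orbit Hs \<xi>"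
  shows "\<exists>\<psi>. weakly_admissible M MH (H_space M N X) \<psi>"
proof -
  interpret N: sigma_finite_measure N by (rule sigma_finite_N)
  interpret MH: sigma_finite_measure MH by (rule sigma_finite_MH)
  interpret NH: pair_sigma_finite N MH ..
  obtain W where W[measurable]: "W \<in> sets N" and WB: "W \<subseteq> B"
    and Wpos: "\<And>\<xi>. \<xi> \<in> B \<Longrightarrow> 0 < emeasure MH {h \<in> Hs. \<xi> \<circ> h \<in> W}"
    and Wfin: "\<And>\<xi>. \<xi> \<in> B \<Longrightarrow> emeasure MH {h \<in> Hs. \<xi> \<circ> h \<in> W} < \<infinity>"
    by (rule orbit_hitting_set[OF B(1) inv C stab uniq]) blast+
  have Bd: "B \<subseteq> dual_group" using sets.sets_into_space[OF B(1)] space_N by simp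
  have Binv: "\<xi> \<circ> h \<in> B" if "\<xi> \<in> B" "h \<in> Hs" for \<xi> h using inv that unfolding H_invariant_def by blast
  define q where "q \<xi> = (indicator W \<xi> :: complex)" for \<xi>
  have q[measurable]: "q \<in> borel_measurable N" unfolding q_def by measurable
  have q_sq: "ennreal ((cmod (q \<xi>))\<^sup>2) = indicator W \<xi>" for \<xi> by (simp add: q_def indicator_def)
  \<comment> \<open>This is the weight of the indicator of \<open>W\<close>, from which
    \<open>p\<close> is built, and not the weight of \<open>p\<close> itself.\<close>
  define \<Phi> where "\<Phi> = orbit_weight q"
  have \<Phi>m[measurable]: "\<Phi> \<in> borel_measurable N" unfolding \<Phi>_def by (rule measurable_orbit_weight[OF q])
  have Tm: "{h \<in> Hs. \<xi> \<circ> h \<in> W} \<in> sets MH" if "\<xi> \<in> B" for \<xi>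
  proof -
    have "(\<lambda>h. \<xi> \<circ> h) \<in> MH \<rightarrow>\<^sub>M N" using that Bd by (intro measurable_dual_comp) (auto simp: space_N)
    from measurable_sets[OF this W] show ?thesis by (simp add: vimage_def space_MH Int_def conj_commute)
  qed
  have \<Phi>: "\<Phi> \<xi> = emeasure MH {h \<in> Hs. \<xi> \<circ> h \<in> W}" if "\<xi> \<in> B" for \<xi>
  proof -
    have "\<Phi> \<xi> = (\<integral>\<^sup>+h. indicator {h \<in> Hs. \<xi> \<circ> h \<in> W} h \<partial>MH)"
      unfolding \<Phi>_def orbit_weight_def q_sq by (intro nn_integral_cong) (simp add: indicator_def space_MH)
    also have "\<dots> = emeasure MH {h \<in> Hs. \<xi> \<circ> h \<in> W}" by (rule nn_integral_indicator[OF Tm[OF that]])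
    finally show ?thesis .
  qed
  have \<Phi>pos: "0 < \<Phi> \<xi>" "\<Phi> \<xi> < \<infinity>" if "\<xi> \<in> B" for \<xi> using \<Phi> Wpos Wfin that by simp_all
  obtain \<theta> where \<theta>[measurable]: "\<theta> \<in> borel_measurable N" and \<theta>int: "(\<integral>\<^sup>+\<xi>. \<theta> \<xi> \<partial>N) \<noteq> \<infinity>"
    and \<theta>: "\<And>\<xi>. \<xi> \<in> space N \<Longrightarrow> 0 < \<theta> \<xi> \<and> \<theta> \<xi> < \<infinity>"
    using N.Ex_finite_integrable_function by blast
  \<comment> \<open>The intended squared modulus of \<open>p\<close>. The bound by the strictly
    positive integrable function \<theta> makes it integrable; the bound by
    \<open>1 / \<Phi> \<xi>\<close> makes its integral over each orbit at most 1. Both are positive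
    on \<open>W\<close>, so no orbit in \<open>B\<close> loses its weight.\<close>
  define t where "t \<xi> = indicator W \<xi> * min (\<theta> \<xi>) (1 / \<Phi> \<xi>)" for \<xi>
  have t[measurable]: "t \<in> borel_measurable N" unfolding t_def by measurable
  have t_fin: "t \<xi> < \<infinity>" if "\<xi> \<in> space N" for \<xi> using \<theta>[OF that] by (auto simp: t_def indicator_def min_def)
  define p where "p \<xi> = complex_of_real (sqrt (enn2real (t \<xi>)))" for \<xi>
  have p[measurable]: "p \<in> borel_measurable N" unfolding p_def by measurable
  have p_sq: "ennreal ((cmod (p \<xi>))\<^sup>2) = t \<xi>" if "\<xi> \<in> space N" for \<xi>
    using t_fin[OF that] by (simp add: p_def ennreal_enn2real_if less_top)
  have "(\<integral>\<^sup>+\<xi>. ennreal ((cmod (p \<xi>))\<^sup>2) \<partial>N) \<le> (\<integral>\<^sup>+\<xi>. \<theta> \<xi> \<partial>N)"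
  proof (rule nn_integral_mono)
    show "ennreal ((cmod (p \<xi>))\<^sup>2) \<le> \<theta> \<xi>" if "\<xi> \<in> space N" for \<xi>
      unfolding p_sq[OF that] t_def by (auto simp: indicator_def)
  qed
  then have pL2: "p \<in> L2 N" using \<theta>int L2_iff_nn_integral[OF p] by (auto simp: less_top top_unique)
  obtain \<psi> where \<psi>: "is_fourier_L2 M N \<psi> p" by (rule fourier_L2_surj[OF pL2])
  have \<psi>H: "\<psi> \<in> H_space M N X"
    by (rule mem_H_space[OF \<psi>]) (use WB B(2) in \<open>auto simp: p_def t_def indicator_def\<close>)
  have ow: "orbit_weight p \<xi> = (\<integral>\<^sup>+h. t (\<xi> \<circ> h) \<partial>MH)" if "\<xi> \<in> B" for \<xi>
    unfolding orbit_weight_def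
    by (intro nn_integral_cong p_sq) (use that Bd dual_comp in \<open>auto simp: space_N space_MH\<close>)
  have om: "(\<lambda>h. \<xi> \<circ> h) \<in> MH \<rightarrow>\<^sub>M N" if "\<xi> \<in> B" for \<xi>
    using that Bd by (intro measurable_dual_comp) (auto simp: space_N)
  have \<Phi>_inv: "\<Phi> (\<xi> \<circ> h) = \<Phi> \<xi>" if "\<xi> \<in> B" "h \<in> Hs" for \<xi> h
    unfolding \<Phi>_def using that Bd by (intro orbit_weight_comp[OF q]) auto
  have ow_le: "orbit_weight p \<xi> \<le> 1" if \<xi>: "\<xi> \<in> B" for \<xi>
  proof -
    have "orbit_weight p \<xi> \<le> (\<integral>\<^sup>+h. ennreal ((cmod (q (\<xi> \<circ> h)))\<^sup>2) / \<Phi> \<xi> \<partial>MH)"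
      unfolding ow[OF \<xi>]
    proof (rule nn_integral_mono)
      fix h assume "h \<in> space MH"
      then have "\<Phi> (\<xi> \<circ> h) = \<Phi> \<xi>" using \<Phi>_inv[OF \<xi>] by (simp add: space_MH)
      then show "t (\<xi> \<circ> h) \<le> ennreal ((cmod (q (\<xi> \<circ> h)))\<^sup>2) / \<Phi> \<xi>"
        unfolding q_sq t_def by (auto simp: indicator_def)
    qed
    also have "\<dots> = \<Phi> \<xi> / \<Phi> \<xi>"
      using measurable_compose[OF om[OF \<xi>] q] by (simp add: nn_integral_divide \<Phi>_def orbit_weight_def)
    also have "\<dots> = 1" using \<Phi>pos[OF \<xi>] by (intro ennreal_divide_self) auto
    finally show ?thesis .
  qed
  have ow_pos: "0 < orbit_weight p \<xi>" if \<xi>: "\<xi> \<in> B" for \<xi>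
  proof (rule ccontr)
    assume "\<not> 0 < orbit_weight p \<xi>"
    then have "(\<integral>\<^sup>+h. t (\<xi> \<circ> h) \<partial>MH) = 0" using ow[OF \<xi>] by (simp add: zero_less_iff_neq_zero)
    then have "AE h in MH. t (\<xi> \<circ> h) = 0"
      using measurable_compose[OF om[OF \<xi>] t] by (simp add: nn_integral_0_iff_AE)
    then have "AE h in MH. h \<notin> {h \<in> Hs. \<xi> \<circ> h \<in> W}"
    proof (rule AE_mp, intro AE_I2 impI)
      fix h assume h: "h \<in> space MH" and z: "t (\<xi> \<circ> h) = 0"
      have hH: "h \<in> Hs" using h by (simp add: space_MH)
      have b: "\<xi> \<circ> h \<in> B" by (rule Binv[OF \<xi> hH])
      have "0 < \<theta> (\<xi> \<circ> h)" using \<theta> b Bd by (auto simp: space_N)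
      moreover have "1 / \<Phi> (\<xi> \<circ> h) \<noteq> 0" using \<Phi>pos[OF b] by (auto simp: ennreal_divide_eq_0_iff)
      ultimately have "min (\<theta> (\<xi> \<circ> h)) (1 / \<Phi> (\<xi> \<circ> h)) \<noteq> 0" by (auto simp: min_def)
      then show "h \<notin> {h \<in> Hs. \<xi> \<circ> h \<in> W}" using z by (auto simp: t_def indicator_def)
    qed
    then have "emeasure MH {h \<in> Hs. \<xi> \<circ> h \<in> W} = 0"
      using AE_iff_measurable[of "{h \<in> Hs. \<xi> \<circ> h \<in> W}" MH "\<lambda>h. h \<notin> {h \<in> Hs. \<xi> \<circ> h \<in> W}"] Tm[OF \<xi>]
        by (auto simp: space_MH)
    then show False using Wpos[OF \<xi>] by simp
  qed
  have main: "voice M \<psi> f \<in> L2 (G_measure M MH) \<and> L2norm (G_measure M MH) (voice M \<psi> f) \<le> L2norm M f \<and>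
      ((AE x in G_measure M MH. voice M \<psi> f x = 0) \<longrightarrow> (AE x in M. f x = 0))" if f: "f \<in> H_space M N X" for f
  proof -
    obtain F where F: "is_fourier_L2 M N f F" and FX: "AE \<xi> in N. F \<xi> * indicator X \<xi> = F \<xi>"
      using f unfolding H_space_def by blast
    note L = is_fourier_L2D[OF F] is_fourier_L2D[OF \<psi>]
    have [measurable]: "f \<in> borel_measurable M" "\<psi> \<in> borel_measurable M" and Fm[measurable]: "F \<in> borel_measurable N"
      using L by (auto simp: L2_def)
    have vm: "voice M \<psi> f \<in> borel_measurable (G_measure M MH)"
      unfolding G_measure_def using measurable_voice[of f \<psi>] by simp
    have "AE \<xi> in N. \<not> \<xi> \<in> X - B"
      using AE_not_in[of "X - B" N] null X B(1) by (auto simp: null_sets_def)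
    then have FB: "AE \<xi> in N. F \<xi> = 0 \<or> \<xi> \<in> B" using FX
      by eventually_elim (auto simp: indicator_def split: if_splits)
    define I where "I = (\<integral>\<^sup>+\<xi>. ennreal ((cmod (F \<xi>))\<^sup>2) * orbit_weight p \<xi> \<partial>N)"
    have "I \<le> (\<integral>\<^sup>+\<xi>. ennreal ((cmod (F \<xi>))\<^sup>2) \<partial>N)" unfolding I_def
    proof (rule nn_integral_mono_AE)
      show "AE \<xi> in N. ennreal ((cmod (F \<xi>))\<^sup>2) * orbit_weight p \<xi> \<le> ennreal ((cmod (F \<xi>))\<^sup>2)"
        using FB
      proof eventually_elim
        case (elim \<xi>)
        then show ?case using mult_left_mono[OF ow_le[of \<xi>], of "ennreal ((cmod (F \<xi>))\<^sup>2)"] by auto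
      qed
    qed
    also have "\<dots> = ennreal ((L2norm M f)\<^sup>2)"
      using ennreal_L2norm_sq[OF L(2)] fourier_L2_norm[OF F] by simp
    finally have I_le: "I \<le> ennreal ((L2norm M f)\<^sup>2)" .
    have Fubini: "(\<integral>\<^sup>+h. (\<integral>\<^sup>+\<xi>. ennreal ((cmod (F \<xi> * cnj (p (\<xi> \<circ> h))))\<^sup>2) \<partial>N) \<partial>MH) = I"
    proof -
      have "(\<integral>\<^sup>+h. (\<integral>\<^sup>+\<xi>. ennreal ((cmod (F \<xi> * cnj (p (\<xi> \<circ> h))))\<^sup>2) \<partial>N) \<partial>MH) =
          (\<integral>\<^sup>+\<xi>. (\<integral>\<^sup>+h. ennreal ((cmod (F \<xi> * cnj (p (\<xi> \<circ> h))))\<^sup>2) \<partial>MH) \<partial>N)"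
        by (rule NH.Fubini') measurable
      also have "\<dots> = (\<integral>\<^sup>+\<xi>. (\<integral>\<^sup>+h. ennreal ((cmod (F \<xi>))\<^sup>2) * ennreal ((cmod (p (\<xi> \<circ> h)))\<^sup>2) \<partial>MH) \<partial>N)"
        by (simp add: norm_mult power_mult_distrib ennreal_mult)
      also have "\<dots> = I" unfolding I_def orbit_weight_def
        by (intro nn_integral_cong nn_integral_cmult) measurable
      finally show ?thesis .
    qed
    have "AE h in MH. (\<integral>\<^sup>+\<xi>. ennreal ((cmod (F \<xi> * cnj (p (\<xi> \<circ> h))))\<^sup>2) \<partial>N) \<noteq> \<infinity>"
    proof (rule nn_integral_PInf_AE)
      show "(\<lambda>h. \<integral>\<^sup>+\<xi>. ennreal ((cmod (F \<xi> * cnj (p (\<xi> \<circ> h))))\<^sup>2) \<partial>N) \<in> borel_measurable MH" by measurable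
      show "(\<integral>\<^sup>+h. (\<integral>\<^sup>+\<xi>. ennreal ((cmod (F \<xi> * cnj (p (\<xi> \<circ> h))))\<^sup>2) \<partial>N) \<partial>MH) \<noteq> \<infinity>"
        unfolding Fubini using I_le by (auto simp: top_unique)
    qed
    then have G2: "AE h in MH. (\<lambda>\<xi>. F \<xi> * cnj (p (\<xi> \<circ> h))) \<in> L2 N"
    proof (rule AE_mp, intro AE_I2 impI)
      fix h assume h: "h \<in> space MH" and fin: "(\<integral>\<^sup>+\<xi>. ennreal ((cmod (F \<xi> * cnj (p (\<xi> \<circ> h))))\<^sup>2) \<partial>N) \<noteq> \<infinity>"
      have "(\<lambda>\<xi>. p (\<xi> \<circ> h)) \<in> borel_measurable N"
        by (rule measurable_compose[OF measurable_comp_right p]) (use h in \<open>simp add: space_MH\<close>)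
      then have "(\<lambda>\<xi>. F \<xi> * cnj (p (\<xi> \<circ> h))) \<in> borel_measurable N" by measurable
      then show "(\<lambda>\<xi>. F \<xi> * cnj (p (\<xi> \<circ> h))) \<in> L2 N" using fin by (simp add: L2_iff_nn_integral less_top)
    qed
    have vI: "(\<integral>\<^sup>+x. ennreal ((cmod (voice M \<psi> f x))\<^sup>2) \<partial>G_measure M MH) = I"
      unfolding I_def by (rule nn_integral_voice[OF F \<psi> G2])
    have vL2: "voice M \<psi> f \<in> L2 (G_measure M MH)"
      unfolding L2_iff_nn_integral[OF vm] vI using I_le by (auto intro: le_less_trans)
    have "ennreal ((L2norm (G_measure M MH) (voice M \<psi> f))\<^sup>2) \<le> ennreal ((L2norm M f)\<^sup>2)"
      unfolding ennreal_L2norm_sq[OF vL2] vI by (rule I_le)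
    then have "(L2norm (G_measure M MH) (voice M \<psi> f))\<^sup>2 \<le> (L2norm M f)\<^sup>2"
      by (subst (asm) ennreal_le_iff) auto
    then have le: "L2norm (G_measure M MH) (voice M \<psi> f) \<le> L2norm M f"
      by (rule power2_le_imp_le) (rule L2norm_nonneg)
    have "AE x in M. f x = 0" if z: "AE x in G_measure M MH. voice M \<psi> f x = 0"
    proof -
      have "I = (\<integral>\<^sup>+x. 0 \<partial>G_measure M MH)" unfolding vI[symmetric]
      proof (rule nn_integral_cong_AE)
        show "AE x in G_measure M MH. ennreal ((cmod (voice M \<psi> f x))\<^sup>2) = 0"
          using z by eventually_elim simp
      qed
      then have I0: "I = 0" by simp
      note [measurable] = measurable_orbit_weight[OF p]
      have m: "(\<lambda>\<xi>. ennreal ((cmod (F \<xi>))\<^sup>2) * orbit_weight p \<xi>) \<in> borel_measurable N" by measurable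
      have "AE \<xi> in N. ennreal ((cmod (F \<xi>))\<^sup>2) * orbit_weight p \<xi> = 0"
        using I0 unfolding I_def nn_integral_0_iff_AE[OF m] .
      then have "AE \<xi> in N. F \<xi> = 0" using FB
      proof eventually_elim
        case (elim \<xi>)
        then show ?case using ow_pos[of \<xi>] by auto
      qed
      then show ?thesis using fourier_L2_eq_0_iff[OF F] by blast
    qed
    then show ?thesis using vL2 le by blast
  qed
  have "weakly_admissible M MH (H_space M N X) \<psi>"
    unfolding weakly_admissible_def using \<psi>H main by (auto intro!: exI[of _ 1])
  then show ?thesis by blast
qed

text \<open>Restriction to the points of positive finite weight loses a null set only and keeps
  invariance, because the weight is constant on orbits. There the stabilizers are compact and the
  selection argument applies; the two exceptional null sets add up.\<close>

lemma exists_cross_section: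
  assumes X: "X \<in> sets N" and inv: "H_invariant Hs X" and adm: "weakly_admissible M MH (H_space M N X) \<psi>"
  obtains B C where "B \<subseteq> X" "B \<in> sets N" "H_invariant Hs B" "emeasure N (X - B) = 0"
    "\<And>\<xi>. \<xi> \<in> B \<Longrightarrow> compactin TH (stabilizer Hs \<xi>)"
    "C \<subseteq> B" "C \<in> sets N" "\<And>\<xi>. \<xi> \<in> B \<Longrightarrow> \<exists>!\<eta>. \<eta> \<in> C \<inter> dual_orbit Hs \<xi>"
proof -
  have "\<psi> \<in> H_space M N X" using adm unfolding weakly_admissible_def by blast
  then obtain p where \<psi>: "is_fourier_L2 M N \<psi> p" unfolding H_space_def by blast
  have p: "p \<in> borel_measurable N" using is_fourier_L2D[OF \<psi>] by (simp add: L2_def)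
  note [measurable] = X measurable_orbit_weight[OF p]
  have Xd: "X \<subseteq> dual_group" using sets.sets_into_space[OF X] space_N by simp
  define B0 where "B0 = {\<xi> \<in> space N. \<xi> \<in> X \<and> 0 < orbit_weight p \<xi> \<and> orbit_weight p \<xi> < \<infinity>}"
  have B0: "B0 \<in> sets N" unfolding B0_def by measurable
  have B0X: "B0 \<subseteq> X" by (auto simp: B0_def)
  have inv0: "H_invariant Hs B0" unfolding H_invariant_def
  proof (intro ballI)
    fix \<xi> h assume \<xi>: "\<xi> \<in> B0" and h: "h \<in> Hs"
    have "\<xi> \<circ> h \<in> X" using inv \<xi> h B0X unfolding H_invariant_def by blast
    moreover have "orbit_weight p (\<xi> \<circ> h) = orbit_weight p \<xi>"
      using \<xi> B0X Xd h by (intro orbit_weight_comp[OF p]) auto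
    ultimately show "\<xi> \<circ> h \<in> B0" using \<xi> Xd by (auto simp: B0_def space_N)
  qed
  have "AE \<xi> in N. \<not> \<xi> \<in> X - B0"
    using weakly_admissible_orbit_weight[OF adm X \<psi>] AE_space by eventually_elim (auto simp: B0_def)
  then have null0: "emeasure N (X - B0) = 0"
    using AE_iff_measurable[of "X - B0" N "\<lambda>\<xi>. \<not> \<xi> \<in> X - B0"] X B0 sets.sets_into_space[OF X] by auto
  obtain B C where BC: "B \<subseteq> B0" "B \<in> sets N" "H_invariant Hs B" "emeasure N (B0 - B) = 0"
    "C \<subseteq> B" "C \<in> sets N" "\<And>\<xi>. \<xi> \<in> B \<Longrightarrow> \<exists>!\<eta>. \<eta> \<in> C \<inter> dual_orbit Hs \<xi>"
    by (rule orbit_cross_section[OF p B0 inv0]) (auto simp: B0_def)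
  have "emeasure N (X - B) = 0"
  proof -
    have "(X - B0) \<union> (B0 - B) \<in> null_sets N"
      using null0 BC(2,4) B0 X by (intro null_sets.Un) (auto simp: null_sets_def)
    moreover have "X - B = (X - B0) \<union> (B0 - B)" using BC(1) B0X by blast
    ultimately show ?thesis by (simp add: null_sets_def)
  qed
  moreover have "compactin TH (stabilizer Hs \<xi>)" if "\<xi> \<in> B" for \<xi>
    using that BC(1) by (intro compactin_stabilizer[OF _ p]) (auto simp: B0_def space_N)
  ultimately show ?thesis using that[of B C] BC B0X by auto
qed

end

theorem mainTheorem3:
  fixes M :: "'a::{ab_group_add, t2_space, second_countable_topology} measure"
    and N :: "('a \<Rightarrow> complex) measure"
    and Hs :: "('a \<Rightarrow> 'a) set" and TH :: "('a \<Rightarrow> 'a) topology" and MH :: "('a \<Rightarrow> 'a) measure"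
    and X :: "('a \<Rightarrow> complex) set"
  assumes "lca_group TYPE('a)"
    and "haar_measure_A M"
    and "plancherel_measure M N"
    and "automorphism_group Hs TH MH"
    and "X \<subseteq> dual_group" and "X \<in> sets N" and "H_invariant Hs X"
  shows "(\<exists>\<psi>. weakly_admissible M MH (H_space M N X) \<psi>) \<longleftrightarrow>
    (\<exists>B. B \<subseteq> X \<and> B \<in> sets N \<and> H_invariant Hs B \<and> emeasure N (X - B) = 0 \<and>
         (\<forall>\<xi> \<in> B. compactin TH (stabilizer Hs \<xi>)) \<and>
         (\<exists>C. C \<subseteq> B \<and> C \<in> sets N \<and> (\<forall>\<xi> \<in> B. \<exists>!\<eta>. \<eta> \<in> C \<inter> dual_orbit Hs \<xi>)))"
    (is "?L \<longleftrightarrow> ?R")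
proof
  interpret quasi_regular_setup M N Hs TH MH
    using assms(1-4) by (rule quasi_regular_setup.intro)
  show ?R if adm: ?L
  proof -
    obtain \<psi> where \<psi>: "weakly_admissible M MH (H_space M N X) \<psi>" using adm by blast
    obtain B C where BC: "B \<subseteq> X" "B \<in> sets N" "H_invariant Hs B" "emeasure N (X - B) = 0"
      "\<And>\<xi>. \<xi> \<in> B \<Longrightarrow> compactin TH (stabilizer Hs \<xi>)"
      "C \<subseteq> B" "C \<in> sets N" "\<And>\<xi>. \<xi> \<in> B \<Longrightarrow> \<exists>!\<eta>. \<eta> \<in> C \<inter> dual_orbit Hs \<xi>"
      by (rule exists_cross_section[OF assms(6,7) \<psi>]) blast
    have C: "\<exists>C. C \<subseteq> B \<and> C \<in> sets N \<and> (\<forall>\<xi> \<in> B. \<exists>!\<eta>. \<eta> \<in> C \<inter> dual_orbit Hs \<xi>)"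
      using BC(6,7,8) by (intro exI[of _ C] conjI ballI)
    show ?R by (rule exI[of _ B], intro conjI BC(1-4) C ballI BC(5); assumption)
  qed
  show ?L if cs: ?R
  proof -
    obtain B C where BC: "B \<subseteq> X" "B \<in> sets N" "H_invariant Hs B" "emeasure N (X - B) = 0"
      "\<forall>\<xi>\<in>B. compactin TH (stabilizer Hs \<xi>)" "C \<subseteq> B" "C \<in> sets N"
      "\<forall>\<xi>\<in>B. \<exists>!\<eta>. \<eta> \<in> C \<inter> dual_orbit Hs \<xi>"
      using cs by (elim exE conjE)
    show ?L by (rule exists_weakly_admissible[OF assms(6) BC(2,1,3,4,7) bspec[OF BC(5)] bspec[OF BC(8)]])
  qed
qed

end
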